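(* (a) Let $Q$ be a Dynkin quiver of any finite type, $i,j\in I$ and $k\ge 0$. For any $\langle\!\langle\alpha,\beta\rangle\!\rangle,\langle\!\langle\alpha',\beta'\rangle\!\rangle\in\Phi_Q(i,j)[k]$ one has $\deg_{[Q]}(\langle\!\langle\alpha,\beta\rangle\!\rangle)=\deg_{[Q]}(\langle\!\langle\alpha',\beta'\rangle\!\rangle)$. Thus the integer $\mathtt o_k^Q(i,j)$, defined as $\deg_{[Q]}(\langle\!\langle\alpha,\beta\rangle\!\rangle)$ if $\langle\!\langle\alpha,\beta\rangle\!\rangle\in\Phi_Q(i,j)[k]$ and as $0$ if $\Phi_Q(i,j)[k]=\emptyset$, is well defined. (b) Put $\mathtt O_k^Q(i,j)=\max(\mathtt o_k^Q(i,j),\mathtt o_k^{Q^*}(i,j))$. Let $\triangle$ be a Dynkin diagram of any finite type. For any two Dynkin quivers $Q,Q'$ with underlying diagram $\triangle$, one has $\mathtt O_k^Q(i,j)=\mathtt O_k^{Q'}(i,j)$ for all $i,j,k$.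
   Context: **Cartan data.** $\triangle$ has vertex set $I$, simple roots $\alpha_i$, fundamental weights $\varpi_i$, positive roots $\Phi^+$, Weyl group $W=\langle s_i\rangle$ with longest element $w_0$, involution $i\mapsto i^*$ with $w_0\alpha_i=-\alpha_{i^*}$, Coxeter number $\mathsf h$. $d(i,j)$ is the number of edges between $i$ and $j$ in $\triangle$ viewed as a graph (multiplicities ignored). **Dynkin quivers.** A Dynkin quiver $Q=(\triangle,\xi)$ is given by a height function $\xi:I\to\mathbb Z$ with $|\xi_i-\xi_j|=1$ whenever $d(i,j)=1$. $i$ is a source if $\xi_i>\xi_j$ for all neighbours $j$; then $s_iQ=(\triangle,s_i\xi)$, $(s_i\xi)_j=\xi_j-2\delta_{i,j}$. A reduced expression $s_{i_1}\cdots s_{i_l}$ is $Q$-adapted if $i_k$ is a source of $s_{i_{k-1}}\cdots s_{i_1}Q$ for all $k$. The $Q$-adapted reduced expressions of $w_0$ form one commutation class $[Q]$. $\tau_Q$ is the unique Coxeter element all of whose reduced expressions are $Q$-adapted; $\gamma_i^Q=(1-\tau_Q)\varpi_i$. $(\Gamma_Q)_0=\{(i,p)\in I\times\mathbb Z\mid p-\xi_i\in2\mathbb Z,\ \xi_{i^*}-\mathsf h<p\le\xi_i\}$ and $\phi_Q:(\Gamma_Q)_0\to\Phi^+$, $\phi_Q(i,p)=\tau_Q^{(\xi_i-p)/2}(\gamma_i^Q)$, is a bijection. $Q^*=(\triangle,\xi^* )$, $\xi^*_i=\xi_{i^*}$. **Orders and degree.** For a reduced expression $\underline w_0=s_{i_1}\cdots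 s_{i_\ell}$ of $w_0$ put $\beta_k=s_{i_1}\cdots s_{i_{k-1}}(\alpha_{i_k})$ and $\beta_a<_{\underline w_0}\beta_b$ iff $a<b$. $\alpha\prec_Q\beta$ iff $\alpha<_{\underline w_0}\beta$ for all $\underline w_0\in[Q]$. An exponent is $\underline m\in\mathbb Z_{\ge0}^{\Phi^+}$, of weight $\sum\underline m_\beta\beta$. $\underline m<^{\mathtt b}_{\underline w_0}\underline m'$ if they have equal weight, there is $\alpha$ with $\underline m_\alpha<\underline m'_\alpha$ and $\underline m_\beta=\underline m'_\beta$ for all $\beta<_{\underline w_0}\alpha$, and there is $\eta$ with $\underline m_\eta<\underline m'_\eta$ and $\underline m_\zeta=\underline m'_\zeta$ for all $\zeta>_{\underline w_0}\eta$. $\underline m\prec^{\mathtt b}_Q\underline m'$ if $\underline m<^{\mathtt b}_{\underline w_0}\underline m'$ for all $\underline w_0\in[Q]$. $\deg_{[Q]}(\underline m)$ is the largest $k\ge0$ with a chain $\underline m^{(0)}\prec^{\mathtt b}_Q\cdots\prec^{\mathtt b}_Q\underline m^{(k)}=\underline m$. A $[Q]$-pair $\langle\!\langle\alpha,\beta\rangle\!\rangle$ is given by $\alpha,\beta\in\Phi^+$ with $\beta\not\preceq_Q\alpha$, regarded as the exponent with value $1$ at $\alpha,\beta$ and $0$ elsewhere. $\Phi_Q(i,j)[k]$ is the set of $[Q]$-pairs $\langle\!\langle\alpha,\beta\rangle\!\rangle$ with $\{\alpha,\beta\}=\{\phi_Q(i,p),\phi_Q(j,s)\}$ for some $p,s$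 with $|p-s|=k$. *)

theory Defs
  imports "HOL-Analysis.Analysis"
begin

text \<open>
  The vertex set of the Dynkin diagram is the finite type \<open>'n\<close>, and the diagram is given by its
  Cartan matrix, with \<open>A $ i $ j = \<langle>h\<^sub>i, \<alpha>\<^sub>j\<rangle>\<close>.  The ambient space of roots and weights is
  \<open>real ^ 'n\<close>, a vector being identified with its coordinates in the basis of simple roots.
\<close>

definition adjacent :: "int ^ 'n ^ 'n \<Rightarrow> 'n \<Rightarrow> 'n \<Rightarrow> bool" where
  "adjacent A i j \<longleftrightarrow> i \<noteq> j \<and> A $ i $ j \<noteq> 0"

definition generalized_cartan_matrix :: "int ^ 'n ^ 'n \<Rightarrow> bool" where
  "generalized_cartan_matrix A \<longleftrightarrow>
     (\<forall>i. A $ i $ i = 2) \<and>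
     (\<forall>i j. i \<noteq> j \<longrightarrow> A $ i $ j \<le> 0) \<and>
     (\<forall>i j. A $ i $ j = 0 \<longrightarrow> A $ j $ i = 0)"

definition indecomposable :: "int ^ 'n ^ 'n \<Rightarrow> bool" where
  "indecomposable A \<longleftrightarrow> (\<forall>i j. (adjacent A)\<^sup>*\<^sup>* i j)"

definition symmetrizable_pos_def :: "int ^ 'n ^ 'n \<Rightarrow> bool" where
  "symmetrizable_pos_def A \<longleftrightarrow>
     (\<exists>d :: 'n::finite \<Rightarrow> real.
        (\<forall>i. 0 < d i) \<and>
        (\<forall>i j. d i * of_int (A $ i $ j) = d j * of_int (A $ j $ i)) \<and>
        (\<forall>v :: real ^ 'n. v \<noteq> 0 \<longrightarrow>
           0 < (\<Sum>i\<in>UNIV. \<Sum>j\<in>UNIV. d i * of_int (A $ i $ j) * v $ i * v $ j)))"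

text \<open>The Cartan matrices of the connected Dynkin diagrams of finite type (types A to G).\<close>

definition finite_type_cartan_matrix :: "int ^ 'n::finite ^ 'n \<Rightarrow> bool" where
  "finite_type_cartan_matrix A \<longleftrightarrow>
     generalized_cartan_matrix A \<and> indecomposable A \<and> symmetrizable_pos_def A"


section \<open>Weyl group and roots\<close>

definition simple_root :: "'n::finite \<Rightarrow> real ^ 'n" where
  "simple_root i = axis i 1"

definition coroot_pairing :: "int ^ 'n ^ 'n \<Rightarrow> 'n \<Rightarrow> real ^ 'n::finite \<Rightarrow> real" where
  "coroot_pairing A i v = (\<Sum>j\<in>UNIV. of_int (A $ i $ j) * v $ j)"

definition fundamental_weight :: "int ^ 'n ^ 'n \<Rightarrow> 'n \<Rightarrow> real ^ 'n::finite" where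
  "fundamental_weight A i =
     (THE v. \<forall>j. coroot_pairing A j v = (if j = i then 1 else 0))"

definition simple_reflection :: "int ^ 'n ^ 'n \<Rightarrow> 'n \<Rightarrow> real ^ 'n::finite \<Rightarrow> real ^ 'n" where
  "simple_reflection A i v = v - coroot_pairing A i v *\<^sub>R simple_root i"

text \<open>The product of the simple reflections of a word, the last letter acting first.\<close>

definition word_act :: "int ^ 'n ^ 'n \<Rightarrow> 'n list \<Rightarrow> real ^ 'n::finite \<Rightarrow> real ^ 'n" where
  "word_act A w = foldr (\<lambda>i f. simple_reflection A i \<circ> f) w id"

definition weyl_group :: "int ^ 'n ^ 'n \<Rightarrow> (real ^ 'n::finite \<Rightarrow> real ^ 'n) set" where
  "weyl_group A = range (word_act A)"

definition weyl_length :: "int ^ 'n ^ 'n \<Rightarrow> (real ^ 'n::finite \<Rightarrow> real ^ 'n) \<Rightarrow> nat" where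
  "weyl_length A g = (LEAST l. \<exists>w. word_act A w = g \<and> length w = l)"

definition reduced_expressions ::
    "int ^ 'n ^ 'n \<Rightarrow> (real ^ 'n::finite \<Rightarrow> real ^ 'n) \<Rightarrow> 'n list set" where
  "reduced_expressions A g = {w. word_act A w = g \<and> length w = weyl_length A g}"

definition longest_element :: "int ^ 'n ^ 'n \<Rightarrow> real ^ 'n::finite \<Rightarrow> real ^ 'n" where
  "longest_element A =
     (THE g. g \<in> weyl_group A \<and> (\<forall>g'\<in>weyl_group A. weyl_length A g' \<le> weyl_length A g))"

definition involution :: "int ^ 'n ^ 'n \<Rightarrow> 'n::finite \<Rightarrow> 'n" where
  "involution A i = (THE j. longest_element A (simple_root i) = - simple_root j)"

definition positive_roots :: "int ^ 'n ^ 'n \<Rightarrow> (real ^ 'n::finite) set" where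
  "positive_roots A =
     {g (simple_root i) |g i. g \<in> weyl_group A \<and> (\<forall>j. 0 \<le> g (simple_root i) $ j)}"

definition coxeter_elements :: "int ^ 'n ^ 'n \<Rightarrow> (real ^ 'n::finite \<Rightarrow> real ^ 'n) set" where
  "coxeter_elements A = {word_act A w |w. distinct w \<and> set w = UNIV}"

text \<open>The common order of the Coxeter elements (they are all conjugate).\<close>

definition coxeter_number :: "int ^ 'n::finite ^ 'n \<Rightarrow> nat" where
  "coxeter_number A = (LEAST h. 0 < h \<and> (\<forall>c\<in>coxeter_elements A. c ^^ h = id))"


section \<open>Dynkin quivers\<close>

text \<open>A Dynkin quiver on a fixed diagram is represented by its height function.\<close>

definition height_function :: "int ^ 'n ^ 'n \<Rightarrow> ('n \<Rightarrow> int) \<Rightarrow> bool" where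
  "height_function A \<xi> \<longleftrightarrow> (\<forall>i j. adjacent A i j \<longrightarrow> \<bar>\<xi> i - \<xi> j\<bar> = 1)"

definition is_source :: "int ^ 'n ^ 'n \<Rightarrow> ('n \<Rightarrow> int) \<Rightarrow> 'n \<Rightarrow> bool" where
  "is_source A \<xi> i \<longleftrightarrow> (\<forall>j. adjacent A i j \<longrightarrow> \<xi> j < \<xi> i)"

definition reflect_height :: "'n \<Rightarrow> ('n \<Rightarrow> int) \<Rightarrow> 'n \<Rightarrow> int" where
  "reflect_height i \<xi> = (\<lambda>j. \<xi> j - (if i = j then 2 else 0))"

fun adapted :: "int ^ 'n ^ 'n \<Rightarrow> ('n \<Rightarrow> int) \<Rightarrow> 'n list \<Rightarrow> bool" where
  "adapted A \<xi> [] \<longleftrightarrow> True"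
| "adapted A \<xi> (i # w) \<longleftrightarrow> is_source A \<xi> i \<and> adapted A (reflect_height i \<xi>) w"

text \<open>The commutation class \<open>[Q]\<close>.\<close>

definition commutation_class :: "int ^ 'n ^ 'n \<Rightarrow> ('n::finite \<Rightarrow> int) \<Rightarrow> 'n list set" where
  "commutation_class A \<xi> = {w \<in> reduced_expressions A (longest_element A). adapted A \<xi> w}"

definition coxeter_of_quiver ::
    "int ^ 'n ^ 'n \<Rightarrow> ('n \<Rightarrow> int) \<Rightarrow> real ^ 'n::finite \<Rightarrow> real ^ 'n" where
  "coxeter_of_quiver A \<xi> =
     (THE c. c \<in> coxeter_elements A \<and> (\<forall>w\<in>reduced_expressions A c. adapted A \<xi> w))"

definition gamma :: "int ^ 'n ^ 'n \<Rightarrow> ('n \<Rightarrow> int) \<Rightarrow> 'n \<Rightarrow> real ^ 'n::finite" where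
  "gamma A \<xi> i = fundamental_weight A i - coxeter_of_quiver A \<xi> (fundamental_weight A i)"

definition AR_vertices :: "int ^ 'n ^ 'n \<Rightarrow> ('n::finite \<Rightarrow> int) \<Rightarrow> ('n \<times> int) set" where
  "AR_vertices A \<xi> =
     {(i, p). even (p - \<xi> i) \<and> \<xi> (involution A i) - int (coxeter_number A) < p \<and> p \<le> \<xi> i}"

text \<open>Only used on \<open>AR_vertices A \<xi>\<close>, where the exponent is a natural number.\<close>

definition AR_coordinate ::
    "int ^ 'n ^ 'n \<Rightarrow> ('n \<Rightarrow> int) \<Rightarrow> 'n \<times> int \<Rightarrow> real ^ 'n::finite" where
  "AR_coordinate A \<xi> = (\<lambda>(i, p). (coxeter_of_quiver A \<xi> ^^ nat ((\<xi> i - p) div 2)) (gamma A \<xi> i))"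

definition dual_height :: "int ^ 'n ^ 'n \<Rightarrow> ('n::finite \<Rightarrow> int) \<Rightarrow> 'n \<Rightarrow> int" where
  "dual_height A \<xi> = (\<lambda>i. \<xi> (involution A i))"


section \<open>Orders on roots and exponents\<close>

text \<open>\<open>word_root A w k\<close> is the root \<open>\<beta>\<close> with index \<open>k + 1\<close>, as lists are indexed from 0.\<close>

definition word_root :: "int ^ 'n ^ 'n \<Rightarrow> 'n list \<Rightarrow> nat \<Rightarrow> real ^ 'n::finite" where
  "word_root A w k = word_act A (take k w) (simple_root (w ! k))"

definition word_less ::
    "int ^ 'n ^ 'n \<Rightarrow> 'n list \<Rightarrow> real ^ 'n::finite \<Rightarrow> real ^ 'n \<Rightarrow> bool" where
  "word_less A w \<alpha> \<beta> \<longleftrightarrow>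
     (\<exists>a b. a < b \<and> b < length w \<and> \<alpha> = word_root A w a \<and> \<beta> = word_root A w b)"

definition quiver_less ::
    "int ^ 'n ^ 'n \<Rightarrow> ('n \<Rightarrow> int) \<Rightarrow> real ^ 'n::finite \<Rightarrow> real ^ 'n \<Rightarrow> bool" where
  "quiver_less A \<xi> \<alpha> \<beta> \<longleftrightarrow> (\<forall>w\<in>commutation_class A \<xi>. word_less A w \<alpha> \<beta>)"

definition quiver_less_eq ::
    "int ^ 'n ^ 'n \<Rightarrow> ('n \<Rightarrow> int) \<Rightarrow> real ^ 'n::finite \<Rightarrow> real ^ 'n \<Rightarrow> bool" where
  "quiver_less_eq A \<xi> \<alpha> \<beta> \<longleftrightarrow> quiver_less A \<xi> \<alpha> \<beta> \<or> \<alpha> = \<beta>"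

text \<open>Exponents are functions on all vectors that vanish outside the positive roots.\<close>

definition exponents :: "int ^ 'n ^ 'n \<Rightarrow> (real ^ 'n::finite \<Rightarrow> nat) set" where
  "exponents A = {m. \<forall>\<beta>. \<beta> \<notin> positive_roots A \<longrightarrow> m \<beta> = 0}"

definition weight :: "int ^ 'n ^ 'n \<Rightarrow> (real ^ 'n::finite \<Rightarrow> nat) \<Rightarrow> real ^ 'n" where
  "weight A m = (\<Sum>\<beta>\<in>positive_roots A. real (m \<beta>) *\<^sub>R \<beta>)"

definition word_bless ::
    "int ^ 'n ^ 'n \<Rightarrow> 'n list \<Rightarrow> (real ^ 'n::finite \<Rightarrow> nat) \<Rightarrow> (real ^ 'n \<Rightarrow> nat) \<Rightarrow> bool" where
  "word_bless A w m m' \<longleftrightarrow>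
     weight A m = weight A m' \<and>
     (\<exists>\<alpha>\<in>positive_roots A. m \<alpha> < m' \<alpha> \<and>
        (\<forall>\<beta>\<in>positive_roots A. word_less A w \<beta> \<alpha> \<longrightarrow> m \<beta> = m' \<beta>)) \<and>
     (\<exists>\<eta>\<in>positive_roots A. m \<eta> < m' \<eta> \<and>
        (\<forall>\<zeta>\<in>positive_roots A. word_less A w \<eta> \<zeta> \<longrightarrow> m \<zeta> = m' \<zeta>))"

definition quiver_bless ::
    "int ^ 'n ^ 'n \<Rightarrow> ('n \<Rightarrow> int) \<Rightarrow> (real ^ 'n::finite \<Rightarrow> nat) \<Rightarrow> (real ^ 'n \<Rightarrow> nat) \<Rightarrow> bool" where
  "quiver_bless A \<xi> m m' \<longleftrightarrow> (\<forall>w\<in>commutation_class A \<xi>. word_bless A w m m')"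

definition exponent_deg ::
    "int ^ 'n ^ 'n \<Rightarrow> ('n \<Rightarrow> int) \<Rightarrow> (real ^ 'n::finite \<Rightarrow> nat) \<Rightarrow> nat" where
  "exponent_deg A \<xi> m =
     (GREATEST k. \<exists>c :: nat \<Rightarrow> real ^ 'n \<Rightarrow> nat.
        (\<forall>l\<le>k. c l \<in> exponents A) \<and> c k = m \<and>
        (\<forall>l<k. quiver_bless A \<xi> (c l) (c (Suc l))))"


section \<open>Pairs\<close>

definition pair_exponent :: "real ^ 'n::finite \<Rightarrow> real ^ 'n \<Rightarrow> real ^ 'n \<Rightarrow> nat" where
  "pair_exponent \<alpha> \<beta> = (\<lambda>\<gamma>. if \<gamma> = \<alpha> \<or> \<gamma> = \<beta> then 1 else 0)"

definition quiver_pairs ::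
    "int ^ 'n ^ 'n \<Rightarrow> ('n \<Rightarrow> int) \<Rightarrow> ((real ^ 'n::finite) \<times> (real ^ 'n)) set" where
  "quiver_pairs A \<xi> =
     {(\<alpha>, \<beta>). \<alpha> \<in> positive_roots A \<and> \<beta> \<in> positive_roots A \<and> \<not> quiver_less_eq A \<xi> \<beta> \<alpha>}"

text \<open>The set \<open>\<Phi>\<^sub>Q(i,j)[k]\<close>.\<close>

definition pairs_at_distance ::
    "int ^ 'n ^ 'n \<Rightarrow> ('n \<Rightarrow> int) \<Rightarrow> 'n \<Rightarrow> 'n \<Rightarrow> nat \<Rightarrow> ((real ^ 'n::finite) \<times> (real ^ 'n)) set" where
  "pairs_at_distance A \<xi> i j k =
     {(\<alpha>, \<beta>) \<in> quiver_pairs A \<xi>.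
        \<exists>p s. (i, p) \<in> AR_vertices A \<xi> \<and> (j, s) \<in> AR_vertices A \<xi> \<and> \<bar>p - s\<bar> = int k \<and>
              {\<alpha>, \<beta>} = {AR_coordinate A \<xi> (i, p), AR_coordinate A \<xi> (j, s)}}"

text \<open>
  \<open>is_o_value A \<xi> i j k d\<close> says that \<open>d\<close> is the integer \<open>o\<close> of \<open>Q, i, j, k\<close>; uniqueness of \<open>d\<close> is
  what makes \<open>o\<close> well defined.
\<close>

definition is_o_value ::
    "int ^ 'n::finite ^ 'n \<Rightarrow> ('n \<Rightarrow> int) \<Rightarrow> 'n \<Rightarrow> 'n \<Rightarrow> nat \<Rightarrow> nat \<Rightarrow> bool" where
  "is_o_value A \<xi> i j k d \<longleftrightarrow>
     (\<forall>(\<alpha>, \<beta>)\<in>pairs_at_distance A \<xi> i j k. d = exponent_deg A \<xi> (pair_exponent \<alpha> \<beta>)) \<and>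
     (pairs_at_distance A \<xi> i j k = {} \<longrightarrow> d = 0)"

definition o_value :: "int ^ 'n::finite ^ 'n \<Rightarrow> ('n \<Rightarrow> int) \<Rightarrow> 'n \<Rightarrow> 'n \<Rightarrow> nat \<Rightarrow> nat" where
  "o_value A \<xi> i j k = (THE d. is_o_value A \<xi> i j k d)"

definition O_value :: "int ^ 'n::finite ^ 'n \<Rightarrow> ('n \<Rightarrow> int) \<Rightarrow> 'n \<Rightarrow> 'n \<Rightarrow> nat \<Rightarrow> nat" where
  "O_value A \<xi> i j k = max (o_value A \<xi> i j k) (o_value A (dual_height A \<xi>) i j k)"

end

theory Submission
  imports Defs
begin

text \<open>
  For a height function \<open>\<xi>\<close>, extend the coordinates \<open>\<phi>\<^sub>Q\<close> to all \<open>p \<in> \<int>\<close> with \<open>p \<equiv> \<xi>\<^sub>i\<close> modulo 2.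
  The extension solves the mesh relations
  \<open>g(i, p + 1) + g(i, p - 1) = - \<Sum>\<^sub>j\<^sub>\<noteq>\<^sub>i A\<^sub>j\<^sub>i g(j, p)\<close>, and every solution is a linear function of it, because a
  solution is determined by its values on a slice.  Hence equality of weights of exponents supported on
  \<open>\<Gamma>\<^sub>Q\<close> can be tested on all solutions \<open>g\<close>, without reference to \<open>Q\<close>.  As the adapted words of the
  longest element are the linear extensions of \<open>\<Gamma>\<^sub>Q\<close>, the order on exponents, and with it the degree,
  becomes a notion on the repetition quiver that does not depend on \<open>Q\<close>.  The mesh relations are
  invariant under translation and under \<open>p \<mapsto> -p\<close>, and reversing the order does not change the
  bi-lexicographic order, so the degree of a pair depends only on \<open>i\<close>, \<open>j\<close> and \<open>|p - s|\<close>.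

  The shape of \<open>\<Gamma>\<^sub>Q\<close> is obtained for a bipartite quiver by evaluating a linear functional on the
  coordinates: for a Perron vector \<open>v\<close> of the diagram, with eigenvalue \<open>2 cos \<theta>\<close>, the function
  \<open>v\<^sub>i sin(\<theta>(c - p))\<close> solves the mesh relations, and the signs of the sine show when roots turn
  negative.  Other quivers follow by source reflections.

  A distance \<open>k\<close> realized for \<open>Q'\<close> but neither for \<open>Q\<close> nor for \<open>Q\<^sup>*\<close> either belongs to incomparable
  coordinates or satisfies \<open>k \<ge> h\<close>.  In the second case, reflect until the upper coordinate has just
  been passed: its root is then \<open>- \<alpha>\<^sub>i\<close>, all later roots are positive, and the lower one has
  \<open>\<alpha>\<^sub>i\<close>-coefficient 0, so no exponent supported in between has the weight of the pair.  In both cases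
  the degree is 0.
\<close>

subsection \<open>Linear extensions\<close>

text \<open>Two obstacles shape the development. First, \<open>longest_element\<close>,
  \<open>involution\<close>, \<open>coxeter_of_quiver\<close> and \<open>coxeter_number\<close> are
  given by description operators, so each has to be identified by an existence and uniqueness
  argument; the sign dichotomy of roots underlies these. Second, the strip
  \<open>AR_vertices\<close> ends at the height of \<open>star i\<close> minus the Coxeter number,
  and that the positive roots end exactly there must be shown uniformly in type. The number
  \<open>layers\<close> is at first only a rounded value of pi / angle. Because w0 permutes the
  simple roots up to sign, comparing the sines at both ends of the strip gives angle * layers = pi,
  and the same sine shows that no smaller power of all Coxeter elements is trivial. The maximum over
  Q and its dual in (b) has its origin at the same boundary. With h the Coxeter number, the lower
  end of the strip admits distance k with j on top for Q if k < h + \<xi> j - \<xi> (star i), and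
  with i on top for the dual if k < h - \<xi> j + \<xi> (star i). Whenever k < h, one of the two
  holds.\<close>

definition linear_extension :: "('a \<Rightarrow> 'a \<Rightarrow> bool) \<Rightarrow> 'a set \<Rightarrow> 'a list \<Rightarrow> bool" where
  "linear_extension R S L \<longleftrightarrow> distinct L \<and> set L = S \<and> sorted_wrt (\<lambda>x y. \<not> R y x) L"

lemma linear_extension_rev:
  "linear_extension R S L \<Longrightarrow> linear_extension (\<lambda>x y. R y x) S (rev L)"
  by (simp add: linear_extension_def sorted_wrt_rev)

text \<open>A down-set can be moved to the front, which makes everything before x lie below
  x.\<close>

lemma linear_extension_down_first:
  assumes "linear_extension R S L" "transp R"
  shows "linear_extension R S (filter (\<lambda>z. R z x) L @ filter (\<lambda>z. \<not> R z x) L)"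
  using assms by (auto simp: linear_extension_def sorted_wrt_append sorted_wrt_filter dest: transpD)

text \<open>The first difference along any extension is a minimal point of the difference set.
  Conversely, a given minimal point becomes the first difference once its down-set is listed first.
  A condition on all words thus becomes one on minimal points.\<close>

lemma first_difference_iff:
  fixes m m' :: "'a \<Rightarrow> nat"
  assumes R: "reflp R" "transp R" and ex: "\<exists>L. linear_extension R S L"
  shows "(\<forall>L. linear_extension R S L \<longrightarrow>
      (\<exists>u x v. L = u @ x # v \<and> m x < m' x \<and> (\<forall>y\<in>set u. m y = m' y))) \<longleftrightarrow>
    (\<exists>x\<in>S. m x \<noteq> m' x) \<and>
    (\<forall>x\<in>S. m x \<noteq> m' x \<longrightarrow> (\<forall>y\<in>S. m y \<noteq> m' y \<longrightarrow> R y x \<longrightarrow> y = x) \<longrightarrow> m x < m' x)"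
  (is "?L \<longleftrightarrow> ?R")
proof
  assume L: ?L
  have "\<exists>x\<in>S. m x \<noteq> m' x"
    using ex L by (fastforce simp: linear_extension_def)
  moreover have "m x < m' x" if x: "x \<in> S" "m x \<noteq> m' x" "\<forall>y\<in>S. m y \<noteq> m' y \<longrightarrow> R y x \<longrightarrow> y = x" for x
  proof -
    obtain L0 where L0: "linear_extension R S L0" using ex by blast
    define L1 where "L1 = filter (\<lambda>z. R z x) L0"
    define L2 where "L2 = filter (\<lambda>z. \<not> R z x) L0"
    obtain u z v where z: "L1 @ L2 = u @ z # v" "m z < m' z" "\<forall>y\<in>set u. m y = m' y"
      using L linear_extension_down_first [OF L0 R(2)] unfolding L1_def L2_def by blast
    have "x \<in> set L1" using x(1) L0 R(1) by (auto simp: L1_def linear_extension_def dest: reflpD)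
    then have "x \<notin> set u" using z(3) x(2) by auto
    \<comment> \<open>If the first difference came after all of \<open>L1\<close>, then
      \<open>u\<close> would contain x, where m and m' differ.\<close>
    have "z \<in> set L1"
    proof (rule ccontr)
      assume "z \<notin> set L1"
      obtain us where "L1 = u @ us \<and> us @ L2 = z # v \<or> L1 @ us = u \<and> L2 = us @ z # v"
        using z(1) unfolding append_eq_append_conv2 by blast
      then have "set L1 \<subseteq> set u" using \<open>z \<notin> set L1\<close> by (cases us) auto
      then show False using \<open>x \<in> set L1\<close> \<open>x \<notin> set u\<close> by blast
    qed
    then have "R z x" "z \<in> S" using L0 by (auto simp: L1_def linear_extension_def)
    then have "z = x" using x(3) z(2) by auto
    then show ?thesis using z(2) by simp
  qed
  ultimately show ?R by blast
next
  assume Rr: ?R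
  show ?L
  proof (intro allI impI)
    fix L assume L: "linear_extension R S L"
    then have "\<exists>x\<in>set L. m x \<noteq> m' x" using Rr by (auto simp: linear_extension_def)
    from split_list_first_prop [OF this]
    obtain u x v where uv: "L = u @ x # v" "m x \<noteq> m' x" "\<forall>y\<in>set u. \<not> m y \<noteq> m' y" by blast
    have "y = x" if "y \<in> S" "m y \<noteq> m' y" "R y x" for y
    proof (rule ccontr)
      assume "y \<noteq> x"
      then have "y \<in> set v" using that uv L by (auto simp: linear_extension_def)
      then show False using L uv(1) that(3) by (auto simp: linear_extension_def sorted_wrt_append)
    qed
    moreover have "x \<in> S" using uv(1) L by (auto simp: linear_extension_def)
    ultimately have "m x < m' x" using Rr uv(2) by blast
    then show "\<exists>u x v. L = u @ x # v \<and> m x < m' x \<and> (\<forall>y\<in>set u. m y = m' y)" using uv by blast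
  qed
qed

subsection \<open>Reflections and roots\<close>

locale finite_cartan =
  fixes A :: "int ^ 'n::finite ^ 'n" and d :: "'n \<Rightarrow> real"
  assumes diag: "A $ i $ i = 2"
    and offdiag: "i \<noteq> j \<Longrightarrow> A $ i $ j \<le> 0"
    and zero_sym: "A $ i $ j = 0 \<Longrightarrow> A $ j $ i = 0"
    and connected: "(adjacent A)\<^sup>*\<^sup>* i j"
    and d_pos: "0 < d i"
    and d_sym: "d i * of_int (A $ i $ j) = d j * of_int (A $ j $ i)"
    and pos_def: "v \<noteq> 0 \<Longrightarrow> 0 < (\<Sum>i\<in>UNIV. \<Sum>j\<in>UNIV. d i * of_int (A $ i $ j) * v $ i * (v :: real ^ 'n) $ j)"
begin

abbreviation pairing :: "'n \<Rightarrow> real ^ 'n \<Rightarrow> real" where "pairing \<equiv> coroot_pairing A"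
abbreviation srefl :: "'n \<Rightarrow> real ^ 'n \<Rightarrow> real ^ 'n" where "srefl \<equiv> simple_reflection A"
abbreviation act :: "'n list \<Rightarrow> real ^ 'n \<Rightarrow> real ^ 'n" where "act \<equiv> word_act A"

text \<open>The Weyl-invariant inner product; \<open>d i\<close> is half the squared length of
  \<open>simple_root i\<close>.\<close>

definition form :: "real ^ 'n \<Rightarrow> real ^ 'n \<Rightarrow> real" where
  "form u v = (\<Sum>i\<in>UNIV. \<Sum>j\<in>UNIV. d i * of_int (A $ i $ j) * u $ i * v $ j)"

lemma simple_root_nth [simp]: "(simple_root i :: real ^ 'n) $ j = (if j = i then 1 else 0)"
  by (simp add: simple_root_def axis_def)

lemma pairing_simple_root [simp]: "pairing i (simple_root j) = of_int (A $ i $ j)"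
  by (simp add: coroot_pairing_def if_distrib [of "\<lambda>x. _ * x"] cong: if_cong)

lemma linear_pairing: "linear (pairing i)"
  by (rule linearI)
     (simp_all add: coroot_pairing_def algebra_simps sum.distrib sum_distrib_left)

lemma pairing_simps [simp]:
  "pairing i (u + v) = pairing i u + pairing i v"
  "pairing i (u - v) = pairing i u - pairing i v"
  "pairing i (- v) = - pairing i v"
  "pairing i (c *\<^sub>R v) = c * pairing i v"
  "pairing i 0 = 0"
  "pairing i (sum f S) = (\<Sum>x\<in>S. pairing i (f x))"
  using linear_pairing [of i]
  by (simp_all add: linear_add linear_diff linear_neg linear_scale linear_0 linear_sum)

lemma srefl_eq: "srefl i v = v - pairing i v *\<^sub>R simple_root i"
  by (fact simple_reflection_def)

lemma linear_srefl: "linear (srefl i)"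
  by (rule linearI) (simp_all add: srefl_eq algebra_simps)

lemma srefl_nth: "srefl i v $ j = v $ j - (if j = i then pairing i v else 0)"
  by (simp add: srefl_eq)

lemma srefl_srefl [simp]: "srefl i (srefl i v) = v"
  by (simp add: srefl_eq diag)

lemma srefl_simple_root [simp]: "srefl i (simple_root i) = - simple_root i"
  by (simp add: srefl_eq diag scaleR_2)

lemma act_Nil [simp]: "act [] v = v" and act_Cons [simp]: "act (i # w) v = srefl i (act w v)"
  by (simp_all add: word_act_def)

lemma act_append [simp]: "act (u @ w) v = act u (act w v)"
  by (induction u) auto

lemma act_rev [simp]: "act (rev w) (act w v) = v" "act w (act (rev w) v) = v"
  by (induction w arbitrary: v) auto

lemma linear_act: "linear (act w)"
proof (induction w)
  case Nil
  have "act [] = (\<lambda>v. v)" by auto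
  then show ?case using linear_ident by simp
next
  case (Cons i w)
  have "act (i # w) = srefl i \<circ> act w" by auto
  then show ?case using linear_compose [OF Cons linear_srefl] by (simp only:)
qed

lemma act_simps [simp]:
  "act w (u + v) = act w u + act w v"
  "act w (u - v) = act w u - act w v"
  "act w (- v) = - act w v"
  "act w (c *\<^sub>R v) = c *\<^sub>R act w v"
  "act w 0 = 0"
  "act w (sum f S) = (\<Sum>x\<in>S. act w (f x))"
  using linear_act [of w]
  by (simp_all add: linear_add linear_diff linear_neg linear_scale linear_0 linear_sum)

lemma srefl_simps [simp]:
  "srefl i (u + v) = srefl i u + srefl i v"
  "srefl i (u - v) = srefl i u - srefl i v"
  "srefl i (- v) = - srefl i v"
  "srefl i (c *\<^sub>R v) = c *\<^sub>R srefl i v"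
  "srefl i 0 = 0"
  "srefl i (sum f S) = (\<Sum>x\<in>S. srefl i (f x))"
  using linear_srefl [of i]
  by (simp_all add: linear_add linear_diff linear_neg linear_scale linear_0 linear_sum)

lemma act_eq_iff [simp]: "act w u = act w v \<longleftrightarrow> u = v"
  by (metis act_rev(1))

lemma act_inverse: "act u = act w \<Longrightarrow> act (rev u) = act (rev w)"
  by (rule ext) (metis act_rev)

lemma act_nth_unchanged: "j \<notin> set w \<Longrightarrow> act w v $ j = v $ j"
  by (induction w) (auto simp: srefl_nth)

lemma vec_expand: "(v :: real ^ 'n) = (\<Sum>i\<in>UNIV. v $ i *\<^sub>R simple_root i)"
  by (simp add: vec_eq_iff if_distrib [of "\<lambda>x. _ * x"] cong: if_cong)

lemma form_commute: "form u v = form v u"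
proof -
  have "form u v = (\<Sum>i\<in>UNIV. \<Sum>j\<in>UNIV. d j * of_int (A $ j $ i) * u $ i * v $ j)"
    by (simp add: form_def d_sym)
  also have "\<dots> = form v u"
    unfolding form_def by (subst sum.swap) (simp add: mult_ac)
  finally show ?thesis .
qed

lemma form_pos: "v \<noteq> 0 \<Longrightarrow> 0 < form v v"
  using pos_def by (simp add: form_def)

lemma form_add_left: "form (u + u') v = form u v + form u' v"
  by (simp add: form_def algebra_simps sum.distrib)

lemma form_scale_left: "form (c *\<^sub>R u) v = c * form u v"
  by (simp add: form_def algebra_simps sum_distrib_left)

lemma form_diff_left: "form (u - u') v = form u v - form u' v"
  using form_add_left [of u "- 1 *\<^sub>R u'" v] form_scale_left [of "-1" u' v] by simp

lemma form_add_right: "form v (u + u') = form v u + form v u'"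
  by (metis form_commute form_add_left)

lemma form_scale_right: "form v (c *\<^sub>R u) = c * form v u"
  by (metis form_commute form_scale_left)

lemma form_diff_right: "form v (u - u') = form v u - form v u'"
  by (metis form_commute form_diff_left)

lemma form_simple_root: "form (simple_root i) v = d i * pairing i v"
proof -
  have "form (simple_root i) v
      = (\<Sum>k\<in>UNIV. if k = i then \<Sum>j\<in>UNIV. d k * of_int (A $ k $ j) * v $ j else 0)"
    unfolding form_def by (rule sum.cong) auto
  also have "\<dots> = d i * pairing i v"
    by (simp add: coroot_pairing_def sum_distrib_left mult.assoc)
  finally show ?thesis .
qed

lemma form_srefl: "form (srefl i u) (srefl i v) = form u v"
proof -
  have "form u (simple_root i) = d i * pairing i u"
    using form_simple_root form_commute by metis
  then show ?thesis
    by (simp add: srefl_eq form_diff_left form_diff_right form_scale_left form_scale_right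
        form_simple_root diag algebra_simps)
qed

lemma form_act: "form (act w u) (act w v) = form u v"
  by (induction w) (auto simp: form_srefl)

lemma pairing_eq_0:
  assumes "\<And>i. pairing i v = 0"
  shows "v = 0"
proof (rule ccontr)
  assume "v \<noteq> 0"
  moreover have "form v v = (\<Sum>i\<in>UNIV. v $ i * (d i * pairing i v))"
    unfolding form_def coroot_pairing_def sum_distrib_left by (simp add: mult_ac)
  ultimately show False using form_pos [of v] assms by simp
qed

lemma act_Ints: "(\<forall>j. v $ j \<in> \<int>) \<Longrightarrow> act w v $ j \<in> \<int>"
proof (induction w arbitrary: j)
  case (Cons i w)
  then have "pairing i (act w v) \<in> \<int>"
    unfolding coroot_pairing_def by (intro Ints_sum Ints_mult) auto
  with Cons show ?case by (auto simp: srefl_nth)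
qed auto

lemma act_simple_root_Ints: "act w (simple_root i) $ j \<in> \<int>"
  by (rule act_Ints) auto


subsection \<open>Roots are positive or negative\<close>

lemma cartan_product_less_4:
  assumes "i \<noteq> j"
  shows "A $ i $ j * A $ j $ i < 4"
proof -
  \<comment> \<open>Twice the component of \<open>simple_root j\<close> orthogonal to
    \<open>simple_root i\<close>; its squared length carries the factor 4 minus the product in
    question.\<close>
  define v :: "real ^ 'n" where
    "v = of_int (- A $ i $ j) *\<^sub>R simple_root i + 2 *\<^sub>R simple_root j"
  have "v $ j = 2" using assms by (simp add: v_def)
  then have "0 < form v v" by (intro form_pos) auto
  moreover have "form v v = 2 * d j * (4 - of_int (A $ i $ j * A $ j $ i))"
    using d_sym [of i j]
    by (simp add: v_def form_add_left form_add_right form_scale_left form_scale_right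
        form_diff_left form_diff_right form_simple_root diag algebra_simps)
  ultimately have "0 < 4 - real_of_int (A $ i $ j * A $ j $ i)"
    using d_pos [of j] by (simp add: zero_less_mult_iff)
  then show ?thesis by linarith
qed

lemma cartan_cases:
  assumes "i \<noteq> j"
  obtains "A $ i $ j = 0" "A $ j $ i = 0" | "A $ i $ j = -1" "A $ j $ i = -1"
  | "A $ i $ j = -1" "A $ j $ i = -2" | "A $ i $ j = -2" "A $ j $ i = -1"
  | "A $ i $ j = -1" "A $ j $ i = -3" | "A $ i $ j = -3" "A $ j $ i = -1"
proof -
  define a b where "a = - A $ i $ j" and "b = - A $ j $ i"
  have ab: "0 \<le> a" "0 \<le> b" "a * b < 4" "a = 0 \<longleftrightarrow> b = 0"
    using offdiag [of i j] offdiag [of j i] assms cartan_product_less_4 [OF assms]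
      zero_sym [of i j] zero_sym [of j i] by (auto simp: a_def b_def)
  have "a = 0 \<and> b = 0 \<or> a = 1 \<and> b = 1 \<or> a = 1 \<and> b = 2 \<or> a = 2 \<and> b = 1 \<or> a = 1 \<and> b = 3 \<or> a = 3 \<and> b = 1"
  proof (cases "a = 0")
    case False
    with ab have 1: "1 \<le> a" "1 \<le> b" by auto
    have "a * 1 \<le> a * b" "1 * b \<le> a * b" using 1 by (intro mult_mono; simp)+
    with ab have "a \<le> 3" "b \<le> 3" by linarith+
    with 1 have "a = 1 \<or> a = 2 \<or> a = 3" "b = 1 \<or> b = 2 \<or> b = 3" by linarith+
    with ab show ?thesis by auto
  qed (use ab in auto)
  then show thesis using that by (auto simp: a_def b_def)
qed

lemma weyl_length_le: "weyl_length A (act w) \<le> length w"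
  unfolding weyl_length_def by (rule Least_le) auto

lemma reduced_word_exists:
  obtains w' where "act w' = act w" "length w' = weyl_length A (act w)"
proof -
  have "\<exists>w'. act w' = act w \<and> length w' = weyl_length A (act w)"
    unfolding weyl_length_def by (rule LeastI) auto
  then show thesis using that by blast
qed

section \<open>Words in two letters and rank-two root systems\<close>

fun alternating :: "'n \<Rightarrow> 'n \<Rightarrow> nat \<Rightarrow> 'n list" where
  "alternating i j 0 = []"
| "alternating i j (Suc n) = alternating j i n @ [j]"

lemma length_alternating [simp]: "length (alternating i j n) = n"
  by (induction i j n rule: alternating.induct) auto

lemma set_alternating: "set (alternating i j n) \<subseteq> {i, j}"
  by (induction i j n rule: alternating.induct) auto

lemma alternating_split:
  "m \<le> n \<Longrightarrow> \<exists>pre. alternating i j n = pre @ alternating i j m \<and> set pre \<subseteq> {i, j}"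
proof (induction m arbitrary: i j n)
  case 0
  then show ?case using set_alternating by auto
next
  case (Suc m)
  then obtain n' where n: "n = Suc n'" "m \<le> n'" by (cases n) auto
  from Suc.IH [OF n(2), of j i] n show ?case by auto
qed

text \<open>Here m is the order of the product of the two reflections: 2, 3, 4 or 6 according to the
  Cartan integers. The witnesses p, q in each case are the coordinates of the images of
  \<open>simple_root i\<close>.\<close>

lemma braid_and_positivity:
  assumes "i \<noteq> j"
  obtains m where "0 < m" "act (alternating i j m) = act (alternating j i m)"
    "\<And>n. n < m \<Longrightarrow> \<exists>p q. 0 \<le> p \<and> 0 \<le> q \<and>
        act (alternating i j n) (simple_root i) = p *\<^sub>R simple_root i + q *\<^sub>R simple_root j"
proof -
  note that_orig = that
  \<comment> \<open>Vectors of this shape are closed under both reflections while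
    \<open>pairing i v\<close> and \<open>pairing j v\<close> stay symbolic, so the braid relation
    for arbitrary v becomes a comparison of two coefficients.\<close>
  have si: "srefl i (v - p *\<^sub>R simple_root i - q *\<^sub>R simple_root j) =
      v - (pairing i v - p - of_int (A $ i $ j) * q) *\<^sub>R simple_root i - q *\<^sub>R simple_root j" for v p q
    using assms by (simp add: vec_eq_iff srefl_nth diag)
  have sj: "srefl j (v - p *\<^sub>R simple_root i - q *\<^sub>R simple_root j) =
      v - p *\<^sub>R simple_root i - (pairing j v - q - of_int (A $ j $ i) * p) *\<^sub>R simple_root j" for v p q
    using assms by (simp add: vec_eq_iff srefl_nth diag)
  have braid: "act (alternating i j m) = act (alternating j i m)"
    if "\<And>v p q. act (alternating i j m) (v - p *\<^sub>R simple_root i - q *\<^sub>R simple_root j)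
      = act (alternating j i m) (v - p *\<^sub>R simple_root i - q *\<^sub>R simple_root j)" for m
  proof
    fix v
    show "act (alternating i j m) v = act (alternating j i m) v"
      using that [of v 0 0] by simp
  qed
  have alt_eqs: "alternating a b 0 = []" "alternating a b 1 = [b]" "alternating a b 2 = [a, b]"
    "alternating a b 3 = [b, a, b]" "alternating a b 4 = [a, b, a, b]"
    "alternating a b 5 = [b, a, b, a, b]" "alternating a b 6 = [a, b, a, b, a, b]" for a b
    by (simp_all add: numeral_eq_Suc)
  have si': "srefl i (p *\<^sub>R simple_root i + q *\<^sub>R simple_root j) =
      (- p - of_int (A $ i $ j) * q) *\<^sub>R simple_root i + q *\<^sub>R simple_root j" for p q
    using assms by (simp add: vec_eq_iff srefl_nth diag)
  have sj': "srefl j (p *\<^sub>R simple_root i + q *\<^sub>R simple_root j) =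
      p *\<^sub>R simple_root i + (- q - of_int (A $ j $ i) * p) *\<^sub>R simple_root j" for p q
    using assms by (simp add: vec_eq_iff srefl_nth diag)
  define plane where "plane m \<longleftrightarrow> act (alternating i j m) = act (alternating j i m)" for m
  define good where "good n \<longleftrightarrow> (\<exists>p q. 0 \<le> p \<and> 0 \<le> q \<and>
      act (alternating i j n) (simple_root i) = p *\<^sub>R simple_root i + q *\<^sub>R simple_root j)" for n
  have planeI: "plane m"
    if "\<And>v p q. act (alternating i j m) (v - p *\<^sub>R simple_root i - q *\<^sub>R simple_root j)
      = act (alternating j i m) (v - p *\<^sub>R simple_root i - q *\<^sub>R simple_root j)" for m
    unfolding plane_def by (rule braid, rule that)
  have goodI: "good n"
    if "act (alternating i j n) (1 *\<^sub>R simple_root i + 0 *\<^sub>R simple_root j)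
      = p *\<^sub>R simple_root i + q *\<^sub>R simple_root j" "0 \<le> p" "0 \<le> q" for n p q
    unfolding good_def using that by (intro exI [of _ p] exI [of _ q]) simp
  have lt: "(\<forall>n<2. P n) \<longleftrightarrow> P 0 \<and> P (1::nat)" "(\<forall>n<3. P n) \<longleftrightarrow> P 0 \<and> P 1 \<and> P (2::nat)"
    "(\<forall>n<4. P n) \<longleftrightarrow> P 0 \<and> P 1 \<and> P 2 \<and> P (3::nat)"
    "(\<forall>n<6. P n) \<longleftrightarrow> P 0 \<and> P 1 \<and> P 2 \<and> P 3 \<and> P 4 \<and> P (5::nat)" for P
    by (simp_all add: numeral_eq_Suc All_less_Suc conj_ac)
  have result: thesis if "0 < m" "plane m" "\<forall>n<m. good n" for m
    using that that_orig unfolding plane_def good_def by blast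
  note compute = act_Cons act_Nil si sj
  note compute' = act_Cons act_Nil si' sj'
  show thesis
    using assms
  proof (cases rule: cartan_cases)
    case 1
    have "plane 2"
      by (rule planeI) (simp only: alt_eqs compute, simp add: 1 algebra_simps)
    moreover have "good 0"
      by (rule goodI [where p = 1 and q = 0]) (simp only: alt_eqs compute', simp_all add: 1)
    moreover have "good 1"
      by (rule goodI [where p = 1 and q = 0]) (simp only: alt_eqs compute', simp_all add: 1)
    ultimately show thesis
      by (intro result [of 2]) (simp_all add: lt)
  next
    case 2
    have "plane 3"
      by (rule planeI) (simp only: alt_eqs compute, simp add: 2 algebra_simps)
    moreover have "good 0"
      by (rule goodI [where p = 1 and q = 0]) (simp only: alt_eqs compute', simp_all add: 2)
    moreover have "good 1"
      by (rule goodI [where p = 1 and q = 1]) (simp only: alt_eqs compute', simp_all add: 2)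
    moreover have "good 2"
      by (rule goodI [where p = 0 and q = 1]) (simp only: alt_eqs compute', simp_all add: 2)
    ultimately show thesis
      by (intro result [of 3]) (simp_all add: lt)
  next
    case 3
    have "plane 4"
      by (rule planeI) (simp only: alt_eqs compute, simp add: 3 algebra_simps)
    moreover have "good 0"
      by (rule goodI [where p = 1 and q = 0]) (simp only: alt_eqs compute', simp_all add: 3)
    moreover have "good 1"
      by (rule goodI [where p = 1 and q = 2]) (simp only: alt_eqs compute', simp_all add: 3)
    moreover have "good 2"
      by (rule goodI [where p = 1 and q = 2]) (simp only: alt_eqs compute', simp_all add: 3)
    moreover have "good 3"
      by (rule goodI [where p = 1 and q = 0]) (simp only: alt_eqs compute', simp_all add: 3)
    ultimately show thesis
      by (intro result [of 4]) (simp_all add: lt)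
  next
    case 4
    have "plane 4"
      by (rule planeI) (simp only: alt_eqs compute, simp add: 4 algebra_simps)
    moreover have "good 0"
      by (rule goodI [where p = 1 and q = 0]) (simp only: alt_eqs compute', simp_all add: 4)
    moreover have "good 1"
      by (rule goodI [where p = 1 and q = 1]) (simp only: alt_eqs compute', simp_all add: 4)
    moreover have "good 2"
      by (rule goodI [where p = 1 and q = 1]) (simp only: alt_eqs compute', simp_all add: 4)
    moreover have "good 3"
      by (rule goodI [where p = 1 and q = 0]) (simp only: alt_eqs compute', simp_all add: 4)
    ultimately show thesis
      by (intro result [of 4]) (simp_all add: lt)
  next
    case 5
    have "plane 6"
      by (rule planeI) (simp only: alt_eqs compute, simp add: 5 algebra_simps)
    moreover have "good 0"
      by (rule goodI [where p = 1 and q = 0]) (simp only: alt_eqs compute', simp_all add: 5)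
    moreover have "good 1"
      by (rule goodI [where p = 1 and q = 3]) (simp only: alt_eqs compute', simp_all add: 5)
    moreover have "good 2"
      by (rule goodI [where p = 2 and q = 3]) (simp only: alt_eqs compute', simp_all add: 5)
    moreover have "good 3"
      by (rule goodI [where p = 2 and q = 3]) (simp only: alt_eqs compute', simp_all add: 5)
    moreover have "good 4"
      by (rule goodI [where p = 1 and q = 3]) (simp only: alt_eqs compute', simp_all add: 5)
    moreover have "good 5"
      by (rule goodI [where p = 1 and q = 0]) (simp only: alt_eqs compute', simp_all add: 5)
    ultimately show thesis
      by (intro result [of 6]) (simp_all add: lt)
  next
    case 6
    have "plane 6"
      by (rule planeI) (simp only: alt_eqs compute, simp add: 6 algebra_simps)
    moreover have "good 0"
      by (rule goodI [where p = 1 and q = 0]) (simp only: alt_eqs compute', simp_all add: 6)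
    moreover have "good 1"
      by (rule goodI [where p = 1 and q = 1]) (simp only: alt_eqs compute', simp_all add: 6)
    moreover have "good 2"
      by (rule goodI [where p = 2 and q = 1]) (simp only: alt_eqs compute', simp_all add: 6)
    moreover have "good 3"
      by (rule goodI [where p = 2 and q = 1]) (simp only: alt_eqs compute', simp_all add: 6)
    moreover have "good 4"
      by (rule goodI [where p = 1 and q = 1]) (simp only: alt_eqs compute', simp_all add: 6)
    moreover have "good 5"
      by (rule goodI [where p = 1 and q = 0]) (simp only: alt_eqs compute', simp_all add: 6)
    ultimately show thesis
      by (intro result [of 6]) (simp_all add: lt)
  qed
qed

text \<open>A word that does not end in i either alternates or contains a square that cancels.
  Stripping the last letter exchanges the roles of i and j, hence the induction over both.\<close>

lemma word_in_pair_cases: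
  assumes "set u \<subseteq> {i, j}" "i \<noteq> j"
  obtains "u = alternating i j (length u)"
  | u' where "set u' \<subseteq> {i, j}" "act u' = act u" "length u' < length u"
  | u' where "u = u' @ [i]"
proof -
  have "\<forall>i j. set u \<subseteq> {i, j} \<longrightarrow> i \<noteq> j \<longrightarrow> u = alternating i j (length u) \<or>
      (\<exists>u'. set u' \<subseteq> {i, j} \<and> act u' = act u \<and> length u' < length u) \<or> (\<exists>u'. u = u' @ [i])"
  proof (induction u rule: rev_induct)
    case (snoc x u)
    show ?case
    proof (intro allI impI)
      fix i j assume a: "set (u @ [x]) \<subseteq> {i, j}" "i \<noteq> j"
      show "u @ [x] = alternating i j (length (u @ [x])) \<or>
        (\<exists>u'. set u' \<subseteq> {i, j} \<and> act u' = act (u @ [x]) \<and> length u' < length (u @ [x])) \<or>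
        (\<exists>u'. u @ [x] = u' @ [i])"
      proof (cases "x = i")
        case False
        then have x: "x = j" using a by auto
        have "set u \<subseteq> {j, i}" using a by auto
        with snoc a consider "u = alternating j i (length u)"
          | u' where "set u' \<subseteq> {j, i}" "act u' = act u" "length u' < length u"
          | u' where "u = u' @ [j]" by metis
        then show ?thesis
        proof cases
          case 1
          then have "u @ [x] = alternating i j (length (u @ [x]))" using x by simp
          then show ?thesis by blast
        next
          case 2
          then have "set (u' @ [j]) \<subseteq> {i, j}" "act (u' @ [j]) = act (u @ [x])"
            "length (u' @ [j]) < length (u @ [x])"
            using x by (auto simp: fun_eq_iff)
          then show ?thesis by blast
        next
          case 3
          then have "set u' \<subseteq> {i, j}" "act u' = act (u @ [x])" "length u' < length (u @ [x])"
            using x a by (auto simp: fun_eq_iff)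
          then show ?thesis by blast
        qed
      qed blast
    qed
  qed simp
  then show thesis using assms that by blast
qed

text \<open>A shortest word that does not end in i alternates. If its length reached m, the braid
  relation would bring an i to its right end, which cancels against the appended i; this contradicts
  \<open>longer\<close>.\<close>

lemma rank_two_nonneg:
  assumes ij: "i \<noteq> j" and u: "set u \<subseteq> {i, j}"
    and min: "\<And>u'. set u' \<subseteq> {i, j} \<Longrightarrow> act u' = act u \<Longrightarrow> length u \<le> length u'"
    and longer: "\<And>u'. set u' \<subseteq> {i, j} \<Longrightarrow> act u' = act (u @ [i]) \<Longrightarrow> length u \<le> length u'"
  shows "\<exists>p q. 0 \<le> p \<and> 0 \<le> q \<and> act u (simple_root i) = p *\<^sub>R simple_root i + q *\<^sub>R simple_root j"
  using u ij
proof (cases rule: word_in_pair_cases)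
  case 1
  obtain m where m: "0 < m" "act (alternating i j m) = act (alternating j i m)"
    and good: "\<And>n. n < m \<Longrightarrow> \<exists>p q. 0 \<le> p \<and> 0 \<le> q \<and>
        act (alternating i j n) (simple_root i) = p *\<^sub>R simple_root i + q *\<^sub>R simple_root j"
    using braid_and_positivity [OF ij] by metis
  show ?thesis
  proof (cases "length u < m")
    case True
    with good 1 show ?thesis by metis
  next
    case False
    then obtain pre where pre: "u = pre @ alternating i j m" "set pre \<subseteq> {i, j}"
      using alternating_split [of m "length u" i j] 1 by auto
    obtain m' where m': "m = Suc m'" using m(1) by (cases m) auto
    have "act (pre @ alternating i j m') v = act (u @ [i]) v" for v
      using m(2) [unfolded fun_eq_iff, rule_format, of "srefl i v"]
      by (simp add: pre(1) m')
    then have "act (pre @ alternating i j m') = act (u @ [i])" ..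
    moreover have "set (pre @ alternating i j m') \<subseteq> {i, j}"
      using pre(2) set_alternating [of i j m'] by auto
    ultimately have "length u \<le> length (pre @ alternating i j m')" by (intro longer)
    then show ?thesis by (simp add: pre(1) m')
  qed
next
  case (2 u')
  then show ?thesis using min by fastforce
next
  case (3 u')
  then have "length u \<le> length u'" using u by (intro longer) (auto simp: fun_eq_iff)
  then show ?thesis using 3 by simp
qed

text \<open>Induction on length. Split w = v u, with lengths adding up, u a word in i and the last
  letter j of a reduced word, and v as short as possible. Appending i or j does not shorten v, so
  the induction hypothesis applies to v, and u maps \<open>simple_root i\<close> to a nonnegative
  combination of the two simple roots.\<close>

lemma act_simple_root_nonneg:
  assumes "weyl_length A (act w) \<le> weyl_length A (act (w @ [i]))"
  shows "0 \<le> act w (simple_root i) $ k"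
  using assms
proof (induction "weyl_length A (act w)" arbitrary: w i k rule: less_induct)
  case less
  obtain w0 where w0: "act w0 = act w" "length w0 = weyl_length A (act w)"
    using reduced_word_exists by metis
  show ?case
  proof (cases w0 rule: rev_exhaust)
    case Nil
    then show ?thesis using w0 by (metis act_Nil simple_root_nth zero_le_one order_refl)
  next
    case (snoc w1 j)
    have ij: "i \<noteq> j"
    proof
      assume "i = j"
      then have "act (w @ [i]) = act w1" using w0 snoc by (auto simp: fun_eq_iff simp flip: w0(1))
      then show False using weyl_length_le [of w1] less.prems w0(2) snoc by simp
    qed
    define P where "P = (\<lambda>(v, u). act (v @ u) = act w \<and> set u \<subseteq> {i, j} \<and>
      length v + length u = weyl_length A (act w))"
    have "P (w1, [j])" using w0 snoc by (auto simp: P_def)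
    then obtain v u where "P (v, u)" and least: "\<And>v' u'. P (v', u') \<Longrightarrow> length v \<le> length v'"
      using ex_has_least_nat [of P "(w1, [j])" "length \<circ> fst"] by auto
    then have vu: "act (v @ u) = act w" "set u \<subseteq> {i, j}"
      "length v + length u = weyl_length A (act w)" by (auto simp: P_def)
    have vless: "length v < weyl_length A (act w)"
      using least [OF \<open>P (w1, [j])\<close>] w0(2) snoc by simp
    have total: "weyl_length A (act w) \<le> length v' + length u'" if "act (v' @ u') = act w" for v' u'
      using weyl_length_le [of "v' @ u'"] that by simp
    have vlen: "weyl_length A (act v) = length v"
    proof -
      obtain v' where v': "act v' = act v" "length v' = weyl_length A (act v)"
        using reduced_word_exists by metis
      then have "act (v' @ u) = act w" using vu(1) by (auto simp: fun_eq_iff)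
      from total [OF this] weyl_length_le [of v] vu(3) v'(2) show ?thesis by simp
    qed
    have step: "0 \<le> act v (simple_root x) $ k'" if x: "x \<in> {i, j}" for x k'
    proof (rule less.hyps)
      show "weyl_length A (act v) < weyl_length A (act w)" using vless vlen by simp
      show "weyl_length A (act v) \<le> weyl_length A (act (v @ [x]))"
      proof (rule ccontr)
        \<comment> \<open>Otherwise x could be moved from v to u, giving a splitting with a shorter
          first part.\<close>
        assume neg: "\<not> ?thesis"
        obtain v' where v': "act v' = act (v @ [x])" "length v' = weyl_length A (act (v @ [x]))"
          using reduced_word_exists by metis
        have eq: "act (v' @ x # u) = act w"
          using vu(1) v'(1) by (simp add: fun_eq_iff)
        have "length v' + length (x # u) = weyl_length A (act w)"
          using total [OF eq] neg v'(2) vlen vu(3) by simp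
        with eq vu(2) x have "P (v', x # u)" by (auto simp: P_def)
        from least [OF this] neg v'(2) vlen show False by simp
      qed
    qed
    have "\<exists>p q. 0 \<le> p \<and> 0 \<le> q \<and> act u (simple_root i) = p *\<^sub>R simple_root i + q *\<^sub>R simple_root j"
    proof (rule rank_two_nonneg [OF ij vu(2)])
      fix u' assume u': "set u' \<subseteq> {i, j}" "act u' = act u"
      then have "act (v @ u') = act w" using vu(1) by (simp add: fun_eq_iff)
      from total [OF this] vu(3) show "length u \<le> length u'" by simp
    next
      fix u' assume u': "set u' \<subseteq> {i, j}" "act u' = act (u @ [i])"
      then have "act (v @ u') = act (w @ [i])" using vu(1) by (simp add: fun_eq_iff)
      with weyl_length_le [of "v @ u'"] less.prems vu(3) show "length u \<le> length u'" by simp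
    qed
    then obtain p q where pq: "0 \<le> p" "0 \<le> q"
      "act u (simple_root i) = p *\<^sub>R simple_root i + q *\<^sub>R simple_root j" by blast
    have "act w (simple_root i) = p *\<^sub>R act v (simple_root i) + q *\<^sub>R act v (simple_root j)"
      using vu(1) pq(3) by (simp flip: vu(1))
    then show ?thesis using pq(1,2) step by simp
  qed
qed

section \<open>Roots and their signs\<close>

definition roots :: "(real ^ 'n) set" where
  "roots = {act w (simple_root i) |w i. True}"

definition nonneg :: "real ^ 'n \<Rightarrow> bool" where
  "nonneg v \<longleftrightarrow> (\<forall>j. 0 \<le> v $ j)"

lemma rootsI [intro]: "act w (simple_root i) \<in> roots"
  by (auto simp: roots_def)

lemma simple_root_in_roots [simp]: "simple_root i \<in> roots"
  using rootsI [of "[]" i] by simp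

lemma act_roots [intro]: "\<beta> \<in> roots \<Longrightarrow> act w \<beta> \<in> roots"
  unfolding roots_def by (force simp flip: act_append)

lemma uminus_roots: "\<beta> \<in> roots \<Longrightarrow> - \<beta> \<in> roots"
proof -
  assume "\<beta> \<in> roots"
  then obtain w i where "\<beta> = act w (simple_root i)" by (auto simp: roots_def)
  then have "- \<beta> = act (w @ [i]) (simple_root i)" by simp
  then show ?thesis by (simp only: rootsI)
qed

lemma roots_nonzero: "\<beta> \<in> roots \<Longrightarrow> \<beta> \<noteq> 0"
  unfolding roots_def by clarsimp (metis act_eq_iff act_simps(5) simple_root_nth zero_index zero_neq_one)

text \<open>Either w or w followed by i is not shortened by appending i, and the two give opposite
  roots.\<close>

lemma root_nonneg_or: "\<beta> \<in> roots \<Longrightarrow> nonneg \<beta> \<or> nonneg (- \<beta>)"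
proof -
  assume "\<beta> \<in> roots"
  then obtain w i where b: "\<beta> = act w (simple_root i)" by (auto simp: roots_def)
  show ?thesis
  proof (cases "weyl_length A (act w) \<le> weyl_length A (act (w @ [i]))")
    case True
    then show ?thesis using act_simple_root_nonneg b by (simp add: nonneg_def)
  next
    case False
    moreover have "act ((w @ [i]) @ [i]) = act w" by (simp add: fun_eq_iff)
    ultimately have "0 \<le> act (w @ [i]) (simple_root i) $ k" for k
      by (intro act_simple_root_nonneg) simp
    then show ?thesis using b by (simp add: nonneg_def)
  qed
qed

lemma nonneg_antisym: "nonneg v \<Longrightarrow> nonneg (- v) \<Longrightarrow> v = 0"
  by (simp add: nonneg_def vec_eq_iff antisym)

lemma positive_roots_eq: "positive_roots A = {\<beta> \<in> roots. nonneg \<beta>}"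
  by (auto simp: positive_roots_def roots_def nonneg_def weyl_group_def)

subsection \<open>Fundamental weights and finiteness of the root system\<close>

abbreviation fweight :: "'n \<Rightarrow> real ^ 'n" where "fweight \<equiv> fundamental_weight A"

lemma fundamental_weight_exists: "\<exists>!v. \<forall>j. pairing j v = (if j = i then 1 else 0)"
proof (rule ex_ex1I)
  define P :: "real ^ 'n \<Rightarrow> real ^ 'n" where "P v = (\<chi> j. pairing j v)" for v
  have "linear P" by (rule linearI) (simp_all add: P_def vec_eq_iff)
  moreover have "inj P"
  proof (rule injI)
    fix u v assume "P u = P v"
    then have "pairing j (u - v) = 0" for j by (simp add: P_def vec_eq_iff)
    then have "u - v = 0" by (rule pairing_eq_0)
    then show "u = v" by simp
  qed
  ultimately have "surj P" by (rule linear_inj_imp_surj)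
  then obtain v where "P v = simple_root i" by (metis surjD)
  then show "\<exists>v. \<forall>j. pairing j v = (if j = i then 1 else 0)"
    by (intro exI [of _ v]) (auto simp: P_def vec_eq_iff)
next
  fix u v assume "\<forall>j. pairing j u = (if j = i then 1 else 0)" "\<forall>j. pairing j v = (if j = i then 1 else 0)"
  then have "u - v = 0" by (intro pairing_eq_0) simp
  then show "u = v" by simp
qed

lemma pairing_fweight [simp]: "pairing j (fweight i) = (if j = i then 1 else 0)"
  using theI' [OF fundamental_weight_exists [of i]] by (simp add: fundamental_weight_def)

lemma vec_eqI_pairing: "(\<And>j. pairing j u = pairing j v) \<Longrightarrow> u = v"
  using pairing_eq_0 [of "u - v"] by simp

lemma fweight_expand: "v = (\<Sum>i\<in>UNIV. pairing i v *\<^sub>R fweight i)"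
  by (rule vec_eqI_pairing) (simp add: if_distrib [of "\<lambda>x. _ * x"] cong: if_cong)

lemma simple_root_fweight: "simple_root i = (\<Sum>j\<in>UNIV. of_int (A $ j $ i) *\<^sub>R fweight j)"
  by (subst fweight_expand) simp

lemma srefl_fweight: "srefl j (fweight i) = (if j = i then fweight i - simple_root i else fweight i)"
  by (simp add: srefl_eq)

lemma act_fweight_unchanged: "i \<notin> set w \<Longrightarrow> act w (fweight i) = fweight i"
  by (induction w) (auto simp: srefl_fweight)

lemma act_eqI_fweight: "(\<And>i. act u (fweight i) = act w (fweight i)) \<Longrightarrow> act u = act w"
proof
  fix v assume eq: "\<And>i. act u (fweight i) = act w (fweight i)"
  show "act u v = act w v"
    by (subst (1 2) fweight_expand [of v]) (simp only: act_simps eq)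
qed

lemma form_eq_pairing: "form u v = (\<Sum>i\<in>UNIV. u $ i * (d i * pairing i v))"
  unfolding form_def coroot_pairing_def sum_distrib_left by (simp add: mult_ac)

lemma form_fweight: "form v (fweight j) = d j * v $ j"
  by (simp add: form_eq_pairing if_distrib [of "\<lambda>x. _ * x"] cong: if_cong)

lemma form_nonneg: "0 \<le> form v v"
  using form_pos [of v] form_scale_left [of 0 0 v] by (cases "v = 0") auto

lemma form_Cauchy_Schwarz: "(form u v)\<^sup>2 \<le> form u u * form v v"
proof (cases "v = 0")
  case True
  then show ?thesis using form_scale_right [of u 0 0] form_scale_right [of v 0 0] by simp
next
  case False
  define t where "t = form u v / form v v"
  have "0 \<le> form (u - t *\<^sub>R v) (u - t *\<^sub>R v)" by (rule form_nonneg)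
  also have "\<dots> = form u u - (form u v)\<^sup>2 / form v v"
    using form_pos [OF False] form_commute [of v u]
    by (simp add: form_diff_left form_diff_right form_scale_left form_scale_right t_def
        power2_eq_square field_simps)
  finally show ?thesis using form_pos [OF False] by (simp add: field_simps)
qed

lemma finite_bounded_integer_vectors:
  "finite {v :: real ^ 'n. \<forall>j. v $ j \<in> \<int> \<and> \<bar>v $ j\<bar> \<le> B j}"
proof -
  define S where "S = (UNIV :: 'n set) \<rightarrow>\<^sub>E {- \<lceil>Max (range B)\<rceil>..\<lceil>Max (range B)\<rceil>}"
  have "finite S" unfolding S_def by (intro finite_PiE) auto
  moreover have "{v :: real ^ 'n. \<forall>j. v $ j \<in> \<int> \<and> \<bar>v $ j\<bar> \<le> B j} \<subseteq> (\<lambda>f. \<chi> j. of_int (f j)) ` S"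
  proof
    fix v :: "real ^ 'n" assume v: "v \<in> {v. \<forall>j. v $ j \<in> \<int> \<and> \<bar>v $ j\<bar> \<le> B j}"
    have "v = (\<chi> j. of_int \<lfloor>v $ j\<rfloor>)" using v by (auto simp: vec_eq_iff elim: Ints_cases)
    moreover have "(\<lambda>j. \<lfloor>v $ j\<rfloor>) \<in> S"
    proof -
      have "- \<lceil>Max (range B)\<rceil> \<le> \<lfloor>v $ j\<rfloor> \<and> \<lfloor>v $ j\<rfloor> \<le> \<lceil>Max (range B)\<rceil>" for j
      proof -
        have "B j \<le> Max (range B)" by simp
        then have "\<bar>v $ j\<bar> \<le> Max (range B)" using v by (metis (mono_tags, lifting) mem_Collect_eq order_trans)
        then show ?thesis by linarith
      qed
      then show ?thesis by (auto simp: S_def)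
    qed
    ultimately show "v \<in> (\<lambda>f. \<chi> j. of_int (f j)) ` S" by (rule image_eqI)
  qed
  ultimately show ?thesis by (meson finite_imageI finite_subset)
qed

text \<open>Coordinates are integers and, up to the factor \<open>d j\<close>, inner products with
  fundamental weights. The squared lengths of roots are among the 2 \<open>d i\<close>, so
  Cauchy-Schwarz bounds every coordinate.\<close>

lemma finite_roots: "finite roots"
proof -
  define C where "C = Max (range (\<lambda>i. 2 * d i))"
  have "\<bar>\<beta> $ j\<bar> \<le> sqrt (C * form (fweight j) (fweight j)) / d j \<and> \<beta> $ j \<in> \<int>" if "\<beta> \<in> roots" for \<beta> j
  proof -
    from that obtain w i where b: "\<beta> = act w (simple_root i)" by (auto simp: roots_def)
    have "form \<beta> \<beta> = 2 * d i" by (simp add: b form_act form_simple_root diag)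
    also have "\<dots> \<le> C" by (simp add: C_def)
    finally have "(form \<beta> (fweight j))\<^sup>2 \<le> C * form (fweight j) (fweight j)"
      using form_Cauchy_Schwarz [of \<beta> "fweight j"] form_nonneg [of "fweight j"]
      by (meson mult_right_mono order_trans)
    then have "\<bar>d j * \<beta> $ j\<bar> \<le> sqrt (C * form (fweight j) (fweight j))"
      by (simp add: form_fweight real_le_rsqrt)
    then show ?thesis using d_pos [of j] b
      by (simp add: abs_mult field_simps act_simple_root_Ints)
  qed
  then show ?thesis
    by (intro finite_subset [OF _ finite_bounded_integer_vectors
        [of "\<lambda>j. sqrt (C * form (fweight j) (fweight j)) / d j"]]) auto
qed

lemma finite_positive_roots: "finite (positive_roots A)"
  using finite_roots by (simp add: positive_roots_eq)


subsection \<open>Inversions and the longest element\<close>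

lemma roots_Ints: "\<beta> \<in> roots \<Longrightarrow> \<beta> $ j \<in> \<int>"
  by (auto simp: roots_def act_simple_root_Ints)

text \<open>A positive root other than \<open>simple_root i\<close> has a positive coordinate away
  from i. The reflection leaves that coordinate unchanged, and one positive coordinate fixes the
  sign of a root.\<close>

lemma positive_root_srefl:
  assumes "\<beta> \<in> roots" "nonneg \<beta>" "\<beta> \<noteq> simple_root i"
  shows "nonneg (srefl i \<beta>)"
proof -
  have "\<exists>j. j \<noteq> i \<and> \<beta> $ j \<noteq> 0"
  proof (rule ccontr)
    assume "\<not> ?thesis"
    then have b: "\<beta> = \<beta> $ i *\<^sub>R simple_root i" by (auto simp: vec_eq_iff)
    \<comment> \<open>Moving back to a simple root by \<open>rev w\<close> shows that the factor
      \<open>\<beta> $ i\<close> divides 1, as all coordinates are integers.\<close>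
    from assms(1) obtain w j where w: "\<beta> = act w (simple_root j)" by (auto simp: roots_def)
    then have "simple_root j = act (rev w) (\<beta> $ i *\<^sub>R simple_root i)" using b by simp
    then have "1 = \<beta> $ i * act (rev w) (simple_root i) $ j"
      by (metis act_simps(4) simple_root_nth vector_scaleR_component real_scaleR_def)
    moreover obtain a b where "\<beta> $ i = of_int a" "act (rev w) (simple_root i) $ j = of_int b"
      using roots_Ints [OF assms(1)] act_simple_root_Ints by (metis Ints_cases)
    ultimately have "a * b = 1" by (metis of_int_eq_1_iff of_int_mult)
    moreover have "0 \<le> a" using assms(2) \<open>\<beta> $ i = of_int a\<close> by (simp add: nonneg_def) (metis of_int_0_le_iff)
    ultimately have "a = 1" by (metis pos_zmult_eq_1_iff zero_less_one zmult_eq_1_iff not_one_le_zero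
          neg_0_le_iff_le)
    then show False using b assms(3) \<open>\<beta> $ i = of_int a\<close> by simp
  qed
  then obtain j where j: "j \<noteq> i" "\<beta> $ j \<noteq> 0" by blast
  then have "0 < srefl i \<beta> $ j" using assms(2) by (simp add: srefl_nth nonneg_def less_le)
  then have "\<not> nonneg (- srefl i \<beta>)" by (auto simp: nonneg_def not_le intro!: exI [of _ j])
  moreover have "srefl i \<beta> \<in> roots" using act_roots [OF assms(1), of "[i]"] by simp
  ultimately show ?thesis using root_nonneg_or by blast
qed

text \<open>\<open>act (rev w)\<close> is the inverse of \<open>act w\<close>, so this set depends
  only on the group element; its cardinality will be the length.\<close>

definition inversions :: "'n list \<Rightarrow> (real ^ 'n) set" where
  "inversions w = {\<beta> \<in> positive_roots A. nonneg (- act (rev w) \<beta>)}"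

abbreviation wroot :: "'n list \<Rightarrow> nat \<Rightarrow> real ^ 'n" where "wroot \<equiv> word_root A"

lemma word_root_append: "k < length u \<Longrightarrow> wroot (u @ w) k = wroot u k"
  by (simp add: word_root_def nth_append)

lemma word_root_last: "wroot (u @ [i]) (length u) = act u (simple_root i)"
  by (simp add: word_root_def)

text \<open>A positive root followed through the inverse word can change sign only where it has
  become the simple root of the current letter.\<close>

lemma inversions_subset: "inversions w \<subseteq> wroot w ` {..<length w}"
proof (induction w rule: rev_induct)
  case Nil
  have False if "\<beta> \<in> inversions []" for \<beta>
    using that nonneg_antisym [of \<beta>] roots_nonzero [of \<beta>]
    by (auto simp: inversions_def positive_roots_eq)
  then show ?case by auto
next
  case (snoc i w)
  show ?case
  proof
    fix \<beta> assume b: "\<beta> \<in> inversions (w @ [i])"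
    show "\<beta> \<in> wroot (w @ [i]) ` {..<length (w @ [i])}"
    proof (cases "\<beta> \<in> inversions w")
      case True
      then obtain k where "k < length w" "\<beta> = wroot w k" using snoc by auto
      then show ?thesis
        by (intro image_eqI [of _ _ k]) (auto simp: word_root_append)
    next
      case False
      have root: "act (rev w) \<beta> \<in> roots" using b by (auto simp: inversions_def positive_roots_eq)
      then have "nonneg (act (rev w) \<beta>)"
        using False b root_nonneg_or by (auto simp: inversions_def)
      moreover have "\<not> nonneg (srefl i (act (rev w) \<beta>))"
        using b nonneg_antisym roots_nonzero act_roots [OF root, of "[i]"]
        by (auto simp: inversions_def)
      ultimately have "act (rev w) \<beta> = simple_root i" using positive_root_srefl root by blast
      then have "\<beta> = act w (simple_root i)" by (metis act_rev(2))
      then show ?thesis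
        by (intro image_eqI [of _ _ "length w"]) (auto simp: word_root_last)
    qed
  qed
qed

text \<open>Appending i with a positive new root adds exactly that inversion: it was none before,
  and the older ones persist because the reflection negates no positive root except
  \<open>simple_root i\<close>.\<close>

lemma inversions_positive_word:
  assumes "\<And>k. k < length w \<Longrightarrow> nonneg (wroot w k)"
  shows "inversions w = wroot w ` {..<length w} \<and> inj_on (wroot w) {..<length w}"
  using assms
proof (induction w rule: rev_induct)
  case Nil
  then show ?case using inversions_subset [of "[]"] by auto
next
  case (snoc i w)
  have IH: "inversions w = wroot w ` {..<length w}" "inj_on (wroot w) {..<length w}"
    using snoc.IH snoc.prems word_root_append by (metis length_append_singleton less_SucI)+
  define \<beta> where "\<beta> = act w (simple_root i)"
  have b: "nonneg \<beta>" "\<beta> \<in> roots"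
    using snoc.prems [of "length w"] by (auto simp: word_root_last \<beta>_def)
  have inv: "act (rev w) \<beta> = simple_root i" by (simp add: \<beta>_def)
  have new: "\<beta> \<notin> inversions w"
    using inv by (auto simp: inversions_def nonneg_def intro: exI [of _ i])
  have "\<beta> \<in> inversions (w @ [i])"
    using b by (simp add: inversions_def positive_roots_eq inv) (simp add: nonneg_def)
  moreover have "inversions w \<subseteq> inversions (w @ [i])"
  proof
    fix \<gamma> assume g: "\<gamma> \<in> inversions w"
    then have r: "- act (rev w) \<gamma> \<in> roots" "nonneg (- act (rev w) \<gamma>)"
      by (auto simp: inversions_def positive_roots_eq intro!: uminus_roots)
    moreover have "- act (rev w) \<gamma> \<noteq> simple_root i"
    proof
      assume "- act (rev w) \<gamma> = simple_root i"
      then have "act (rev w) (- \<gamma>) = act (rev w) \<beta>" using inv by simp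
      then have "- \<gamma> = \<beta>" by (simp only: act_eq_iff)
      then show False using b g nonneg_antisym [of \<gamma>] roots_nonzero [of \<gamma>]
        by (auto simp: inversions_def positive_roots_eq)
    qed
    ultimately have "nonneg (srefl i (- act (rev w) \<gamma>))" by (rule positive_root_srefl)
    then show "\<gamma> \<in> inversions (w @ [i])" using g by (simp add: inversions_def)
  qed
  moreover have "wroot (w @ [i]) ` {..<length (w @ [i])} = insert \<beta> (wroot w ` {..<length w})"
    by (auto simp: lessThan_Suc word_root_last \<beta>_def word_root_append cong: image_cong_simp)
  ultimately have "inversions (w @ [i]) = wroot (w @ [i]) ` {..<length (w @ [i])}"
    using inversions_subset [of "w @ [i]"] IH(1) by auto
  moreover have "inj_on (wroot (w @ [i])) {..<length (w @ [i])}"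
  proof -
    have "inj_on (wroot (w @ [i])) {..<length w}"
      using IH(2) by (auto simp: inj_on_def word_root_append)
    moreover have "wroot (w @ [i]) (length w) \<notin> wroot (w @ [i]) ` {..<length w}"
      using new IH(1) by (auto simp: word_root_last \<beta>_def word_root_append cong: image_cong_simp)
    ultimately show ?thesis by (simp add: lessThan_Suc)
  qed
  ultimately show ?case by blast
qed

lemma inversions_cong: "act u = act w \<Longrightarrow> inversions u = inversions w"
  using act_inverse [of u w] by (simp add: inversions_def)

text \<open>The inversion set depends only on \<open>act w\<close> and has at most as many elements
  as any expression has letters.\<close>

lemma positive_word_length:
  assumes "\<And>k. k < length w \<Longrightarrow> nonneg (wroot w k)"
  shows "weyl_length A (act w) = length w" "card (inversions w) = length w"
proof -
  show c: "card (inversions w) = length w"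
    using inversions_positive_word [of w] assms by (simp add: card_image)
  obtain w' where w': "act w' = act w" "length w' = weyl_length A (act w)"
    using reduced_word_exists by metis
  have "card (inversions w') \<le> length w'"
    using card_mono [OF _ inversions_subset [of w']] card_image_le [of "{..<length w'}" "wroot w'"]
    by simp
  then have "length w \<le> weyl_length A (act w)"
    using c w' inversions_cong by metis
  then show "weyl_length A (act w) = length w" using weyl_length_le [of w] by simp
qed

lemma reduced_prefix:
  assumes "weyl_length A (act (u @ w)) = length (u @ w)"
  shows "weyl_length A (act u) = length u"
proof -
  obtain u' where u': "act u' = act u" "length u' = weyl_length A (act u)"
    using reduced_word_exists by metis
  then have "act (u' @ w) = act (u @ w)" by (simp add: fun_eq_iff)
  then have "weyl_length A (act (u @ w)) \<le> length (u' @ w)" using weyl_length_le by metis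
  then show ?thesis using assms u' weyl_length_le [of u] by simp
qed

lemma reduced_word_positive:
  assumes "weyl_length A (act w) = length w" "k < length w"
  shows "nonneg (wroot w k)"
proof -
  have "weyl_length A (act (take k w)) = k"
    using reduced_prefix [of "take k w" "drop k w"] assms by simp
  moreover have "weyl_length A (act (take (Suc k) w)) = Suc k"
    using reduced_prefix [of "take (Suc k) w" "drop (Suc k) w"] assms by simp
  ultimately show ?thesis
    using act_simple_root_nonneg [of "take k w" "w ! k"] assms(2)
    by (simp add: take_Suc_conv_app_nth word_root_def nonneg_def)
qed

text \<open>Working characterization of the longest element that can be checked on simple
  roots.\<close>

definition makes_negative :: "'n list \<Rightarrow> bool" where
  "makes_negative w \<longleftrightarrow> (\<forall>i. nonneg (- act w (simple_root i)))"

lemma makes_negative_nonneg: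
  assumes "makes_negative w" "nonneg v"
  shows "nonneg (- act w v)"
proof -
  have "- act w v = (\<Sum>i\<in>UNIV. v $ i *\<^sub>R (- act w (simple_root i)))"
    by (subst vec_expand [of v]) (simp add: sum_negf)
  then show ?thesis using assms by (auto simp: makes_negative_def nonneg_def mult_nonneg_nonpos intro!: sum_nonneg)
qed

lemma makes_negative_rev:
  assumes "makes_negative w" "\<beta> \<in> roots" "nonneg \<beta>"
  shows "nonneg (- act (rev w) \<beta>)"
proof (rule ccontr)
  assume "\<not> ?thesis"
  then have "nonneg (act (rev w) \<beta>)" using root_nonneg_or assms(2) by blast
  then have "nonneg (- \<beta>)" using makes_negative_nonneg [OF assms(1)] by fastforce
  then show False using nonneg_antisym roots_nonzero assms by blast
qed

text \<open>The quotient of two such elements maps every simple root to a nonnegative one. A reduced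
  word for it is empty, since its last letter would yield a root that is both positive and
  negative.\<close>

lemma makes_negative_unique:
  assumes "makes_negative w" "makes_negative w'"
  shows "act w = act w'"
proof -
  obtain u where u: "act u = act (rev w @ w')" "length u = weyl_length A (act (rev w @ w'))"
    using reduced_word_exists by metis
  have pos: "nonneg (act u (simple_root i))" for i
  proof -
    have "nonneg (- act w' (simple_root i))" using assms(2) by (simp add: makes_negative_def)
    moreover have "- act w' (simple_root i) \<in> roots" by (intro uminus_roots) blast
    ultimately have "nonneg (- act (rev w) (- act w' (simple_root i)))"
      using makes_negative_rev [OF assms(1)] by blast
    then show ?thesis using u(1) by simp
  qed
  have "u = []"
  proof (cases u rule: rev_exhaust)
    case (snoc u' i)
    then have "nonneg (act u' (simple_root i))"
      using reduced_word_positive [of u "length u'"] u by (simp add: word_root_last)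
    moreover have "nonneg (- act u' (simple_root i))" using pos [of i] snoc by simp
    ultimately show ?thesis using nonneg_antisym roots_nonzero by blast
  qed
  then have "act (rev w) (act w' v) = v" for v using u(1) by (simp add: fun_eq_iff)
  then show ?thesis by (metis act_rev(2) ext)
qed

lemma weyl_length_le_card: "weyl_length A (act w) \<le> card (positive_roots A)"
proof -
  obtain u where u: "act u = act w" "length u = weyl_length A (act w)"
    using reduced_word_exists by metis
  have "length u = card (inversions u)"
    using positive_word_length(2) reduced_word_positive u by metis
  also have "\<dots> \<le> card (positive_roots A)"
    by (rule card_mono [OF finite_positive_roots]) (auto simp: inversions_def)
  finally show ?thesis using u by simp
qed

lemma makes_negative_length:
  assumes "makes_negative w"
  shows "weyl_length A (act w) = card (positive_roots A)"
proof -
  obtain u where u: "act u = act w" "length u = weyl_length A (act w)"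
    using reduced_word_exists by metis
  have "length u = card (inversions u)"
    using positive_word_length(2) reduced_word_positive u by metis
  also have "inversions u = positive_roots A"
    using makes_negative_rev [of u] assms u(1) by (auto simp: inversions_def positive_roots_eq makes_negative_def)
  finally show ?thesis using u by simp
qed

text \<open>A letter whose simple root stays positive could be appended to a reduced word, making it
  longer.\<close>

lemma maximal_length_makes_negative:
  assumes "\<And>w'. weyl_length A (act w') \<le> weyl_length A (act w)"
  shows "makes_negative w"
  unfolding makes_negative_def
proof (rule allI, rule ccontr)
  fix i assume "\<not> nonneg (- act w (simple_root i))"
  then have pos: "nonneg (act w (simple_root i))" using root_nonneg_or by blast
  obtain u where u: "act u = act w" "length u = weyl_length A (act w)"
    using reduced_word_exists by metis
  have "nonneg (wroot (u @ [i]) k)" if "k < length (u @ [i])" for k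
    using that pos u reduced_word_positive [of u k] word_root_last [of u i]
    by (cases "k = length u") (auto simp: word_root_append)
  then have "weyl_length A (act (u @ [i])) = length (u @ [i])" by (rule positive_word_length)
  then show False using assms [of "u @ [i]"] u by simp
qed

lemma longest_element_eqI:
  assumes "makes_negative w"
  shows "longest_element A = act w"
  unfolding longest_element_def
proof (rule the_equality)
  show "act w \<in> weyl_group A \<and>
      (\<forall>g'\<in>weyl_group A. weyl_length A g' \<le> weyl_length A (act w))"
    using makes_negative_length [OF assms] weyl_length_le_card by (auto simp: weyl_group_def)
next
  fix g assume g: "g \<in> weyl_group A \<and> (\<forall>g'\<in>weyl_group A. weyl_length A g' \<le> weyl_length A g)"
  then obtain w' where "g = act w'" by (auto simp: weyl_group_def)
  with g have "makes_negative w'"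
    by (intro maximal_length_makes_negative) (auto simp: weyl_group_def)
  then show "g = act w" using makes_negative_unique assms \<open>g = act w'\<close> by metis
qed

lemma longest_word_exists:
  obtains w where "longest_element A = act w" "makes_negative w"
    "length w = card (positive_roots A)"
proof -
  have "\<forall>w. True \<longrightarrow> weyl_length A (act w) < Suc (card (positive_roots A))"
    using weyl_length_le_card le_imp_less_Suc by blast
  from ex_has_greatest_nat [where P = "\<lambda>_. True", OF _ this]
  obtain w where "\<And>w'. weyl_length A (act w') \<le> weyl_length A (act w)" by auto
  then have n: "makes_negative w" by (rule maximal_length_makes_negative)
  obtain u where u: "act u = act w" "length u = weyl_length A (act w)"
    using reduced_word_exists by metis
  show thesis
    using that [of u] u n longest_element_eqI [OF n] makes_negative_length [OF n]
    by (auto simp: makes_negative_def)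
qed

section \<open>The longest element as a linear map and the diagram involution\<close>

abbreviation w0 :: "real ^ 'n \<Rightarrow> real ^ 'n" where "w0 \<equiv> longest_element A"

lemma linear_w0: "linear w0"
  using longest_word_exists linear_act by metis

lemma w0_simps [simp]:
  "w0 (u + v) = w0 u + w0 v"
  "w0 (u - v) = w0 u - w0 v"
  "w0 (- v) = - w0 v"
  "w0 (c *\<^sub>R v) = c *\<^sub>R w0 v"
  "w0 (sum f S) = (\<Sum>x\<in>S. w0 (f x))"
  using linear_w0
  by (simp_all add: linear_add linear_diff linear_neg linear_scale linear_sum)

lemma w0_w0 [simp]: "w0 (w0 v) = v"
proof -
  obtain w where w: "w0 = act w" "makes_negative w" using longest_word_exists by metis
  then have "makes_negative (rev w)"
    using makes_negative_rev [OF w(2)] by (auto simp: makes_negative_def nonneg_def)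
  then have "w0 = act (rev w)" by (rule longest_element_eqI)
  then show ?thesis using w(1) by (metis act_rev(1))
qed

lemma form_w0: "form (w0 u) (w0 v) = form u v"
  using longest_word_exists form_act by metis

lemma positive_root_coordinate_sum:
  assumes "\<beta> \<in> roots" "nonneg \<beta>"
  shows "1 \<le> (\<Sum>j\<in>UNIV. \<beta> $ j)"
proof -
  obtain j where "\<beta> $ j \<noteq> 0" using roots_nonzero [OF assms(1)] by (auto simp: vec_eq_iff)
  then have "1 \<le> \<beta> $ j"
    using assms(2) roots_Ints [OF assms(1), of j] by (auto simp: nonneg_def elim!: Ints_cases)
      (metis less_le of_int_0_less_iff of_int_1_le_iff zless_imp_add1_zle add_0 of_int_0_le_iff of_int_eq_0_iff)
  also have "\<beta> $ j \<le> (\<Sum>j\<in>UNIV. \<beta> $ j)"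
    using assms(2) by (intro member_le_sum) (auto simp: nonneg_def)
  finally show ?thesis .
qed

text \<open>Minus \<open>w0\<close> is an involution with nonnegative integer coefficients. Applying
  it twice to a simple root and adding coordinates writes 1 as a nonnegative combination of
  coordinate sums, all at least 1; this forces the image to have coordinate sum 1.\<close>

lemma w0_simple_root_exists: "\<exists>j. w0 (simple_root i) = - simple_root j"
proof -
  obtain w where w: "w0 = act w" "makes_negative w" using longest_word_exists by metis
  define c where "c k = - w0 (simple_root k)" for k
  have c: "c k \<in> roots" "nonneg (c k)" for k
    using w by (auto simp: c_def makes_negative_def intro!: uminus_roots)
  define S where "S v = (\<Sum>j\<in>UNIV. v $ j)" for v :: "real ^ 'n"
  have c1: "1 \<le> S (c k)" for k using positive_root_coordinate_sum [OF c] by (simp add: S_def)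
  have "simple_root i = - w0 (c i)" by (simp add: c_def)
  also have "- w0 (c i) = (\<Sum>j\<in>UNIV. c i $ j *\<^sub>R c j)"
    by (subst vec_expand [of "c i"]) (simp add: c_def sum_negf)
  finally have e: "simple_root i = (\<Sum>j\<in>UNIV. c i $ j *\<^sub>R c j)" .
  have "1 = S (simple_root i)" by (simp add: S_def)
  also have "\<dots> = (\<Sum>j\<in>UNIV. c i $ j * S (c j))"
    unfolding S_def by (subst e) (simp add: sum_distrib_left, subst sum.swap, simp)
  finally have 1: "1 = (\<Sum>j\<in>UNIV. c i $ j * S (c j))" .
  have "S (c i) \<le> (\<Sum>j\<in>UNIV. c i $ j * S (c j))"
    unfolding S_def [of "c i"]
  proof (rule sum_mono)
    fix j
    have "c i $ j * 1 \<le> c i $ j * S (c j)"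
      using c1 c(2) [of i] by (intro mult_left_mono) (auto simp: nonneg_def)
    then show "c i $ j \<le> c i $ j * S (c j)" by simp
  qed
  then have S1: "S (c i) = 1" using c1 [of i] 1 by simp
  obtain j where j: "c i $ j \<noteq> 0" using roots_nonzero [OF c(1)] by (auto simp: vec_eq_iff)
  then have j1: "1 \<le> c i $ j"
    using c(2) [of i] roots_Ints [OF c(1), of i j] by (auto simp: nonneg_def elim!: Ints_cases)
      (metis less_le of_int_0_less_iff of_int_1_le_iff zless_imp_add1_zle add_0 of_int_0_le_iff of_int_eq_0_iff)
  have split: "S (c i) = c i $ j + (\<Sum>k\<in>UNIV - {j}. c i $ k)"
    unfolding S_def by (simp add: sum.remove)
  have nn: "0 \<le> (\<Sum>k\<in>UNIV - {j}. c i $ k)"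
    by (rule sum_nonneg) (use c(2) [of i] in \<open>simp add: nonneg_def\<close>)
  have "c i $ j = 1" "(\<Sum>k\<in>UNIV - {j}. c i $ k) = 0" using split S1 j1 nn by simp_all
  moreover from this(2) have "\<forall>k\<in>UNIV - {j}. c i $ k = 0"
    using c(2) [of i] by (subst (asm) sum_nonneg_eq_0_iff) (auto simp: nonneg_def)
  ultimately have "c i = simple_root j" by (auto simp: vec_eq_iff)
  then show ?thesis by (metis c_def minus_minus)
qed

abbreviation star :: "'n \<Rightarrow> 'n" where "star \<equiv> involution A"

lemma simple_root_inject [simp]: "(simple_root i :: real ^ 'n) = simple_root j \<longleftrightarrow> i = j"
  by (metis simple_root_nth zero_neq_one)

lemma w0_simple_root: "w0 (simple_root i) = - simple_root (star i)"
proof -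
  obtain j where j: "w0 (simple_root i) = - simple_root j" using w0_simple_root_exists by metis
  have "star i = j" unfolding involution_def by (rule the_equality) (use j in auto)
  with j show ?thesis by simp
qed

lemma star_star [simp]: "star (star i) = i"
proof -
  have "simple_root i = w0 (w0 (simple_root i))" by simp
  also have "\<dots> = simple_root (star (star i))" by (simp only: w0_simple_root w0_simps minus_minus)
  finally show ?thesis by simp
qed

lemma star_eq_iff [simp]: "star i = star j \<longleftrightarrow> i = j"
  by (metis star_star)

lemma bij_star: "bij star"
  by (metis star_star involuntory_imp_bij)

lemma sum_star: "(\<Sum>i\<in>UNIV. f (star i)) = (\<Sum>i\<in>UNIV. f i)"
  using sum.reindex_bij_betw [OF bij_star] by blast

lemma form_star: "form (simple_root (star i)) v = - form (simple_root i) (w0 v)"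
proof -
  have "form (simple_root (star i)) v = form (w0 (simple_root (star i))) (w0 v)" by (simp only: form_w0)
  also have "\<dots> = - form (simple_root i) (w0 v)"
    using form_scale_left [of "- 1"] by (simp add: w0_simple_root)
  finally show ?thesis .
qed

lemma d_star: "d (star i) = d i"
  using form_w0 [of "simple_root i" "simple_root i"] form_scale_left [of "- 1"] form_scale_right [of _ "- 1"]
  by (simp add: w0_simple_root form_simple_root diag)

lemma pairing_star: "pairing (star i) v = - pairing i (w0 v)"
proof -
  have "d i * pairing (star i) v = d i * (- pairing i (w0 v))"
    using form_star [of i v] by (simp add: form_simple_root d_star)
  then show ?thesis using d_pos [of i] by (simp only: mult_cancel_left)  auto
qed

lemma cartan_star [simp]: "A $ star i $ star j = A $ i $ j"
  using pairing_star [of i "simple_root (star j)"] by (simp add: w0_simple_root)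

lemma w0_fweight: "w0 (fweight i) = - fweight (star i)"
proof (rule vec_eqI_pairing)
  fix j
  have "pairing j (w0 (fweight i)) = - pairing (star j) (fweight i)"
    using pairing_star [of j "fweight i"] by simp
  then show "pairing j (w0 (fweight i)) = pairing j (- fweight (star i))"
    by auto
qed

lemma adjacent_star [simp]: "adjacent A (star i) (star j) \<longleftrightarrow> adjacent A i j"
  by (simp add: adjacent_def)

lemma adjacent_sym: "adjacent A i j \<longleftrightarrow> adjacent A j i"
  using zero_sym by (auto simp: adjacent_def)

subsection \<open>Coxeter elements of quivers\<close>

abbreviation height :: "('n \<Rightarrow> int) \<Rightarrow> bool" where "height \<equiv> height_function A"
abbreviation source :: "('n \<Rightarrow> int) \<Rightarrow> 'n \<Rightarrow> bool" where "source \<equiv> is_source A"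

lemma heightD: "height \<xi> \<Longrightarrow> adjacent A i j \<Longrightarrow> \<xi> j = \<xi> i + 1 \<or> \<xi> j = \<xi> i - 1"
  unfolding height_function_def by (drule spec [of _ i], drule spec [of _ j]) arith

lemma not_adjacent_cartan: "\<not> adjacent A i j \<Longrightarrow> i \<noteq> j \<Longrightarrow> A $ j $ i = 0"
  using zero_sym by (auto simp: adjacent_def)

lemma height_reflect:
  assumes "height \<xi>" "source \<xi> i"
  shows "height (reflect_height i \<xi>)"
  unfolding height_function_def
proof (intro allI impI)
  fix k j assume kj: "adjacent A k j"
  then have "k \<noteq> j" by (simp add: adjacent_def)
  moreover have "i = k \<Longrightarrow> \<xi> j < \<xi> k" "i = j \<Longrightarrow> \<xi> k < \<xi> j"
    using assms(2) kj adjacent_sym by (auto simp: is_source_def)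
  ultimately show "\<bar>reflect_height i \<xi> k - reflect_height i \<xi> j\<bar> = 1"
    using heightD [OF assms(1) kj] by (auto simp: reflect_height_def)
qed

text \<open>Each vertex is reflected at most once, which turns it from the upper to the lower end of
  its edges. Hence a letter is a source when it is read if and only if its upper neighbours have
  been read before.\<close>

lemma adapted_distinct_iff:
  assumes "height \<xi>" "distinct w"
  shows "adapted A \<xi> w \<longleftrightarrow>
    (\<forall>u i v j. w = u @ i # v \<longrightarrow> adjacent A i j \<longrightarrow> \<xi> i < \<xi> j \<longrightarrow> j \<in> set u)"
  using assms
proof (induction w arbitrary: \<xi>)
  case (Cons i w)
  show ?case
  proof
    assume ad: "adapted A \<xi> (i # w)"
    then have s: "source \<xi> i" and ad': "adapted A (reflect_height i \<xi>) w" by auto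
    have IH: "\<forall>u k v j. w = u @ k # v \<longrightarrow> adjacent A k j \<longrightarrow>
        reflect_height i \<xi> k < reflect_height i \<xi> j \<longrightarrow> j \<in> set u"
      using Cons.IH [OF height_reflect [OF Cons.prems(1) s]] Cons.prems(2) ad' by simp
    show "\<forall>u k v j. i # w = u @ k # v \<longrightarrow> adjacent A k j \<longrightarrow> \<xi> k < \<xi> j \<longrightarrow> j \<in> set u"
    proof (intro allI impI)
      fix u k v j assume e: "i # w = u @ k # v" and kj: "adjacent A k j" "\<xi> k < \<xi> j"
      show "j \<in> set u"
      proof (cases u)
        case Nil
        then show ?thesis using e s kj by (force simp: is_source_def)
      next
        case (Cons _ u')
        then have w: "w = u' @ k # v" and u: "u = i # u'" using e by auto
        then have "k \<noteq> i" using \<open>distinct (i # w)\<close> by auto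
        then show ?thesis
          using IH [rule_format, OF w kj(1)] kj(2) u by (cases "i = j") (auto simp: reflect_height_def)
      qed
    qed
  next
    assume R: "\<forall>u k v j. i # w = u @ k # v \<longrightarrow> adjacent A k j \<longrightarrow> \<xi> k < \<xi> j \<longrightarrow> j \<in> set u"
    have s: "source \<xi> i"
      unfolding is_source_def
    proof (intro allI impI)
      fix j assume "adjacent A i j"
      moreover have "\<not> \<xi> i < \<xi> j" using R [rule_format, of "[]" i w j] calculation by auto
      ultimately show "\<xi> j < \<xi> i" using heightD [OF Cons.prems(1)] by force
    qed
    have "j \<in> set u" if w: "w = u @ k # v" and kj: "adjacent A k j"
      and lt: "reflect_height i \<xi> k < reflect_height i \<xi> j" for u k v j
    proof -
      have k: "k \<noteq> i" using Cons.prems(2) w by auto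
      have "j \<noteq> i" using lt k heightD [OF Cons.prems(1) kj] by (auto simp: reflect_height_def)
      then have "\<xi> k < \<xi> j" using lt k by (simp add: reflect_height_def)
      then have "j \<in> set (i # u)" using R [rule_format, of "i # u" k v j] w kj by simp
      then show ?thesis using \<open>j \<noteq> i\<close> by simp
    qed
    then have "adapted A (reflect_height i \<xi>) w"
      using Cons.IH [OF height_reflect [OF Cons.prems(1) s]] Cons.prems(2) by simp
    then show "adapted A \<xi> (i # w)" using s by simp
  qed
qed simp

definition coxeter_word :: "('n \<Rightarrow> int) \<Rightarrow> 'n list \<Rightarrow> bool" where
  "coxeter_word \<xi> c \<longleftrightarrow> distinct c \<and> set c = UNIV \<and> adapted A \<xi> c"

lemma coxeter_word_exists:
  assumes "height \<xi>"
  obtains c where "coxeter_word \<xi> c"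
proof -
  obtain xs where xs: "set xs = (UNIV :: 'n set)" "distinct xs"
    using finite_distinct_list [OF finite] by metis
  define c where "c = sort_key (\<lambda>i. - \<xi> i) xs"
  have c: "distinct c" "set c = UNIV" using xs by (simp_all add: c_def)
  have "sorted (map (\<lambda>i. - \<xi> i) c)" by (simp add: c_def)
  then have "j \<in> set u" if "c = u @ i # v" "\<xi> i < \<xi> j" for u i v j
    using that c(2) by (fastforce simp: sorted_append)
  then have "adapted A \<xi> c" using adapted_distinct_iff [OF assms c(1)] by blast
  then show thesis using that c by (simp add: coxeter_word_def)
qed

lemma distinct_word_fweight:
  assumes "distinct (u @ i # v)"
  shows "act (u @ i # v) (fweight i) = fweight i - act u (simple_root i)"
  using assms by (simp add: act_fweight_unchanged srefl_fweight)

text \<open>Expand \<open>simple_root i\<close> in fundamental weights. When i is read, the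
  neighbours above it have been read and those below have not, so the prefix already acts on the
  former like c and fixes the latter. This is the mesh relation between two consecutive
  slices.\<close>

lemma coxeter_word_fweight:
  assumes "height \<xi>" "coxeter_word \<xi> c"
  shows "act c (fweight i) = - fweight i -
    (\<Sum>j\<in>UNIV - {i}. of_int (A $ j $ i) *\<^sub>R (if \<xi> i < \<xi> j then act c (fweight j) else fweight j))"
proof -
  have c: "distinct c" "set c = UNIV" using assms(2) by (auto simp: coxeter_word_def)
  have up: "j \<in> set u" if "c = u @ k # v" "adjacent A k j" "\<xi> k < \<xi> j" for u k v j
    using adapted_distinct_iff [OF assms(1) c(1)] assms(2) that by (simp add: coxeter_word_def)
  obtain u v where uv: "c = u @ i # v" using c(2) by (metis UNIV_I split_list)
  have "of_int (A $ j $ i) *\<^sub>R act u (fweight j) =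
      of_int (A $ j $ i) *\<^sub>R (if \<xi> i < \<xi> j then act c (fweight j) else fweight j)" if ji: "j \<noteq> i" for j
  proof (cases "adjacent A i j")
    case True
    show ?thesis
    proof (cases "\<xi> i < \<xi> j")
      case True
      with up [OF uv \<open>adjacent A i j\<close>] have "j \<in> set u" by blast
      then have "j \<notin> set (i # v)" using c(1) uv by auto
      then have "act (i # v) (fweight j) = fweight j" by (rule act_fweight_unchanged)
      then show ?thesis using uv True by simp
    next
      case False
      then have lt: "\<xi> j < \<xi> i" using heightD [OF assms(1) True] by auto
      have "j \<notin> set u"
      proof
        assume "j \<in> set u"
        then obtain u1 u2 where u: "u = u1 @ j # u2" by (metis split_list)
        then have "i \<in> set u1" using up [of u1 j "u2 @ i # v" i] uv True adjacent_sym lt by auto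
        then show False using c(1) uv u by auto
      qed
      then show ?thesis using False by (simp add: act_fweight_unchanged)
    qed
  qed (use ji not_adjacent_cartan in auto)
  then have "(\<Sum>j\<in>UNIV - {i}. of_int (A $ j $ i) *\<^sub>R act u (fweight j)) =
      (\<Sum>j\<in>UNIV - {i}. of_int (A $ j $ i) *\<^sub>R (if \<xi> i < \<xi> j then act c (fweight j) else fweight j))"
    by (intro sum.cong) auto
  moreover have "act u (simple_root i) = (\<Sum>j\<in>UNIV. of_int (A $ j $ i) *\<^sub>R act u (fweight j))"
    by (subst simple_root_fweight) simp
  moreover have "\<dots> = 2 *\<^sub>R act u (fweight i) + (\<Sum>j\<in>UNIV - {i}. of_int (A $ j $ i) *\<^sub>R act u (fweight j))"
    by (subst sum.remove [of _ i]) (simp_all add: diag)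
  moreover have "act u (fweight i) = fweight i"
    using c(1) uv by (intro act_fweight_unchanged) auto
  ultimately show ?thesis
    using distinct_word_fweight [of u i v] c(1) uv by (simp add: scaleR_2)
qed

text \<open>Induction downwards in height: the recursion at i involves only images at higher
  vertices.\<close>

lemma coxeter_word_unique:
  assumes "height \<xi>" "coxeter_word \<xi> c" "coxeter_word \<xi> c'"
  shows "act c = act c'"
proof (rule act_eqI_fweight)
  fix i show "act c (fweight i) = act c' (fweight i)"
  proof (induction "nat (Max (range \<xi>) - \<xi> i)" arbitrary: i rule: less_induct)
    case less
    have "act c (fweight j) = act c' (fweight j)" if "\<xi> i < \<xi> j" for j
    proof -
      have "\<xi> j \<le> Max (range \<xi>)" by simp
      then show ?thesis using that by (intro less) linarith
    qed
    then have "(if \<xi> i < \<xi> j then act c (fweight j) else fweight j) =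
        (if \<xi> i < \<xi> j then act c' (fweight j) else fweight j)" for j by simp
    then show ?case
      unfolding coxeter_word_fweight [OF assms(1,2), of i] coxeter_word_fweight [OF assms(1,3), of i]
      by (simp only:)
  qed
qed

text \<open>A word without i fixes \<open>fweight i\<close>, whereas c moves it by a root.\<close>

lemma coxeter_full_support:
  assumes "distinct c" "set c = UNIV" "act w = act c"
  shows "set w = UNIV"
proof (rule ccontr)
  assume "set w \<noteq> UNIV"
  then obtain i where i: "i \<notin> set w" by auto
  obtain u v where uv: "c = u @ i # v" using assms(2) by (metis UNIV_I split_list)
  have "fweight i - act u (simple_root i) = fweight i"
    using distinct_word_fweight [of u i v] assms(1) uv act_fweight_unchanged [OF i] assms(3) by simp
  then have "act u (simple_root i) = 0" by simp
  then show False using roots_nonzero by blast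
qed

lemma coxeter_length:
  assumes "distinct c" "set c = UNIV"
  shows "weyl_length A (act c) = CARD('n)"
proof -
  obtain w where w: "act w = act c" "length w = weyl_length A (act c)"
    using reduced_word_exists by metis
  have "CARD('n) \<le> length w"
    using coxeter_full_support [OF assms w(1)] card_length [of w] by simp
  moreover have "length c = CARD('n)" using assms distinct_card by fastforce
  ultimately show ?thesis using w weyl_length_le [of c] by simp
qed

text \<open>The coordinate at a neighbour of i is positive exactly if that neighbour occurs in u, so
  the relative order of adjacent letters is visible in the group element.\<close>

lemma prefix_coordinates:
  assumes "distinct u" "i \<notin> set u"
  shows "(\<forall>l. 0 \<le> act u (simple_root i) $ l) \<and> act u (simple_root i) $ i = 1 \<and>
    (\<forall>l. l \<notin> set u \<longrightarrow> l \<noteq> i \<longrightarrow> act u (simple_root i) $ l = 0) \<and>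
    (\<forall>j\<in>set u. adjacent A j i \<longrightarrow> 0 < act u (simple_root i) $ j)"
  using assms
proof (induction u)
  case (Cons k u)
  define x where "x = act u (simple_root i)"
  have x: "\<forall>l. 0 \<le> x $ l" "x $ i = 1" "\<forall>l. l \<notin> set u \<longrightarrow> l \<noteq> i \<longrightarrow> x $ l = 0"
    "\<forall>j\<in>set u. adjacent A j i \<longrightarrow> 0 < x $ j"
    using Cons unfolding x_def by auto
  have k: "k \<notin> set u" "k \<noteq> i" using Cons.prems by auto
  then have xk: "x $ k = 0" using x by auto
  have nn: "0 \<le> - (of_int (A $ k $ l) * x $ l)" for l
  proof (cases "l = k")
    case False
    then have "real_of_int (A $ k $ l) \<le> 0" using offdiag by (metis of_int_le_0_iff)
    then show ?thesis using x(1) by (simp add: mult_nonpos_nonneg)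
  qed (simp add: xk)
  have new: "srefl k x $ k = (\<Sum>l\<in>UNIV. - (of_int (A $ k $ l) * x $ l))"
    by (simp add: srefl_nth xk coroot_pairing_def sum_negf)
  have "0 \<le> srefl k x $ k" unfolding new by (rule sum_nonneg) (rule nn)
  moreover have "0 < srefl k x $ k" if "adjacent A k i"
  proof -
    have "A $ k $ i < 0" using that offdiag [of k i] by (auto simp: adjacent_def less_le)
    then have "0 < - (of_int (A $ k $ i) * x $ i)" using x(2) by simp
    also have "\<dots> \<le> srefl k x $ k" unfolding new by (rule member_le_sum) (use nn in auto)
    finally show ?thesis .
  qed
  moreover have "srefl k x $ l = x $ l" if "l \<noteq> k" for l using that by (simp add: srefl_nth)
  ultimately have "(\<forall>l. 0 \<le> srefl k x $ l) \<and> srefl k x $ i = 1 \<and>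
    (\<forall>l. l \<notin> set (k # u) \<longrightarrow> l \<noteq> i \<longrightarrow> srefl k x $ l = 0) \<and>
    (\<forall>j\<in>set (k # u). adjacent A j i \<longrightarrow> 0 < srefl k x $ j)"
    using x k by (smt (verit, best) list.set_intros(2) set_ConsD list.set_intros(1))
  then show ?case by (simp add: x_def)
qed auto

text \<open>A reduced word of a Coxeter element uses every letter once, and the j-coordinate of
  \<open>fweight i\<close> minus its image tells whether j precedes i. All reduced words therefore
  order adjacent letters alike.\<close>

lemma coxeter_reduced_adapted:
  assumes "height \<xi>" "coxeter_word \<xi> c" "w \<in> reduced_expressions A (act c)"
  shows "coxeter_word \<xi> w"
proof -
  have c: "distinct c" "set c = UNIV" using assms(2) by (auto simp: coxeter_word_def)
  have w: "act w = act c" "length w = CARD('n)"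
    using assms(3) coxeter_length [OF c] by (auto simp: reduced_expressions_def)
  have full: "set w = UNIV" using coxeter_full_support [OF c w(1)] .
  then have dist: "distinct w" using w(2) card_distinct by metis
  have "j \<in> set u" if wu: "w = u @ i # v" and ij: "adjacent A i j" "\<xi> i < \<xi> j" for u i v j
  proof (rule ccontr)
    assume j: "j \<notin> set u"
    obtain u' v' where c': "c = u' @ i # v'" using c(2) by (metis UNIV_I split_list)
    have ne: "j \<noteq> i" using ij by auto
    have "j \<in> set u'"
      using adapted_distinct_iff [OF assms(1) c(1)] assms(2) c' ij
      by (simp add: coxeter_word_def)
    then have "0 < act u' (simple_root i) $ j"
      using prefix_coordinates [of u' i] c(1) c' ij adjacent_sym by auto
    moreover have "act u (simple_root i) $ j = 0"
      using prefix_coordinates [of u i] dist wu j ne by auto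
    moreover have "act w (fweight i) = fweight i - act u (simple_root i)"
      unfolding wu by (rule distinct_word_fweight) (use dist wu in simp)
    moreover have "act c (fweight i) = fweight i - act u' (simple_root i)"
      unfolding c' by (rule distinct_word_fweight) (use c c' in simp)
    ultimately show False using w(1) by simp
  qed
  then have "adapted A \<xi> w" using adapted_distinct_iff [OF assms(1) dist] by blast
  then show ?thesis using dist full by (simp add: coxeter_word_def)
qed

abbreviation cox :: "('n \<Rightarrow> int) \<Rightarrow> real ^ 'n \<Rightarrow> real ^ 'n" where "cox \<equiv> coxeter_of_quiver A"

lemma coxeter_of_quiver_eq:
  assumes "height \<xi>" "coxeter_word \<xi> c"
  shows "cox \<xi> = act c"
  unfolding coxeter_of_quiver_def
proof (rule the_equality)
  show "act c \<in> coxeter_elements A \<and> (\<forall>w\<in>reduced_expressions A (act c). adapted A \<xi> w)"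
    using assms coxeter_reduced_adapted [OF assms]
    by (auto simp: coxeter_elements_def coxeter_word_def)
next
  fix g assume g: "g \<in> coxeter_elements A \<and> (\<forall>w\<in>reduced_expressions A g. adapted A \<xi> w)"
  then obtain c' where c': "g = act c'" "distinct c'" "set c' = UNIV"
    by (auto simp: coxeter_elements_def)
  have "length c' = CARD('n)" using c' distinct_card by fastforce
  then have "c' \<in> reduced_expressions A g"
    using coxeter_length [OF c'(2,3)] c'(1) by (simp add: reduced_expressions_def)
  then have "coxeter_word \<xi> c'" using g c' by (auto simp: coxeter_word_def)
  then show "g = act c" using coxeter_word_unique [OF assms(1)] assms(2) c'(1) by metis
qed

subsection \<open>Mesh-additive functions\<close>

text \<open>Non-neighbours contribute 0 to the sum. The relations do not mix the two parity classes
  cut out by a height function, so a solution may be 0 on one of them.\<close>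

definition mesh_additive :: "('n \<times> int \<Rightarrow> 'b :: real_vector) \<Rightarrow> bool" where
  "mesh_additive g \<longleftrightarrow> (\<forall>i p. g (i, p + 1) + g (i, p - 1) =
     - (\<Sum>j\<in>UNIV - {i}. of_int (A $ j $ i) *\<^sub>R g (j, p)))"

lemma mesh_additiveD:
  "mesh_additive g \<Longrightarrow> g (i, p + 1) + g (i, p - 1) = - (\<Sum>j\<in>UNIV - {i}. of_int (A $ j $ i) *\<^sub>R g (j, p))"
  by (simp add: mesh_additive_def)

lemma mesh_additive_shift:
  assumes "mesh_additive g"
  shows "mesh_additive (\<lambda>(i, p). g (i, p + c))"
  unfolding mesh_additive_def
proof (intro allI)
  fix i and p :: int
  have "p + 1 + c = p + c + 1" "p - 1 + c = p + c - 1" by simp_all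
  then show "(case (i, p + 1) of (i, p) \<Rightarrow> g (i, p + c)) + (case (i, p - 1) of (i, p) \<Rightarrow> g (i, p + c)) =
      - (\<Sum>j\<in>UNIV - {i}. of_int (A $ j $ i) *\<^sub>R (case (j, p) of (i, p) \<Rightarrow> g (i, p + c)))"
    using mesh_additiveD [OF assms, of i "p + c"] by (simp only: prod.case)
qed

lemma mesh_additive_reverse:
  assumes "mesh_additive g"
  shows "mesh_additive (\<lambda>(i, p). g (i, - p))"
  unfolding mesh_additive_def
proof (intro allI)
  fix i and p :: int
  have "- (p + 1) = - p - 1" and "- (p - 1) = - p + 1" by linarith+
  then show "(case (i, p + 1) of (i, p) \<Rightarrow> g (i, - p)) + (case (i, p - 1) of (i, p) \<Rightarrow> g (i, - p)) =
      - (\<Sum>j\<in>UNIV - {i}. of_int (A $ j $ i) *\<^sub>R (case (j, p) of (i, p) \<Rightarrow> g (i, - p)))"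
    using mesh_additiveD [OF assms, of i "- p"]
      add.commute [of "g (i, - p + 1)" "g (i, - p - 1)"] by (simp only: prod.case)
qed

lemma mesh_additive_star: "mesh_additive g \<Longrightarrow> mesh_additive (\<lambda>(i, p). g (star i, p))"
  unfolding mesh_additive_def
proof (intro allI)
  fix i and p :: int
  assume g: "\<forall>i p. g (i, p + 1) + g (i, p - 1) = - (\<Sum>j\<in>UNIV - {i}. of_int (A $ j $ i) *\<^sub>R g (j, p))"
  have "(\<Sum>j\<in>UNIV - {star i}. of_int (A $ j $ star i) *\<^sub>R g (j, p)) =
      (\<Sum>j\<in>UNIV - {i}. of_int (A $ j $ i) *\<^sub>R g (star j, p))"
    by (rule sum.reindex_bij_witness [of _ star star]) (auto simp flip: cartan_star [of _ i])
  then show "(case (i, p + 1) of (i, p) \<Rightarrow> g (star i, p)) + (case (i, p - 1) of (i, p) \<Rightarrow> g (star i, p)) =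
      - (\<Sum>j\<in>UNIV - {i}. of_int (A $ j $ i) *\<^sub>R (case (j, p) of (i, p) \<Rightarrow> g (star i, p)))"
    using g by simp
qed

lemma mesh_additive_linear:
  assumes "linear f" "mesh_additive g"
  shows "mesh_additive (\<lambda>x. f (g x))"
  unfolding mesh_additive_def
proof (intro allI)
  fix i and p :: int
  have "f (g (i, p + 1)) + f (g (i, p - 1)) = f (g (i, p + 1) + g (i, p - 1))"
    by (simp only: linear_add [OF assms(1)])
  also have "\<dots> = - (\<Sum>j\<in>UNIV - {i}. of_int (A $ j $ i) *\<^sub>R f (g (j, p)))"
    unfolding mesh_additiveD [OF assms(2)]
    by (simp only: linear_neg [OF assms(1)] linear_sum [OF assms(1)] linear_scale [OF assms(1)])
  finally show "f (g (i, p + 1)) + f (g (i, p - 1)) = \<dots>" .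
qed

lemma mesh_additive_diff:
  assumes "mesh_additive g" "mesh_additive h"
  shows "mesh_additive (\<lambda>x. g x - h x)"
  unfolding mesh_additive_def
proof (intro allI)
  fix i and p :: int
  have "g (i, p + 1) - h (i, p + 1) + (g (i, p - 1) - h (i, p - 1)) =
      (g (i, p + 1) + g (i, p - 1)) - (h (i, p + 1) + h (i, p - 1))" by simp
  also have "\<dots> = - (\<Sum>j\<in>UNIV - {i}. of_int (A $ j $ i) *\<^sub>R (g (j, p) - h (j, p)))"
    unfolding mesh_additiveD [OF assms(1)] mesh_additiveD [OF assms(2)]
    by (simp only: scaleR_right_diff_distrib sum_subtractf) simp
  finally show "g (i, p + 1) - h (i, p + 1) + (g (i, p - 1) - h (i, p - 1)) = \<dots>" .
qed

text \<open>Among the vertices where the two functions differ, a highest one is a source: a higher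
  neighbour would already have its final height, at distance at least 3 from the final height of
  this vertex.\<close>

lemma height_descend [consumes 4, case_names start step]:
  assumes "height \<xi>" "height \<xi>'" "\<And>i. \<xi>' i \<le> \<xi> i" "\<And>i. even (\<xi> i - \<xi>' i)" "P \<xi>"
    and step: "\<And>\<zeta> i. height \<zeta> \<Longrightarrow> P \<zeta> \<Longrightarrow> source \<zeta> i \<Longrightarrow> (\<And>j. \<xi>' j \<le> reflect_height i \<zeta> j) \<Longrightarrow>
      P (reflect_height i \<zeta>)"
  shows "P \<xi>'"
  using assms(1,3,4,5)
proof (induction "nat (\<Sum>i\<in>UNIV. \<xi> i - \<xi>' i)" arbitrary: \<xi> rule: less_induct)
  case less
  show ?case
  proof (cases "\<xi> = \<xi>'")
    case False
    define S where "S = {i. \<xi>' i < \<xi> i}"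
    have "S \<noteq> {}" using False less.prems(2) by (force simp: S_def fun_eq_iff less_le)
    then have "Max (\<xi> ` S) \<in> \<xi> ` S" by (intro Max_in) auto
    then obtain i where i: "i \<in> S" "\<xi> i = Max (\<xi> ` S)" by auto
    have max: "\<xi> j \<le> \<xi> i" if "j \<in> S" for j using that i by simp
    have i2: "\<xi>' i + 2 \<le> \<xi> i" using i(1) less.prems(3) [of i] by (simp add: S_def) presburger
    have src: "source \<xi> i"
      unfolding is_source_def
    proof (intro allI impI)
      fix j assume adj: "adjacent A i j"
      show "\<xi> j < \<xi> i"
      proof (rule ccontr)
        assume "\<not> ?thesis"
        then have 1: "\<xi> j = \<xi> i + 1" using heightD [OF less.prems(1) adj] by auto
        then have "j \<notin> S" using max by force
        then have "\<xi>' j = \<xi> j" using less.prems(2) [of j] by (simp add: S_def)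
        then show False using heightD [OF assms(2) adj] 1 i2 by auto
      qed
    qed
    have le: "\<xi>' j \<le> reflect_height i \<xi> j" for j
      using i2 less.prems(2) [of j] by (auto simp: reflect_height_def)
    have "(\<Sum>k\<in>UNIV. reflect_height i \<xi> k - \<xi>' k) = (\<Sum>k\<in>UNIV. \<xi> k - \<xi>' k) - 2"
      by (simp add: reflect_height_def sum_subtractf)
    moreover have "0 \<le> (\<Sum>k\<in>UNIV. reflect_height i \<xi> k - \<xi>' k)"
      by (rule sum_nonneg) (use le in simp)
    ultimately have "nat (\<Sum>k\<in>UNIV. reflect_height i \<xi> k - \<xi>' k) < nat (\<Sum>k\<in>UNIV. \<xi> k - \<xi>' k)"
      by linarith
    then show ?thesis
      by (rule less.hyps) (use height_reflect [OF less.prems(1) src] le less.prems(3)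
          step [OF less.prems(1,4) src] in \<open>auto simp: reflect_height_def\<close>)
  qed (use less.prems in simp)
qed

text \<open>A source reflection moves the slice at one vertex, and one mesh relation computes the
  new value from the old slice.\<close>

lemma mesh_additive_zero_below:
  fixes g :: "'n \<times> int \<Rightarrow> 'b :: real_vector"
  assumes "mesh_additive g" "height \<xi>" "\<And>i. g (i, \<xi> i) = 0" "even (p - \<xi> i)" "p \<le> \<xi> i"
  shows "g (i, p) = 0"
proof -
  \<comment> \<open>Lowering the whole slice by 2N keeps the parities and makes it pass through (i,
    p).\<close>
  define N where "N = (\<xi> i - p) div 2"
  have N: "p = \<xi> i - 2 * N" "0 \<le> N" using assms(4,5) by (auto simp: N_def)
  have "height (\<lambda>j. \<xi> j - 2 * N)" using assms(2) by (simp add: height_function_def)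
  with assms(2) have "\<forall>i. g (i, \<xi> i - 2 * N) = 0"
  proof (rule height_descend [where P = "\<lambda>\<zeta>. \<forall>i. g (i, \<zeta> i) = 0"])
    fix \<zeta> i assume h: "height \<zeta>" "\<forall>i. g (i, \<zeta> i) = 0" and s: "source \<zeta> i"
    have "of_int (A $ j $ i) *\<^sub>R g (j, \<zeta> i - 1) = 0" if "j \<noteq> i" for j
    proof (cases "adjacent A i j")
      case True
      then have "\<zeta> j = \<zeta> i - 1" using heightD [OF h(1) True] s by (auto simp: is_source_def)
      then show ?thesis using h(2) by (metis scaleR_zero_right)
    qed (use that not_adjacent_cartan in auto)
    then have "(\<Sum>j\<in>UNIV - {i}. of_int (A $ j $ i) *\<^sub>R g (j, \<zeta> i - 1)) = 0"
      by (intro sum.neutral) auto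
    then have "g (i, \<zeta> i - 2) = 0"
      using mesh_additiveD [OF assms(1), of i "\<zeta> i - 1"] h(2) by simp
    then show "\<forall>k. g (k, reflect_height i \<zeta> k) = 0" using h(2) by (simp add: reflect_height_def)
  qed (use N assms(3) in auto)
  then show ?thesis using N by simp
qed

lemma mesh_additive_zero:
  fixes g :: "'n \<times> int \<Rightarrow> 'b :: real_vector"
  assumes "mesh_additive g" "height \<xi>" "\<And>i. g (i, \<xi> i) = 0" "even (p - \<xi> i)"
  shows "g (i, p) = 0"
proof (cases "p \<le> \<xi> i")
  case False
  \<comment> \<open>Above the slice, reversal of p reduces to the case below for the negated height
    function.\<close>
  have "height (\<lambda>j. - \<xi> j)" using assms(2) by (simp add: height_function_def abs_minus_commute)
  moreover have "even (- p - - \<xi> i)" using assms(4) by presburger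
  ultimately have "(\<lambda>(i, p). g (i, - p)) (i, - p) = 0"
    using mesh_additive_zero_below [OF mesh_additive_reverse [OF assms(1)], of "\<lambda>j. - \<xi> j" "- p" i]
      False assms(3) by simp
  then show ?thesis by simp
qed (use mesh_additive_zero_below [OF assms] in simp)

lemma mesh_additive_unique:
  fixes g :: "'n \<times> int \<Rightarrow> 'b :: real_vector"
  assumes "mesh_additive g" "mesh_additive h" "height \<xi>" "\<And>i. g (i, \<xi> i) = h (i, \<xi> i)" "even (p - \<xi> i)"
  shows "g (i, p) = h (i, p)"
  using mesh_additive_zero [OF mesh_additive_diff [OF assms(1,2)] assms(3) _ assms(5)] assms(4) by simp

subsection \<open>Weights and roots on the repetition quiver\<close>

definition cox_power :: "('n \<Rightarrow> int) \<Rightarrow> int \<Rightarrow> real ^ 'n \<Rightarrow> real ^ 'n" where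
  "cox_power \<xi> k = (if 0 \<le> k then cox \<xi> ^^ nat k else inv (cox \<xi>) ^^ nat (- k))"

text \<open>Set to 0 at the wrong parity so that the mesh relations hold everywhere. Weights are
  easier to compare than roots, as their values on the slice of \<xi> are the fundamental weights;
  \<open>phi\<close> arises by applying 1 - \<open>cox \<xi>\<close> and extends
  \<open>AR_coordinate\<close> beyond the strip.\<close>

definition omega :: "('n \<Rightarrow> int) \<Rightarrow> 'n \<times> int \<Rightarrow> real ^ 'n" where
  "omega \<xi> = (\<lambda>(i, p). if even (p - \<xi> i) then cox_power \<xi> ((\<xi> i - p) div 2) (fweight i) else 0)"

definition phi :: "('n \<Rightarrow> int) \<Rightarrow> 'n \<times> int \<Rightarrow> real ^ 'n" where
  "phi \<xi> = (\<lambda>(i, p). omega \<xi> (i, p) - omega \<xi> (i, p - 2))"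

lemma cox_act: "height \<xi> \<Longrightarrow> \<exists>c. coxeter_word \<xi> c \<and> cox \<xi> = act c \<and> inv (cox \<xi>) = act (rev c)"
proof -
  assume h: "height \<xi>"
  obtain c where c: "coxeter_word \<xi> c" using coxeter_word_exists [OF h] .
  have "inv (act c) = act (rev c)" by (rule inv_equality) simp_all
  then show ?thesis using c coxeter_of_quiver_eq [OF h c] by auto
qed

lemma act_funpow: "act w ^^ n = act (concat (replicate n w))"
  by (induction n) (auto simp: fun_eq_iff)

lemma cox_power_act: "height \<xi> \<Longrightarrow> \<exists>w. cox_power \<xi> k = act w"
  unfolding cox_power_def using cox_act [of \<xi>] by (auto simp: act_funpow)

lemma cox_power_Suc:
  assumes "height \<xi>"
  shows "cox \<xi> (cox_power \<xi> k v) = cox_power \<xi> (k + 1) v"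
    "cox_power \<xi> k (cox \<xi> v) = cox_power \<xi> (k + 1) v"
proof -
  obtain c where c: "cox \<xi> = act c" "inv (act c) = act (rev c)" using cox_act [OF assms] by metis
  consider "0 \<le> k" | "k < 0" by linarith
  then have "cox \<xi> (cox_power \<xi> k v) = cox_power \<xi> (k + 1) v \<and>
      cox_power \<xi> k (cox \<xi> v) = cox_power \<xi> (k + 1) v"
  proof cases
    case 1
    then have "nat (k + 1) = Suc (nat k)" by simp
    then show ?thesis using 1 by (simp add: cox_power_def funpow_swap1)
  next
    case 2
    then obtain n where n: "nat (- k) = Suc n" by (metis not0_implies_Suc zero_less_nat_eq neg_0_less_iff_less less_irrefl)
    then have n': "nat (- (k + 1)) = n" "k + 1 = - int n" by simp_all
    show ?thesis
    proof (cases "k + 1 = 0")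
      case True
      then show ?thesis using n n' 2 by (simp add: cox_power_def c)
    next
      case False
      then have "\<not> 0 \<le> k + 1" "\<not> 0 \<le> k" using 2 by auto
      moreover have "act c ((act (rev c) ^^ Suc n) v) = (act (rev c) ^^ n) v" by simp
      moreover have "(act (rev c) ^^ Suc n) (act c v) = (act (rev c) ^^ n) v"
        by (simp only: funpow_Suc_right comp_apply act_rev)
      ultimately show ?thesis unfolding cox_power_def n' n by (simp only: c if_False) simp
    qed
  qed
  then show "cox \<xi> (cox_power \<xi> k v) = cox_power \<xi> (k + 1) v"
    "cox_power \<xi> k (cox \<xi> v) = cox_power \<xi> (k + 1) v" by auto
qed

lemma cox_power_0 [simp]: "cox_power \<xi> 0 v = v"
  by (simp add: cox_power_def)

lemma omega_slice [simp]: "omega \<xi> (i, \<xi> i) = fweight i"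
  by (simp add: omega_def)

lemma omega_cox: "height \<xi> \<Longrightarrow> cox \<xi> (omega \<xi> (i, p)) = omega \<xi> (i, p - 2)"
proof -
  assume h: "height \<xi>"
  obtain c where "cox \<xi> = act c" using cox_act [OF h] by blast
  moreover have "even (p - \<xi> i) \<Longrightarrow> (\<xi> i - (p - 2)) div 2 = (\<xi> i - p) div 2 + 1" by presburger
  ultimately show ?thesis using cox_power_Suc [OF h] by (auto simp: omega_def)
qed

text \<open>Powers of the Coxeter element carry \<open>coxeter_word_fweight\<close> from the slice
  of \<xi> to all positions.\<close>

lemma omega_mesh_additive:
  assumes "height \<xi>"
  shows "mesh_additive (omega \<xi>)"
  unfolding mesh_additive_def
proof (intro allI)
  fix i p
  obtain c where c: "coxeter_word \<xi> c" "cox \<xi> = act c" using cox_act [OF assms] by blast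
  show "omega \<xi> (i, p + 1) + omega \<xi> (i, p - 1) =
      - (\<Sum>j\<in>UNIV - {i}. of_int (A $ j $ i) *\<^sub>R omega \<xi> (j, p))"
  proof (cases "even (p + 1 - \<xi> i)")
    case True
    \<comment> \<open>The number of Coxeter steps from the slice down to p + 1 in column i.\<close>
    define k where "k = (\<xi> i - p - 1) div 2"
    have p: "p = \<xi> i - 1 - 2 * k" using True unfolding k_def by presburger
    obtain w where w: "cox_power \<xi> k = act w" using cox_power_act [OF assms] by blast
    have next_power: "cox_power \<xi> (k + 1) v = act w (cox \<xi> v)" for v
      using cox_power_Suc(2) [OF assms, of k v] w by simp
    have "omega \<xi> (i, p + 1) = act w (fweight i)"
      unfolding omega_def using p w by simp
    moreover have "omega \<xi> (i, p - 1) = act w (cox \<xi> (fweight i))"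
      unfolding omega_def using p by (simp add: next_power [symmetric])
    moreover have "of_int (A $ j $ i) *\<^sub>R omega \<xi> (j, p) = act w (of_int (A $ j $ i) *\<^sub>R
        (if \<xi> i < \<xi> j then cox \<xi> (fweight j) else fweight j))" if "j \<noteq> i" for j
    proof (cases "adjacent A i j")
      case True
      show ?thesis
      proof (cases "\<xi> i < \<xi> j")
        case True
        then have "\<xi> j = \<xi> i + 1" using heightD [OF assms \<open>adjacent A i j\<close>] by auto
        then have "omega \<xi> (j, p) = cox_power \<xi> (k + 1) (fweight j)"
          unfolding omega_def p by (simp add: algebra_simps)
        then show ?thesis using True next_power by simp
      next
        case False
        then have "\<xi> j = \<xi> i - 1" using heightD [OF assms \<open>adjacent A i j\<close>] by auto
        then have "p = \<xi> j - 2 * k" using p by simp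
        then have "omega \<xi> (j, p) = cox_power \<xi> k (fweight j)" by (simp add: omega_def)
        then show ?thesis using False w by simp
      qed
    qed (use that not_adjacent_cartan in auto)
    moreover define S where "S = (\<Sum>j\<in>UNIV - {i}. of_int (A $ j $ i) *\<^sub>R
        (if \<xi> i < \<xi> j then cox \<xi> (fweight j) else fweight j))"
    ultimately have "(\<Sum>j\<in>UNIV - {i}. of_int (A $ j $ i) *\<^sub>R omega \<xi> (j, p)) = act w S"
      unfolding S_def act_simps(6) by (intro sum.cong) simp_all
    moreover have "cox \<xi> (fweight i) = - fweight i - S"
      using coxeter_word_fweight [OF assms c(1), of i] by (simp only: S_def c(2))
    ultimately show ?thesis
      using \<open>omega \<xi> (i, p + 1) = _\<close> \<open>omega \<xi> (i, p - 1) = _\<close> by simp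
  next
    case False
    have "of_int (A $ j $ i) *\<^sub>R omega \<xi> (j, p) = 0" if "j \<noteq> i" for j
    proof (cases "adjacent A i j")
      case True
      then have "odd (p - \<xi> j)" using heightD [OF assms True] False by auto
      then show ?thesis by (simp add: omega_def)
    qed (use that not_adjacent_cartan in auto)
    then have "(\<Sum>j\<in>UNIV - {i}. of_int (A $ j $ i) *\<^sub>R omega \<xi> (j, p)) = 0"
      by (intro sum.neutral) auto
    moreover have "omega \<xi> (i, p + 1) = 0" "omega \<xi> (i, p - 1) = 0"
      using False by (auto simp: omega_def)
    ultimately show ?thesis by simp
  qed
qed

lemma phi_mesh_additive: "height \<xi> \<Longrightarrow> mesh_additive (phi \<xi>)"
proof -
  assume "height \<xi>"
  from mesh_additive_diff [OF omega_mesh_additive [OF this]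
      mesh_additive_shift [OF omega_mesh_additive [OF this], of "- 2"]]
  show ?thesis by (simp add: phi_def case_prod_unfold)
qed

lemma phi_AR_coordinate:
  assumes "height \<xi>" "even (p - \<xi> i)" "p \<le> \<xi> i"
  shows "AR_coordinate A \<xi> (i, p) = phi \<xi> (i, p)"
proof -
  define n where "n = nat ((\<xi> i - p) div 2)"
  have p: "p = \<xi> i - 2 * int n" using assms(2,3) by (simp add: n_def)
  obtain w where w: "cox \<xi> ^^ n = act w" using cox_act [OF assms(1)] act_funpow by metis
  have "omega \<xi> (i, p) = act w (fweight i)"
    by (simp add: omega_def p cox_power_def w)
  moreover have "omega \<xi> (i, p - 2) = act w (cox \<xi> (fweight i))"
  proof -
    have "omega \<xi> (i, p - 2) = cox_power \<xi> (int n + 1) (fweight i)"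
      by (simp add: omega_def p)
    also have "\<dots> = cox_power \<xi> (int n) (cox \<xi> (fweight i))" by (simp add: cox_power_Suc(2) [OF assms(1)])
    finally show ?thesis by (simp add: cox_power_def w)
  qed
  ultimately show ?thesis
    by (simp add: AR_coordinate_def gamma_def phi_def w flip: n_def)
qed

lemma source_lower:
  assumes "height \<xi>" "source \<xi> i" "adjacent A i j"
  shows "\<xi> j = \<xi> i - 1"
  using heightD [OF assms(1,3)] assms(2,3) by (auto simp: is_source_def)

lemma neighbour_sum:
  assumes "\<And>j. adjacent A i j \<Longrightarrow> g j = fweight j"
  shows "- (\<Sum>j\<in>UNIV - {i}. of_int (A $ j $ i) *\<^sub>R g j) = 2 *\<^sub>R fweight i - simple_root i"
proof -
  have "of_int (A $ j $ i) *\<^sub>R g j = of_int (A $ j $ i) *\<^sub>R fweight j" if "j \<noteq> i" for j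
    by (cases "adjacent A i j") (use assms that not_adjacent_cartan in auto)
  then have "(\<Sum>j\<in>UNIV - {i}. of_int (A $ j $ i) *\<^sub>R g j) = (\<Sum>j\<in>UNIV - {i}. of_int (A $ j $ i) *\<^sub>R fweight j)"
    by (intro sum.cong) auto
  moreover have "simple_root i = 2 *\<^sub>R fweight i + (\<Sum>j\<in>UNIV - {i}. of_int (A $ j $ i) *\<^sub>R fweight j)"
    by (subst simple_root_fweight, subst sum.remove [of _ i]) (simp_all add: diag)
  ultimately show ?thesis by simp
qed

lemma omega_source:
  assumes "height \<xi>" "source \<xi> i"
  shows "omega \<xi> (i, \<xi> i - 2) = fweight i - simple_root i"
proof -
  have "- (\<Sum>j\<in>UNIV - {i}. of_int (A $ j $ i) *\<^sub>R omega \<xi> (j, \<xi> i - 1)) = 2 *\<^sub>R fweight i - simple_root i"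
    by (rule neighbour_sum) (use source_lower [OF assms] omega_slice in metis)
  then have "omega \<xi> (i, \<xi> i - 2) + fweight i = 2 *\<^sub>R fweight i - simple_root i"
    using mesh_additiveD [OF omega_mesh_additive [OF assms(1)], of i "\<xi> i - 1"]
    by (simp add: add.commute)
  then have "omega \<xi> (i, \<xi> i - 2) = 2 *\<^sub>R fweight i - simple_root i - fweight i"
    by (simp only: eq_diff_eq)
  then show ?thesis by (simp add: scaleR_2)
qed

lemma omega_sink:
  assumes "height \<xi>" "\<And>j. adjacent A i j \<Longrightarrow> \<xi> j = \<xi> i + 1"
  shows "omega \<xi> (i, \<xi> i + 2) = fweight i - simple_root i"
proof -
  have "- (\<Sum>j\<in>UNIV - {i}. of_int (A $ j $ i) *\<^sub>R omega \<xi> (j, \<xi> i + 1)) = 2 *\<^sub>R fweight i - simple_root i"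
    by (rule neighbour_sum) (use assms(2) omega_slice in metis)
  then have "omega \<xi> (i, \<xi> i + 2) + fweight i = 2 *\<^sub>R fweight i - simple_root i"
    using mesh_additiveD [OF omega_mesh_additive [OF assms(1)], of i "\<xi> i + 1"]
    by (simp add: add.commute)
  then have "omega \<xi> (i, \<xi> i + 2) = 2 *\<^sub>R fweight i - simple_root i - fweight i"
    by (simp only: eq_diff_eq)
  then show ?thesis by (simp add: scaleR_2)
qed

lemma phi_source: "height \<xi> \<Longrightarrow> source \<xi> i \<Longrightarrow> phi \<xi> (i, \<xi> i) = simple_root i"
  by (simp add: phi_def omega_source)

text \<open>Two above a sink is the position that a source reflection at this vertex has just
  passed; the simple root there has turned negative.\<close>

lemma phi_sink:
  "height \<xi> \<Longrightarrow> (\<And>j. adjacent A i j \<Longrightarrow> \<xi> j = \<xi> i + 1) \<Longrightarrow> phi \<xi> (i, \<xi> i + 2) = - simple_root i"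
  by (simp add: phi_def omega_sink)

text \<open>Both sides solve the mesh relations, so it suffices to compare them on the slice of the
  reflected quiver, which differs from the old one only at i.\<close>

lemma omega_reflect:
  assumes "height \<xi>" "source \<xi> i"
  shows "omega (reflect_height i \<xi>) x = srefl i (omega \<xi> x)"
proof (cases x)
  case (Pair k p)
  note h = height_reflect [OF assms]
  have par: "even (p - reflect_height i \<xi> k) \<longleftrightarrow> even (p - \<xi> k)"
    by (simp add: reflect_height_def)
  show ?thesis
  proof (cases "even (p - \<xi> k)")
    case True
    have "omega (reflect_height i \<xi>) (k, p) = srefl i (omega \<xi> (k, p))"
    proof (rule mesh_additive_unique [OF omega_mesh_additive [OF h]
        mesh_additive_linear [OF linear_srefl omega_mesh_additive [OF assms(1)]] h])
      fix j show "omega (reflect_height i \<xi>) (j, reflect_height i \<xi> j)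
          = srefl i (omega \<xi> (j, reflect_height i \<xi> j))"
        unfolding omega_slice
        by (cases "j = i") (simp_all add: reflect_height_def srefl_fweight omega_source [OF assms])
    qed (use True par in simp)
    then show ?thesis using Pair by simp
  qed (use Pair par in \<open>simp add: omega_def\<close>)
qed

lemma phi_reflect:
  assumes "height \<xi>" "source \<xi> i"
  shows "phi (reflect_height i \<xi>) x = srefl i (phi \<xi> x)"
  by (simp add: phi_def omega_reflect [OF assms] case_prod_unfold)

section \<open>Words of source reflections\<close>

definition final_height :: "('n \<Rightarrow> int) \<Rightarrow> 'n list \<Rightarrow> 'n \<Rightarrow> int" where
  "final_height \<xi> w = (\<lambda>j. \<xi> j - 2 * int (count_list w j))"

lemma final_height_Nil [simp]: "final_height \<xi> [] = \<xi>"
  by (simp add: final_height_def)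

lemma final_height_Cons [simp]: "final_height \<xi> (i # w) = final_height (reflect_height i \<xi>) w"
  by (auto simp: final_height_def reflect_height_def)

lemma final_height_append [simp]:
  "final_height \<xi> (u @ w) = final_height (final_height \<xi> u) w"
  by (induction u arbitrary: \<xi>) auto

lemma adapted_append [simp]:
  "adapted A \<xi> (u @ w) \<longleftrightarrow> adapted A \<xi> u \<and> adapted A (final_height \<xi> u) w"
  by (induction u arbitrary: \<xi>) auto

lemma height_final: "height \<xi> \<Longrightarrow> adapted A \<xi> w \<Longrightarrow> height (final_height \<xi> w)"
  by (induction w arbitrary: \<xi>) (auto simp: height_reflect)

lemma omega_word: "height \<xi> \<Longrightarrow> adapted A \<xi> w \<Longrightarrow> omega \<xi> x = act w (omega (final_height \<xi> w) x)"
proof (induction w arbitrary: \<xi>)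
  case (Cons i w)
  then have "omega \<xi> x = srefl i (omega (reflect_height i \<xi>) x)" by (simp add: omega_reflect)
  also have "omega (reflect_height i \<xi>) x = act w (omega (final_height (reflect_height i \<xi>) w) x)"
    using Cons by (intro Cons.IH) (auto simp: height_reflect)
  finally show ?case by simp
qed simp

lemma phi_word: "height \<xi> \<Longrightarrow> adapted A \<xi> w \<Longrightarrow> phi \<xi> x = act w (phi (final_height \<xi> w) x)"
  by (simp add: phi_def omega_word [of \<xi> w] case_prod_unfold)

lemma descend_word:
  assumes "height \<xi>" "height \<xi>'" "\<And>i. \<xi>' i \<le> \<xi> i" "\<And>i. even (\<xi> i - \<xi>' i)"
  obtains w where "adapted A \<xi> w" "final_height \<xi> w = \<xi>'"
proof -
  have "\<exists>w. adapted A \<xi> w \<and> final_height \<xi> w = \<xi>'"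
    using assms
  proof (rule height_descend [where P = "\<lambda>\<zeta>. \<exists>w. adapted A \<xi> w \<and> final_height \<xi> w = \<zeta>"])
    have "adapted A \<xi> [] \<and> final_height \<xi> [] = \<xi>" by simp
    then show "\<exists>w. adapted A \<xi> w \<and> final_height \<xi> w = \<xi>" ..
  next
    fix \<zeta> i assume "\<exists>w. adapted A \<xi> w \<and> final_height \<xi> w = \<zeta>" "source \<zeta> i"
    then obtain w where "adapted A \<xi> w" "final_height \<xi> w = \<zeta>" by blast
    then have "adapted A \<xi> (w @ [i]) \<and> final_height \<xi> (w @ [i]) = reflect_height i \<zeta>"
      using \<open>source \<zeta> i\<close> by simp
    then show "\<exists>w. adapted A \<xi> w \<and> final_height \<xi> w = reflect_height i \<zeta>" ..
  qed
  then show thesis using that by blast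
qed

text \<open>On the slice, \<open>fweight i\<close> minus its image under the Coxeter element is the
  image of \<open>simple_root i\<close> under the prefix before i; powers of the Coxeter element
  give the other positions.\<close>

lemma phi_roots:
  assumes "height \<xi>" "even (p - \<xi> i)"
  shows "phi \<xi> (i, p) \<in> roots"
proof -
  have base: "phi \<xi> (i, \<xi> i) \<in> roots" for i
  proof -
    obtain c where c: "coxeter_word \<xi> c" "cox \<xi> = act c" using cox_act [OF assms(1)] by blast
    obtain u v where uv: "c = u @ i # v" using c(1) by (metis UNIV_I coxeter_word_def split_list)
    have "act c (fweight i) = fweight i - act u (simple_root i)"
      using distinct_word_fweight [of u i v] c(1) uv by (simp add: coxeter_word_def)
    then have "omega \<xi> (i, \<xi> i - 2) = fweight i - act u (simple_root i)"
      using omega_cox [OF assms(1), of i "\<xi> i"] c(2) by simp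
    then have "phi \<xi> (i, \<xi> i) = act u (simple_root i)" by (simp add: phi_def)
    then show ?thesis by (simp only: rootsI)
  qed
  define k where "k = (\<xi> i - p) div 2"
  have p: "p = \<xi> i - 2 * k" using assms(2) by (auto simp: k_def)
  obtain w where w: "cox_power \<xi> k = act w" using cox_power_act [OF assms(1)] by blast
  have "phi \<xi> (i, p) = act w (phi \<xi> (i, \<xi> i))"
  proof -
    have "omega \<xi> (i, p - 2) = cox_power \<xi> (k + 1) (fweight i)" by (simp add: omega_def p)
    also have "\<dots> = act w (omega \<xi> (i, \<xi> i - 2))"
      using omega_cox [OF assms(1), of i "\<xi> i"] cox_power_Suc(2) [OF assms(1), of k "fweight i"] w by simp
    finally show ?thesis by (simp add: phi_def) (simp add: omega_def p w)
  qed
  then show ?thesis using base by auto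
qed


subsection \<open>Coordinates of adapted words\<close>

text \<open>The positions of the repetition quiver that a word of source reflections passes, in
  order.\<close>

fun track :: "('n \<Rightarrow> int) \<Rightarrow> 'n list \<Rightarrow> ('n \<times> int) list" where
  "track \<xi> [] = []"
| "track \<xi> (i # w) = (i, \<xi> i) # track (reflect_height i \<xi>) w"

lemma length_track [simp]: "length (track \<xi> w) = length w"
  by (induction w arbitrary: \<xi>) auto

lemma map_fst_track [simp]: "map fst (track \<xi> w) = w"
  by (induction w arbitrary: \<xi>) auto

lemma track_append: "track \<xi> (u @ w) = track \<xi> u @ track (final_height \<xi> u) w"
  by (induction u arbitrary: \<xi>) auto

lemma set_track:
  "set (track \<xi> w) = {(i, p). even (p - \<xi> i) \<and> p \<le> \<xi> i \<and> final_height \<xi> w i < p}"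
proof (induction w arbitrary: \<xi>)
  case (Cons k w)
  have le: "final_height (reflect_height k \<xi>) w i \<le> reflect_height k \<xi> i" for i
    by (simp add: final_height_def)
  have "x \<in> set (track \<xi> (k # w)) \<longleftrightarrow> x \<in> {(i, p). even (p - \<xi> i) \<and> p \<le> \<xi> i \<and> final_height \<xi> (k # w) i < p}"
    for x
  proof (cases x)
    case (Pair i p)
    have "even (p - \<xi> k) \<Longrightarrow> (p = \<xi> k \<or> p \<le> \<xi> k - 2) \<longleftrightarrow> p \<le> \<xi> k" by presburger
    then show ?thesis
      using Pair le [of k] by (cases "i = k") (auto simp: Cons.IH reflect_height_def)
  qed
  then show ?case by blast
qed auto

lemma distinct_track: "distinct (track \<xi> w)"
  by (induction w arbitrary: \<xi>) (auto simp: set_track reflect_height_def)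

text \<open>A letter is a source when it is read, and there \<open>phi\<close> is its simple root;
  the prefix carries this back to the original quiver.\<close>

lemma word_root_track:
  assumes "height \<xi>" "adapted A \<xi> w" "k < length w"
  shows "wroot w k = phi \<xi> (track \<xi> w ! k)"
proof -
  define u where "u = take k w"
  have w: "w = u @ w ! k # drop (Suc k) w" using assms(3) by (simp add: u_def id_take_nth_drop)
  have ad: "adapted A \<xi> u" "source (final_height \<xi> u) (w ! k)"
    using assms(2) by (subst (asm) w, simp)+
  have "track \<xi> w ! k = (w ! k, final_height \<xi> u (w ! k))"
    using assms(3) by (subst w) (simp add: track_append nth_append u_def)
  then have "phi \<xi> (track \<xi> w ! k) = act u (simple_root (w ! k))"
    using phi_word [OF assms(1) ad(1)] phi_source [OF height_final [OF assms(1) ad(1)] ad(2)] by simp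
  then show ?thesis by (simp add: word_root_def u_def)
qed

subsection \<open>The Perron vector\<close>

text \<open>Minimize the Rayleigh quotient of \<open>form\<close> against the
  \<open>d\<close>-weighted norm. The minimum \<mu> is an eigenvalue of the Cartan matrix, and 2 cos
  \<theta> = 2 - \<mu>. Definiteness gives \<theta> > 0, and nonpositive off-diagonal entries give
  \<theta> \<le> pi / 2.\<close>

lemma perron_vector_exists:
  "\<exists>(v :: 'n \<Rightarrow> real) \<theta>. (\<forall>i. 0 < v i) \<and> 0 < \<theta> \<and> \<theta> \<le> pi / 2 \<and>
     (\<forall>i. (\<Sum>j\<in>UNIV - {i}. of_int (A $ j $ i) * v j) = - (2 * cos \<theta> * v i))"
proof -
  define N where "N x = (\<Sum>i\<in>UNIV. d i * (x $ i)\<^sup>2)" for x :: "real ^ 'n"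
  have N_pos: "0 < N x" if "x \<noteq> 0" for x
  proof -
    from that obtain i where "x $ i \<noteq> 0" by (auto simp: vec_eq_iff)
    then have "0 < d i * (x $ i)\<^sup>2" using d_pos by simp
    also have "\<dots> \<le> N x" unfolding N_def
      by (rule member_le_sum) (use d_pos in \<open>auto intro!: mult_nonneg_nonneg simp: less_imp_le\<close>)
    finally show ?thesis .
  qed
  have "compact (sphere 0 1 :: (real ^ 'n) set)" by simp
  moreover have "simple_root undefined \<in> (sphere 0 1 :: (real ^ 'n) set)"
    by (simp add: simple_root_def)
  then have "sphere 0 1 \<noteq> ({} :: (real ^ 'n) set)" by blast
  moreover have "continuous_on (sphere 0 1) (\<lambda>x. form x x / N x)"
    unfolding form_def
  proof (intro continuous_intros)
    show "continuous_on (sphere 0 1) N" unfolding N_def by (intro continuous_intros)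
    show "\<forall>x\<in>sphere 0 1. N x \<noteq> 0" by (metis N_pos less_irrefl mem_sphere_0 norm_zero zero_neq_one)
  qed
  ultimately obtain y where y: "y \<in> sphere 0 1"
    "\<And>z. z \<in> sphere 0 1 \<Longrightarrow> form y y / N y \<le> form z z / N z"
    using continuous_attains_inf [of "sphere 0 1" "\<lambda>x. form x x / N x"] by metis
  define \<mu> where "\<mu> = form y y / N y"
  have y0: "y \<noteq> 0" using y(1) by auto
  have \<mu>_pos: "0 < \<mu>" using N_pos [OF y0] form_pos [OF y0] by (simp add: \<mu>_def)
  have least: "\<mu> * N z \<le> form z z" for z
  proof (cases "z = 0")
    case True
    then show ?thesis by (simp add: N_def form_def)
  next
    case False
    define c where "c = 1 / norm z"
    have c: "0 < c" using False by (simp add: c_def)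
    have "c *\<^sub>R z \<in> sphere 0 1" using False by (simp add: c_def)
    then have "\<mu> \<le> form (c *\<^sub>R z) (c *\<^sub>R z) / N (c *\<^sub>R z)" using y(2) by (simp add: \<mu>_def)
    also have "\<dots> = (c\<^sup>2 * form z z) / (c\<^sup>2 * N z)"
      by (simp add: form_scale_left form_scale_right N_def power_mult_distrib sum_distrib_left
          power2_eq_square mult_ac)
    also have "\<dots> = form z z / N z" using c by simp
    finally show ?thesis using N_pos [OF False] by (simp add: field_simps)
  qed
  \<comment> \<open>Absolute values keep N and cannot increase the form, as off-diagonal entries are
    nonpositive; so x is a nonnegative minimizer.\<close>
  define x :: "real ^ 'n" where "x = (\<chi> i. \<bar>y $ i\<bar>)"
  have x_nonneg: "0 \<le> x $ i" for i by (simp add: x_def)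
  have x0: "x \<noteq> 0" using y0 by (auto simp: x_def vec_eq_iff)
  have "N x = N y" by (simp add: N_def x_def)
  moreover have "form x x \<le> form y y"
    unfolding form_def
  proof (intro sum_mono)
    fix i j
    show "d i * of_int (A $ i $ j) * x $ i * x $ j \<le> d i * of_int (A $ i $ j) * y $ i * y $ j"
    proof (cases "i = j")
      case True
      then show ?thesis by (simp add: x_def mult.assoc)
    next
      case False
      then have "d i * of_int (A $ i $ j) \<le> 0"
        using offdiag d_pos by (simp add: mult_nonneg_nonpos less_imp_le)
      moreover have "y $ i * y $ j \<le> x $ i * x $ j"
        unfolding x_def by (simp flip: abs_mult)
      ultimately have "d i * of_int (A $ i $ j) * (x $ i * x $ j) \<le> d i * of_int (A $ i $ j) * (y $ i * y $ j)"
        by (intro mult_left_mono_neg)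
      then show ?thesis by (simp only: mult.assoc)
    qed
  qed
  ultimately have xmin: "form x x = \<mu> * N x"
    using least [of x] N_pos [OF y0] by (simp add: \<mu>_def)
  have eigen: "pairing i x = \<mu> * x $ i" for i
  proof -
    define a where "a = d i * (pairing i x - \<mu> * x $ i)"
    define b where "b = (2 - \<mu>) * d i"
    \<comment> \<open>Moving the minimizer along \<open>simple_root i\<close> changes form minus
      \<mu> N by this quadratic in t. It is nonnegative for all t, so its linear coefficient
      vanishes: this is the eigenvector equation.\<close>
    have quad: "0 \<le> 2 * t * a + t\<^sup>2 * b" for t
    proof -
      define z where "z = x + t *\<^sub>R simple_root i"
      have "form z z = form x x + 2 * t * (d i * pairing i x) + t\<^sup>2 * (2 * d i)"
        using form_commute [of x "simple_root i"]
        by (simp add: z_def form_add_left form_add_right form_scale_left form_scale_right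
            form_simple_root diag power2_eq_square algebra_simps)
      moreover have "N z = N x + 2 * t * (d i * x $ i) + t\<^sup>2 * d i"
      proof -
        have "N z = d i * (x $ i + t)\<^sup>2 + (\<Sum>j\<in>UNIV - {i}. d j * (x $ j)\<^sup>2)"
          unfolding N_def by (subst sum.remove [of _ i]) (simp_all add: z_def)
        moreover have "N x = d i * (x $ i)\<^sup>2 + (\<Sum>j\<in>UNIV - {i}. d j * (x $ j)\<^sup>2)"
          unfolding N_def by (subst sum.remove [of _ i]) simp_all
        ultimately show ?thesis by (simp add: power2_eq_square algebra_simps)
      qed
      ultimately have "form z z - \<mu> * N z = 2 * t * a + t\<^sup>2 * b"
        using xmin by (simp add: a_def b_def algebra_simps)
      then show ?thesis using least [of z] by simp
    qed
    have "a = 0"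
    proof (rule ccontr)
      assume "a \<noteq> 0"
      define B where "B = \<bar>b\<bar> + 1"
      have B: "0 < B" "b < B" by (auto simp: B_def)
      have "0 \<le> 2 * (- a / B) * a + (- a / B)\<^sup>2 * b" by (rule quad)
      also have "\<dots> = (a / B)\<^sup>2 * (b - 2 * B)" using B by (simp add: power2_eq_square field_simps)
      also have "\<dots> < 0" using B \<open>a \<noteq> 0\<close> by (intro mult_pos_neg) auto
      finally show False by simp
    qed
    then show ?thesis using d_pos [of i] by (simp add: a_def)
  qed
  have row: "(\<Sum>j\<in>UNIV - {i}. of_int (A $ i $ j) * x $ j) = (\<mu> - 2) * x $ i" for i
  proof -
    have "pairing i x = 2 * x $ i + (\<Sum>j\<in>UNIV - {i}. of_int (A $ i $ j) * x $ j)"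
      unfolding coroot_pairing_def by (subst sum.remove [of _ i]) (simp_all add: diag)
    then show ?thesis using eigen [of i] by (simp add: algebra_simps)
  qed
  have off: "of_int (A $ i $ j) * x $ j \<le> 0" if "i \<noteq> j" for i j
    using offdiag [OF that] x_nonneg [of j] by (simp add: mult_nonpos_nonneg)
  \<comment> \<open>In one row of the eigenvector equation all terms have the same sign, so a zero
    coordinate spreads to the neighbours and, by connectedness, everywhere.\<close>
  have spread: "x $ j = 0" if "x $ i = 0" "adjacent A i j" for i j
  proof -
    have "(\<Sum>j\<in>UNIV - {i}. - (of_int (A $ i $ j) * x $ j)) = 0" using row [of i] that by (simp add: sum_negf)
    then have "\<forall>j\<in>UNIV - {i}. - (of_int (A $ i $ j) * x $ j) = 0"
      by (subst (asm) sum_nonneg_eq_0_iff) (use off in auto)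
    then show ?thesis using that by (auto simp: adjacent_def)
  qed
  have x_pos: "0 < x $ i" for i
  proof (rule ccontr)
    assume "\<not> 0 < x $ i"
    then have "x $ i = 0" using x_nonneg [of i] by simp
    moreover have "x $ j = 0" if "(adjacent A)\<^sup>*\<^sup>* i j" for j
      using that by (induction rule: rtranclp_induct) (use \<open>x $ i = 0\<close> spread in auto)
    ultimately show False using connected x0 by (auto simp: vec_eq_iff)
  qed
  have \<mu>2: "\<mu> \<le> 2"
  proof -
    fix i :: 'n
    have "(\<mu> - 2) * x $ i \<le> 0"
      unfolding row [symmetric] by (rule sum_nonpos) (use off in auto)
    then show ?thesis using x_pos [of i] by (simp add: mult_le_0_iff)
  qed
  define \<theta> where "\<theta> = arccos ((2 - \<mu>) / 2)"
  have \<theta>: "cos \<theta> = (2 - \<mu>) / 2" unfolding \<theta>_def using \<mu>2 \<mu>_pos by (intro cos_arccos) auto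
  have \<theta>_range: "0 \<le> \<theta>" "\<theta> \<le> pi / 2" unfolding \<theta>_def
    using \<mu>2 \<mu>_pos arccos_lbound [of "(2 - \<mu>) / 2"] arccos_le_pi2 [of "(2 - \<mu>) / 2"] by simp_all
  moreover have "\<theta> \<noteq> 0" using \<theta> \<mu>_pos by auto
  ultimately have "0 < \<theta>" "\<theta> \<le> pi / 2" by auto
  \<comment> \<open>The mesh relations involve the columns of A; scaling by \<open>d\<close> turns
    the eigenvector for the rows into one for the columns.\<close>
  moreover have "(\<Sum>j\<in>UNIV - {i}. of_int (A $ j $ i) * (d j * x $ j)) = - (2 * cos \<theta> * (d i * x $ i))" for i
  proof -
    have "of_int (A $ j $ i) * (d j * x $ j) = d i * (of_int (A $ i $ j) * x $ j)" for j
      using d_sym [of i j] by (simp add: algebra_simps)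
    then have "(\<Sum>j\<in>UNIV - {i}. of_int (A $ j $ i) * (d j * x $ j)) = d i * ((\<mu> - 2) * x $ i)"
      by (simp only: row sum_distrib_left [symmetric])
    also have "\<dots> = - (2 * cos \<theta> * (d i * x $ i))" by (simp add: \<theta> field_simps)
    finally show ?thesis .
  qed
  ultimately show ?thesis
    using x_pos d_pos by (intro exI [of _ "\<lambda>j. d j * x $ j"] exI [of _ \<theta>]) auto
qed

definition perron :: "('n \<Rightarrow> real) \<times> real" where
  "perron = (SOME (v, \<theta>). (\<forall>i. 0 < v i) \<and> 0 < \<theta> \<and> \<theta> \<le> pi / 2 \<and>
     (\<forall>i. (\<Sum>j\<in>UNIV - {i}. of_int (A $ j $ i) * v j) = - (2 * cos \<theta> * v i)))"

definition pvec :: "'n \<Rightarrow> real" where "pvec = fst perron"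
definition angle :: real where "angle = snd perron"

lemma perron:
  "0 < pvec i" "0 < angle" "angle \<le> pi / 2"
  "(\<Sum>j\<in>UNIV - {i}. of_int (A $ j $ i) * pvec j) = - (2 * cos angle * pvec i)"
proof -
  have "case perron of (v, \<theta>) \<Rightarrow> (\<forall>i. 0 < v i) \<and> 0 < \<theta> \<and> \<theta> \<le> pi / 2 \<and>
     (\<forall>i. (\<Sum>j\<in>UNIV - {i}. of_int (A $ j $ i) * v j) = - (2 * cos \<theta> * v i))"
    unfolding perron_def by (rule someI_ex) (use perron_vector_exists in auto)
  then show "0 < pvec i" "0 < angle" "angle \<le> pi / 2"
    "(\<Sum>j\<in>UNIV - {i}. of_int (A $ j $ i) * pvec j) = - (2 * cos angle * pvec i)"
    by (auto simp: pvec_def angle_def split: prod.splits)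
qed

lemma angle_less: "0 < angle / 2" "angle / 2 < pi"
  using perron pi_gt_zero by (simp, linarith)

lemma sin_half_angle: "0 < sin (angle / 2)"
  using angle_less by (intro sin_gt_zero)

text \<open>Positive on positive roots, so its sign decides the sign of a root.\<close>

definition psum :: "real ^ 'n \<Rightarrow> real" where
  "psum u = (\<Sum>j\<in>UNIV. pvec j * u $ j)"

lemma linear_psum: "linear psum"
  by (rule linearI) (simp_all add: psum_def algebra_simps sum.distrib sum_distrib_left)

lemma psum_simple_root [simp]: "psum (simple_root i) = pvec i"
  by (simp add: psum_def if_distrib [of "\<lambda>x. _ * x"] cong: if_cong)

lemma psum_uminus [simp]: "psum (- u) = - psum u"
  by (simp add: psum_def sum_negf)

lemma psum_pos:
  assumes "nonneg u" "u \<noteq> 0"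
  shows "0 < psum u"
proof -
  obtain i where "u $ i \<noteq> 0" using assms(2) by (auto simp: vec_eq_iff)
  then have "0 < pvec i * u $ i" using assms(1) perron(1) by (auto simp: nonneg_def less_le)
  also have "\<dots> \<le> psum u" unfolding psum_def
    by (rule member_le_sum) (use assms(1) perron(1) in \<open>simp_all add: nonneg_def less_imp_le\<close>)
  finally show ?thesis .
qed

text \<open>The sum of the sines of x - angle and x + angle is 2 cos angle sin x, which matches the
  Perron eigenvalue.\<close>

lemma sine_mesh_additive:
  "mesh_additive (\<lambda>(i, p). pvec i * sin (angle * (c - of_int p)))"
  unfolding mesh_additive_def
proof (intro allI)
  fix i and p :: int
  define x where "x = angle * (c - of_int p)"
  have "sin (angle * (c - of_int (p + 1))) + sin (angle * (c - of_int (p - 1))) =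
      sin (x - angle) + sin (x + angle)"
    by (simp add: x_def algebra_simps)
  also have "\<dots> = 2 * cos angle * sin x" by (simp add: sin_add sin_diff)
  finally have "pvec i * sin (angle * (c - of_int (p + 1))) + pvec i * sin (angle * (c - of_int (p - 1)))
      = 2 * cos angle * pvec i * sin x" by (simp flip: distrib_left)
  also have "\<dots> = - ((\<Sum>j\<in>UNIV - {i}. of_int (A $ j $ i) * pvec j) * sin x)"
    using perron(4) [of i] by simp
  also have "\<dots> = - (\<Sum>j\<in>UNIV - {i}. of_int (A $ j $ i) * (pvec j * sin x))"
    by (simp add: sum_distrib_right mult.assoc)
  finally show "(case (i, p + 1) of (i, p) \<Rightarrow> pvec i * sin (angle * (c - of_int p))) +
      (case (i, p - 1) of (i, p) \<Rightarrow> pvec i * sin (angle * (c - of_int p))) =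
      - (\<Sum>j\<in>UNIV - {i}. of_int (A $ j $ i) *\<^sub>R (case (j, p) of (i, p) \<Rightarrow> pvec i * sin (angle * (c - of_int p))))"
    by (simp add: x_def)
qed


subsection \<open>Bipartite quivers\<close>

definition bipartite :: "int \<Rightarrow> ('n \<Rightarrow> int) \<Rightarrow> bool" where
  "bipartite M \<xi> \<longleftrightarrow> height \<xi> \<and> (\<forall>i. \<xi> i = M \<or> \<xi> i = M + 1)"

lemma bipartite_height: "bipartite M \<xi> \<Longrightarrow> height \<xi>"
  by (simp add: bipartite_def)

lemma bipartite_neighbour:
  assumes "bipartite M \<xi>" "adjacent A i j"
  shows "\<xi> j = 2 * M + 1 - \<xi> i"
proof -
  have "\<xi> i = M \<or> \<xi> i = M + 1" "\<xi> j = M \<or> \<xi> j = M + 1" "\<xi> j = \<xi> i + 1 \<or> \<xi> j = \<xi> i - 1"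
    using assms heightD [of \<xi> i j] by (auto simp: bipartite_def)
  then show ?thesis by auto
qed

lemma bipartite_source: "bipartite M \<xi> \<Longrightarrow> \<xi> i = M + 1 \<Longrightarrow> source \<xi> i"
  using bipartite_neighbour by (fastforce simp: is_source_def)

lemma bipartite_phi_source: "bipartite M \<xi> \<Longrightarrow> \<xi> i = M + 1 \<Longrightarrow> phi \<xi> (i, M + 1) = simple_root i"
  using phi_source bipartite_source by (metis bipartite_def)

lemma bipartite_phi_sink:
  assumes "bipartite M \<xi>" "\<xi> i = M"
  shows "phi \<xi> (i, M + 2) = - simple_root i"
proof -
  have "phi \<xi> (i, \<xi> i + 2) = - simple_root i"
  proof (rule phi_sink [OF bipartite_height [OF assms(1)]])
    fix j assume "adjacent A i j"
    from bipartite_neighbour [OF assms(1) this] show "\<xi> j = \<xi> i + 1" by (simp add: assms(2))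
  qed
  then show ?thesis by (simp add: assms(2))
qed

text \<open>The zero of the sine is at M + 3/2, midway between layer M + 1, where sources carry
  their simple roots, and layer M + 2, where sinks carry the negatives of theirs. The values there
  are plus and minus sin (angle / 2).\<close>

definition layer_sine :: "int \<Rightarrow> int \<Rightarrow> real" where
  "layer_sine M p = sin (angle * (of_int M + 3 / 2 - of_int p))"

lemma psum_phi:
  assumes "bipartite M \<xi>" "even (p - \<xi> i)"
  shows "sin (angle / 2) * psum (phi \<xi> (i, p)) = pvec i * layer_sine M p"
proof -
  \<comment> \<open>The slice through layers M + 1 and M + 2, on which \<open>phi\<close> is known
    at every vertex.\<close>
  define \<eta> where "\<eta> i = (if \<xi> i = M then M + 2 else M + 1)" for i
  have h: "height \<xi>" and cases: "\<xi> i = M \<or> \<xi> i = M + 1" for i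
    using assms(1) by (auto simp: bipartite_def)
  have h\<eta>: "height \<eta>"
    unfolding height_function_def
  proof (intro allI impI)
    fix k j assume "adjacent A k j"
    then show "\<bar>\<eta> k - \<eta> j\<bar> = 1"
      using bipartite_neighbour [OF assms(1), of k j] cases [of k] by (auto simp: \<eta>_def)
  qed
  have lin: "linear (\<lambda>u. sin (angle / 2) * psum u)"
    using linear_psum by (intro linearI) (simp_all add: linear_add linear_scale algebra_simps)
  have "(\<lambda>x. sin (angle / 2) * psum (phi \<xi> x)) (i, p) =
      (\<lambda>(i, p). pvec i * sin (angle * ((of_int M + 3 / 2) - of_int p))) (i, p)"
  proof (rule mesh_additive_unique [OF mesh_additive_linear [OF lin phi_mesh_additive [OF h]]
        sine_mesh_additive h\<eta>])
    fix j
    show "sin (angle / 2) * psum (phi \<xi> (j, \<eta> j)) =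
        (\<lambda>(i, p). pvec i * sin (angle * ((of_int M + 3 / 2) - of_int p))) (j, \<eta> j)"
    proof (cases "\<xi> j = M")
      case True
      then show ?thesis using bipartite_phi_sink [OF assms(1) True] by (simp add: \<eta>_def)
    next
      case False
      then have "\<xi> j = M + 1" using cases by blast
      then show ?thesis using bipartite_phi_source [OF assms(1)] by (simp add: \<eta>_def)
    qed
    show "even (p - \<eta> i)" using assms(2) cases [of i] by (auto simp: \<eta>_def)
  qed
  then show ?thesis by (simp add: layer_sine_def)
qed

lemma phi_nonneg_bipartite:
  assumes "bipartite M \<xi>" "even (p - \<xi> i)" "0 \<le> layer_sine M p"
  shows "nonneg (phi \<xi> (i, p))"
proof (rule ccontr)
  assume n: "\<not> ?thesis"
  have root: "phi \<xi> (i, p) \<in> roots" by (rule phi_roots [OF bipartite_height [OF assms(1)] assms(2)])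
  then have "nonneg (- phi \<xi> (i, p))" "- phi \<xi> (i, p) \<noteq> 0"
    using root_nonneg_or n roots_nonzero by (blast, simp)
  then have "0 < psum (- phi \<xi> (i, p))" by (rule psum_pos)
  moreover have "0 \<le> pvec i * layer_sine M p"
    using assms(3) perron(1) [of i] by simp
  moreover have "sin (angle / 2) * psum (phi \<xi> (i, p)) < 0"
    using sin_half_angle \<open>0 < psum (- phi \<xi> (i, p))\<close> by (intro mult_pos_neg) simp_all
  ultimately show False unfolding psum_phi [OF assms(1,2)] by simp
qed

lemma phi_nonpos_bipartite:
  assumes "bipartite M \<xi>" "even (p - \<xi> i)" "layer_sine M p \<le> 0"
  shows "nonneg (- phi \<xi> (i, p))"
proof (rule ccontr)
  assume n: "\<not> ?thesis"
  have root: "phi \<xi> (i, p) \<in> roots" by (rule phi_roots [OF bipartite_height [OF assms(1)] assms(2)])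
  then have "nonneg (phi \<xi> (i, p))" "phi \<xi> (i, p) \<noteq> 0"
    using root_nonneg_or n roots_nonzero by blast+
  then have "0 < psum (phi \<xi> (i, p))" by (rule psum_pos)
  with sin_half_angle have "0 < sin (angle / 2) * psum (phi \<xi> (i, p))" by (rule mult_pos_pos)
  then have "0 < pvec i * layer_sine M p"
    unfolding psum_phi [OF assms(1,2)] .
  then show False using assms(3) perron(1) [of i] by (simp add: zero_less_mult_iff)
qed

text \<open>Comparing sines 2m apart gives cos y sin (m angle) = 0 at all midpoints y. If the second
  factor were nonzero, the cosine would vanish at midpoints 2 angle apart, forcing angle = pi / 2;
  but then the offset 3/2 makes the midpoints odd multiples of pi / 4.\<close>

lemma phi_period_sin:
  assumes "bipartite M \<xi>" "\<And>q. even (q - \<xi> i) \<Longrightarrow> phi \<xi> (i, q + 2 * m) = phi \<xi> (i, q)"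
  shows "sin (angle * of_int m) = 0"
proof (rule ccontr)
  assume nz: "sin (angle * of_int m) \<noteq> 0"
  have period: "layer_sine M (q + 2 * m) = layer_sine M q" if "even (q - \<xi> i)" for q
  proof -
    have "even (q + 2 * m - \<xi> i)" using that by simp
    then have "pvec i * layer_sine M (q + 2 * m) = pvec i * layer_sine M q"
      using psum_phi [OF assms(1)] assms(2) [OF that] that by metis
    then show ?thesis using perron(1) [of i] by simp
  qed
  define x where "x = angle * (of_int M + 3 / 2 - of_int (\<xi> i) - of_int m)"
  have cos0: "cos (x + angle * of_int n) = 0" if "even n" for n
  proof -
    define y where "y = x + angle * of_int n"
    have "layer_sine M (\<xi> i - n + 2 * m) = sin (y - angle * of_int m)"
      unfolding layer_sine_def y_def x_def by (rule arg_cong [of _ _ sin]) (simp add: algebra_simps)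
    moreover have "layer_sine M (\<xi> i - n) = sin (y + angle * of_int m)"
      unfolding layer_sine_def y_def x_def by (rule arg_cong [of _ _ sin]) (simp add: algebra_simps)
    ultimately have "sin (y - angle * of_int m) = sin (y + angle * of_int m)"
      using period [of "\<xi> i - n"] that by simp
    then have "cos y * sin (angle * of_int m) = 0" by (simp add: sin_add sin_diff)
    then show ?thesis using nz by (simp add: y_def)
  qed
  have "cos x = 0" using cos0 [of 0] by simp
  moreover have "cos (x + 2 * angle) = 0" using cos0 [of 2] by (simp add: mult.commute)
  ultimately have "sin x * sin (2 * angle) = 0" by (simp add: cos_add)
  moreover have "sin x \<noteq> 0" using \<open>cos x = 0\<close> by (metis sin_zero_abs_cos_one abs_zero zero_neq_one)
  ultimately have "sin (2 * angle) = 0" by simp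
  then have "angle = pi / 2"
    using perron(2,3) sin_gt_zero [of "2 * angle"] by force
  then have x: "x = (of_int (2 * (M - \<xi> i - m) + 3)) * (pi / 4)"
    by (simp only: x_def) (simp add: field_simps)
  obtain n where "odd n" "x = of_int n * (pi / 2)" using \<open>cos x = 0\<close> cos_zero_iff_int by blast
  then have "of_int (2 * (M - \<xi> i - m) + 3) * (pi / 4) = of_int (2 * n) * (pi / 4)"
    using x by simp
  then have "real_of_int (2 * (M - \<xi> i - m) + 3) = of_int (2 * n)"
    by (simp only: mult_cancel_right) simp
  then have "2 * (M - \<xi> i - m) + 3 = 2 * n" by (simp only: of_int_eq_iff)
  then show False by presburger
qed

text \<open>The largest integer l with angle * (l - 1/2) \<le> pi, that is, the number of
  consecutive layers from M + 1 downwards with nonnegative sine. It turns out to be pi / angle and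
  the Coxeter number.\<close>

definition layers :: int where
  "layers = \<lfloor>pi / angle + 1 / 2\<rfloor>"

lemma layers_bounds:
  "2 \<le> layers" "angle * (of_int layers - 1 / 2) \<le> pi" "pi < angle * (of_int layers + 1 / 2)"
proof -
  have le: "of_int layers \<le> pi / angle + 1 / 2" and lt: "pi / angle + 1 / 2 < of_int layers + 1"
    unfolding layers_def by linarith+
  show "angle * (of_int layers - 1 / 2) \<le> pi" "pi < angle * (of_int layers + 1 / 2)"
    using le lt perron(2) by (simp_all add: field_simps)
  have "2 \<le> pi / angle" using perron(2,3) by (simp add: field_simps)
  then show "2 \<le> layers" unfolding layers_def by linarith
qed

lemma layer_sine_nonneg:
  assumes "M + 2 - layers \<le> p" "p \<le> M + 1"
  shows "0 \<le> layer_sine M p"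
  unfolding layer_sine_def
proof (rule sin_ge_zero)
  have "real_of_int p \<le> of_int (M + 1)" using assms(2) by (simp only: of_int_le_iff)
  then show "0 \<le> angle * (of_int M + 3 / 2 - of_int p)"
    using perron(2) by simp
  have "real_of_int (M + 2 - layers) \<le> of_int p" using assms(1) by (simp only: of_int_le_iff)
  then have "angle * (of_int M + 3 / 2 - of_int p) \<le> angle * (of_int layers - 1 / 2)"
    using perron(2) by (intro mult_left_mono) auto
  then show "angle * (of_int M + 3 / 2 - of_int p) \<le> pi" using layers_bounds(2) by linarith
qed

lemma layer_sine_next: "layer_sine M (M + 1 - layers) = sin (angle * (of_int layers + 1 / 2))"
  unfolding layer_sine_def by (rule arg_cong [of _ _ sin]) (simp add: algebra_simps)

lemma layer_sine_last: "layer_sine M (M + 2 - layers) = sin (angle * (of_int layers - 1 / 2))"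
  unfolding layer_sine_def by (rule arg_cong [of _ _ sin]) (simp add: algebra_simps)

lemma layer_sine_nonpos: "layer_sine M (M + 1 - layers) \<le> 0"
proof -
  have "angle * (of_int layers + 1 / 2) = angle * (of_int layers - 1 / 2) + angle"
    by (simp add: algebra_simps)
  then have "angle * (of_int layers + 1 / 2) < 2 * pi"
    using layers_bounds(2) perron(3) pi_gt_zero by linarith
  then have "sin (angle * (of_int layers + 1 / 2)) < 0"
    using layers_bounds(3) by (intro sin_lt_zero) auto
  then show ?thesis by (simp add: layer_sine_next)
qed

text \<open>The first position of the right parity in column i below the layers with nonnegative
  sine.\<close>

definition last_height :: "int \<Rightarrow> ('n \<Rightarrow> int) \<Rightarrow> 'n \<Rightarrow> int" where
  "last_height M \<xi> i = (if even (M + 1 - layers - \<xi> i) then M + 1 - layers else M - layers)"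

lemma last_height_facts:
  assumes "bipartite M \<xi>"
  shows "bipartite (M - layers) (last_height M \<xi>)" "even (\<xi> i - last_height M \<xi> i)"
    "last_height M \<xi> i \<le> \<xi> i"
proof -
  show "even (\<xi> i - last_height M \<xi> i)" by (auto simp: last_height_def)
  have "M \<le> \<xi> i" using assms by (auto simp: bipartite_def)
  then show "last_height M \<xi> i \<le> \<xi> i" using layers_bounds(1) by (auto simp: last_height_def)
  have "height (last_height M \<xi>)"
    unfolding height_function_def
  proof (intro allI impI)
    fix k j assume "adjacent A k j"
    then have "\<xi> j = 2 * M + 1 - \<xi> k" using bipartite_neighbour [OF assms] by blast
    then show "\<bar>last_height M \<xi> k - last_height M \<xi> j\<bar> = 1" by (auto simp: last_height_def)
  qed
  then show "bipartite (M - layers) (last_height M \<xi>)" by (auto simp: bipartite_def last_height_def)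
qed

text \<open>
  Along a bipartite quiver the functional \<^const>\<open>psum\<close> takes sinusoidal values, so exactly the
  first \<open>layers\<close> layers are positive roots, and the corresponding adapted word sends every simple
  root to a negative root.
\<close>

lemma bipartite_longest_word:
  assumes "bipartite M \<xi>"
  obtains w where "adapted A \<xi> w" "final_height \<xi> w = last_height M \<xi>" "w0 = act w"
    "length w = card (positive_roots A)"
proof -
  note h = bipartite_height [OF assms]
  note last = last_height_facts [OF assms]
  obtain w where w: "adapted A \<xi> w" "final_height \<xi> w = last_height M \<xi>"
    using descend_word [OF h bipartite_height [OF last(1)] last(3,2)] by metis
  have pos: "nonneg (wroot w k)" if k: "k < length w" for k
  proof -
    obtain i p where ip: "track \<xi> w ! k = (i, p)" by fastforce
    then have "(i, p) \<in> set (track \<xi> w)" using k by (metis length_track nth_mem)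
    then have p: "even (p - \<xi> i)" "p \<le> \<xi> i" "last_height M \<xi> i < p"
      using w(2) by (auto simp: set_track)
    have "p \<le> M + 1" using p(2) assms by (auto simp: bipartite_def) (metis add.commute zle_add1_eq_le order.trans le_cases zless_add1_eq)
    moreover have "M + 2 - layers \<le> p"
      using p(1,3) by (auto simp: last_height_def split: if_splits) presburger+
    ultimately have "nonneg (phi \<xi> (i, p))"
      using phi_nonneg_bipartite [OF assms p(1)] layer_sine_nonneg by blast
    then show ?thesis using word_root_track [OF h w(1) k] ip by simp
  qed
  \<comment> \<open>After the word, a source carries its simple root at layer M + 1 - layers, where
    the original root is negative; a sink carries the negative of its simple root at layer M + 2 -
    layers, where the original root is positive.\<close>
  have neg: "nonneg (- act w (simple_root i))" for i
  proof (cases "last_height M \<xi> i = M - layers + 1")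
    case True
    then have "simple_root i = phi (last_height M \<xi>) (i, M - layers + 1)"
      using bipartite_phi_source [OF last(1)] by simp
    then have "act w (simple_root i) = phi \<xi> (i, M + 1 - layers)"
      using phi_word [OF h w(1)] w(2) by (simp add: algebra_simps)
    moreover have "even (M + 1 - layers - \<xi> i)"
    proof -
      have "M + 1 - layers = last_height M \<xi> i" using True by simp
      then show ?thesis using last(2) [of i] by auto
    qed
    then have "nonneg (- phi \<xi> (i, M + 1 - layers))"
      by (rule phi_nonpos_bipartite [OF assms _ layer_sine_nonpos])
    ultimately show ?thesis by simp
  next
    case False
    then have lh: "last_height M \<xi> i = M - layers" using last(1) by (auto simp: bipartite_def)
    then have "- simple_root i = phi (last_height M \<xi>) (i, M - layers + 2)"
      using bipartite_phi_sink [OF last(1)] by simp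
    then have "- act w (simple_root i) = phi \<xi> (i, M + 2 - layers)"
      using phi_word [OF h w(1), of "(i, M + 2 - layers)"] w(2) by (simp add: algebra_simps flip: act_simps(3))
    moreover have even: "even (M + 2 - layers - \<xi> i)"
    proof -
      have "even (\<xi> i - (M - layers))" using last(2) [of i] lh by simp
      then show ?thesis by presburger
    qed
    moreover have "nonneg (phi \<xi> (i, M + 2 - layers))"
      by (rule phi_nonneg_bipartite [OF assms even layer_sine_nonneg]) (use layers_bounds(1) in simp_all)
    ultimately show ?thesis by simp
  qed
  then have "makes_negative w" by (simp add: makes_negative_def)
  then show thesis
    using that [of w] w longest_element_eqI makes_negative_length positive_word_length(1) [OF pos] by metis
qed

lemma last_height_omega:
  assumes "bipartite M \<xi>"
  shows "omega \<xi> (i, last_height M \<xi> i) = - fweight (star i)"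
proof -
  obtain w where w: "adapted A \<xi> w" "final_height \<xi> w = last_height M \<xi>" "w0 = act w"
    using bipartite_longest_word [OF assms] by metis
  have "omega \<xi> (i, last_height M \<xi> i) = act w (omega (last_height M \<xi>) (i, last_height M \<xi> i))"
    using omega_word [OF bipartite_height [OF assms] w(1)] w(2) by simp
  then show ?thesis using w(3) w0_fweight by simp
qed

lemma last_height_phi:
  assumes "bipartite M \<xi>"
  shows "last_height M \<xi> i = M + 1 - layers \<Longrightarrow> phi \<xi> (i, M + 1 - layers) = - simple_root (star i)"
    "last_height M \<xi> i = M - layers \<Longrightarrow> phi \<xi> (i, M + 2 - layers) = simple_root (star i)"
proof -
  note last = last_height_facts [OF assms]
  obtain w where w: "adapted A \<xi> w" "final_height \<xi> w = last_height M \<xi>" "w0 = act w"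
    using bipartite_longest_word [OF assms] by metis
  have phi: "phi \<xi> x = w0 (phi (last_height M \<xi>) x)" for x
    using phi_word [OF bipartite_height [OF assms] w(1)] w(2,3) by simp
  show "phi \<xi> (i, M + 1 - layers) = - simple_root (star i)" if "last_height M \<xi> i = M + 1 - layers"
    using bipartite_phi_source [OF last(1), of i] that phi [of "(i, M + 1 - layers)"]
    by (simp add: w0_simple_root algebra_simps)
  show "phi \<xi> (i, M + 2 - layers) = simple_root (star i)" if "last_height M \<xi> i = M - layers"
    using bipartite_phi_sink [OF last(1), of i] that phi [of "(i, M + 2 - layers)"]
    by (simp add: w0_simple_root algebra_simps)
qed

text \<open>At the lower boundary the roots are, up to sign, simple roots at \<open>star i\<close>,
  so \<open>psum\<close> relates \<open>pvec (star i)\<close> to \<open>pvec i\<close> by a factor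
  sin (t - \<delta>) / s or sin (t + \<delta>) / s. Applying the involution twice shows that two
  such factors have product 1, which forces \<delta> = 0.\<close>

lemma angle_layers:
  assumes "bipartite M \<xi>"
  shows "angle * of_int layers = pi"
proof -
  \<comment> \<open>The rounding error in \<open>layers\<close>, at most half of
    \<open>angle\<close> in absolute value.\<close>
  define \<delta> where "\<delta> = pi - angle * of_int layers"
  define t where "t = angle / 2"
  define s where "s = sin t"
  have t: "0 < t" "t \<le> pi / 4" "0 < s" using perron(2,3) sin_half_angle by (auto simp: t_def s_def)
  have \<delta>: "- t \<le> \<delta>" "\<delta> < t" using layers_bounds(2,3) by (simp_all add: \<delta>_def t_def algebra_simps)
  have sn: "sin (angle * (of_int layers + 1 / 2)) = - sin (t - \<delta>)"
  proof -
    have "angle * (of_int layers + 1 / 2) = (t - \<delta>) + pi" by (simp add: \<delta>_def t_def algebra_simps)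
    then show ?thesis by (simp only: sin_periodic_pi)
  qed
  have sl: "sin (angle * (of_int layers - 1 / 2)) = sin (t + \<delta>)"
  proof -
    have "angle * (of_int layers - 1 / 2) = pi - (t + \<delta>)" by (simp add: \<delta>_def t_def algebra_simps)
    then show ?thesis by (simp only: sin_pi_minus)
  qed
  note last = last_height_facts [OF assms]
  have type1: "s * pvec (star i) = pvec i * sin (t - \<delta>)" if "last_height M \<xi> i = M + 1 - layers" for i
    using psum_phi [OF assms, of "M + 1 - layers" i] last_height_phi(1) [OF assms that] last(2) [of i] that
    by (simp add: layer_sine_next sn s_def t_def)
  have type2: "s * pvec (star i) = pvec i * sin (t + \<delta>)" if "last_height M \<xi> i = M - layers" for i
    using psum_phi [OF assms, of "M + 2 - layers" i] last_height_phi(2) [OF assms that] last(2) [of i] that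
    by (simp add: layer_sine_last sl s_def t_def)
  fix i :: 'n
  define a where "a k = (if last_height M \<xi> k = M + 1 - layers then sin (t - \<delta>) else sin (t + \<delta>))" for k
  have "last_height M \<xi> k = M + 1 - layers \<or> last_height M \<xi> k = M - layers" for k
    by (simp add: last_height_def)
  then have a: "s * pvec (star k) = pvec k * a k" for k
    using type1 [of k] type2 [of k] by (auto simp: a_def)
  have "s * s * pvec i = s * (s * pvec (star (star i)))" by simp
  also have "\<dots> = s * pvec (star i) * a (star i)" by (simp only: a [of "star i"] mult.assoc)
  also have "\<dots> = pvec i * a i * a (star i)" by (simp only: a)
  also have "\<dots> = a i * a (star i) * pvec i" by (simp only: mult_ac)
  finally have prod: "s * s = a i * a (star i)"
    using perron(1) [of i] by (metis less_irrefl mult_right_cancel)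
  \<comment> \<open>Both t - \<delta> and t + \<delta> lie in [0, 2 t], inside [0, pi / 2], where
    the sine is injective and nonnegative.\<close>
  have inj: "x = t" if "0 \<le> x" "x \<le> 2 * t" "sin x * sin x = s * s" for x
  proof -
    have "x \<le> pi / 2" using that(2) t(2) by linarith
    then have "0 \<le> sin x" using that(1) by (intro sin_ge_zero) auto
    then have "sin x = s" using that(3) t(3) by (metis abs_of_nonneg less_imp_le power2_eq_square real_sqrt_abs)
    moreover have "- (pi / 2) \<le> x" "- (pi / 2) \<le> t" "t \<le> pi / 2" using that(1) t pi_gt_zero by linarith+
    ultimately show ?thesis using \<open>x \<le> pi / 2\<close> sin_inj_pi [of x t] by (simp add: s_def)
  qed
  have "\<delta> = 0"
  proof -
    consider "s * s = sin (t - \<delta>) * sin (t - \<delta>)" | "s * s = sin (t + \<delta>) * sin (t + \<delta>)"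
      | "s * s = sin (t - \<delta>) * sin (t + \<delta>)"
      using prod by (auto simp: a_def mult.commute split: if_splits)
    then show ?thesis
    proof cases
      case 1
      then show ?thesis using inj [of "t - \<delta>"] \<delta> by simp
    next
      case 2
      then show ?thesis using inj [of "t + \<delta>"] \<delta> by simp
    next
      case 3
      have "sin (t - \<delta>) * sin (t + \<delta>) = (sin t * cos \<delta>)\<^sup>2 - (cos t * sin \<delta>)\<^sup>2"
        by (simp add: sin_add sin_diff power2_eq_square algebra_simps)
      also have "\<dots> = (sin t)\<^sup>2 - (sin \<delta>)\<^sup>2"
        by (simp add: power_mult_distrib cos_squared_eq algebra_simps)
      finally have "sin \<delta> = 0" using 3 by (simp add: s_def power2_eq_square)
      moreover have "- pi < \<delta>" "\<delta> < pi" using \<delta> t pi_gt_zero by linarith+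
      ultimately show ?thesis using sin_eq_0_pi by blast
    qed
  qed
  then show ?thesis by (simp add: \<delta>_def)
qed

text \<open>Both sides take only the values M - layers and M + 1 - layers, so failure means the
  opposite value, and neighbours inherit it. Failure everywhere gives \<open>omega\<close> a
  reversal symmetry that makes the Coxeter element its own inverse. Then angle = pi / 2, the diagram
  has no edge, and parity gives the contradiction.\<close>

lemma last_height_star:
  assumes "bipartite M \<xi>"
  shows "last_height M \<xi> i = \<xi> (star i) - layers"
proof (rule ccontr)
  assume neq: "last_height M \<xi> i \<noteq> \<xi> (star i) - layers"
  note h = bipartite_height [OF assms]
  note last = last_height_facts [OF assms]
  have vals: "\<xi> k = M \<or> \<xi> k = M + 1" "last_height M \<xi> k = M - layers \<or> last_height M \<xi> k = M + 1 - layers"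
    for k using assms last(1) by (auto simp: bipartite_def)
  define bad where "bad k \<longleftrightarrow> last_height M \<xi> k = 2 * M + 1 - layers - \<xi> (star k)" for k
  have bad_i: "bad i" using neq vals [of i] vals(1) [of "star i"] by (auto simp: bad_def)
  have step: "bad j" if "bad k" "adjacent A k j" for k j
  proof -
    have "\<xi> (star j) = 2 * M + 1 - \<xi> (star k)"
      using bipartite_neighbour [OF assms, of "star k" "star j"] that(2) by simp
    moreover have "last_height M \<xi> j = 2 * (M - layers) + 1 - last_height M \<xi> k"
      using bipartite_neighbour [OF last(1) that(2)] .
    ultimately show ?thesis using that(1) by (simp add: bad_def)
  qed
  have "bad k" if "(adjacent A)\<^sup>*\<^sup>* i k" for k
    using that by (induction rule: rtranclp_induct) (use bad_i step in auto)
  then have bad: "last_height M \<xi> k = 2 * M + 1 - layers - \<xi> (star k)" for k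
    using connected by (auto simp: bad_def)
  define c where "c = 2 * M + 1 - layers"
  have reversal: "omega \<xi> (k, p) = - omega \<xi> (star k, c - p)" if "even (p - \<xi> k)" for k p
  proof -
    have "mesh_additive (\<lambda>(i, p). omega \<xi> (i, p + c))"
      by (rule mesh_additive_shift [OF omega_mesh_additive [OF h]])
    from mesh_additive_star [OF mesh_additive_reverse [OF this]]
    have add: "mesh_additive (\<lambda>(i, p). omega \<xi> (star i, c - p))" by simp
    have "omega \<xi> (k, p) = (\<lambda>x. - (\<lambda>(i, p). omega \<xi> (star i, c - p)) x) (k, p)"
    proof (rule mesh_additive_unique [OF omega_mesh_additive [OF h]
          mesh_additive_linear [OF linear_uminus add] h _ that])
      fix j
      have "c - \<xi> j = last_height M \<xi> (star j)" using bad [of "star j"] by (simp add: c_def)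
      then show "omega \<xi> (j, \<xi> j) = - (\<lambda>(i, p). omega \<xi> (star i, c - p)) (j, \<xi> j)"
        using last_height_omega [OF assms, of "star j"] by simp
    qed
    then show ?thesis by simp
  qed
  obtain g where g: "cox \<xi> = act g" using cox_act [OF h] by blast
  \<comment> \<open>The Coxeter element lowers p by 2, but read through the reversal it raises p by
    2; the two results differ by a shift of 4.\<close>
  have four: "omega \<xi> (i, q + 4) = omega \<xi> (i, q)" if "even (q - \<xi> i)" for q
  proof -
    have lh: "c - \<xi> i = last_height M \<xi> (star i)" using bad [of "star i"] by (simp add: c_def)
    have even_star: "even (c - q' - \<xi> (star i))" if "even (q' - \<xi> i)" for q'
      using last(2) [of "star i"] lh that by presburger
    have s: "omega \<xi> (star i, c - q') = - omega \<xi> (i, q')" if "even (q' - \<xi> i)" for q'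
      using reversal [OF even_star [OF that]] by simp
    have e2: "even (q + 2 - \<xi> i)" "even (q + 4 - \<xi> i)" using that by simp_all
    have "- omega \<xi> (i, q + 4) = omega \<xi> (star i, c - (q + 2) - 2)"
      using s [OF e2(2)] by (simp add: algebra_simps)
    also have "\<dots> = cox \<xi> (omega \<xi> (star i, c - (q + 2)))" by (rule omega_cox [OF h, symmetric])
    also have "\<dots> = - cox \<xi> (omega \<xi> (i, q + 2))" by (simp add: s [OF e2(1)] g)
    also have "\<dots> = - omega \<xi> (i, q)" using omega_cox [OF h, of i "q + 2"] by simp
    finally show ?thesis by simp
  qed
  have "phi \<xi> (i, q + 2 * 2) = phi \<xi> (i, q)" if "even (q - \<xi> i)" for q
    using four [OF that] four [of "q - 2"] that by (simp add: phi_def)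
  from phi_period_sin [OF assms this] have "sin (2 * angle) = 0" by (simp add: mult.commute)
  then have angle: "angle = pi / 2" using perron(2,3) sin_gt_zero [of "2 * angle"] by force
  \<comment> \<open>The Perron eigenvalue is 0, and a positive vector then leaves no room for a
    negative entry in column i.\<close>
  have no_edge: "\<not> adjacent A i j" for j
  proof
    assume adj: "adjacent A i j"
    have "(\<Sum>k\<in>UNIV - {i}. - (of_int (A $ k $ i) * pvec k)) = 0"
      using perron(4) [of i] by (simp add: angle sum_negf)
    then have "\<forall>k\<in>UNIV - {i}. - (of_int (A $ k $ i) * pvec k) = 0"
      using offdiag perron(1)
      by (subst (asm) sum_nonneg_eq_0_iff) (simp_all add: mult_nonpos_nonneg less_imp_le)
    moreover have "j \<noteq> i" using adj by (auto simp: adjacent_def)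
    ultimately have "A $ j $ i = 0" using perron(1) [of j] by auto
    then show False using adj zero_sym by (auto simp: adjacent_def)
  qed
  have "k = i" if "(adjacent A)\<^sup>*\<^sup>* i k" for k
    using that by (induction rule: rtranclp_induct) (use no_edge in auto)
  then have "star i = i" using connected by blast
  moreover have "layers = 2"
    using angle_layers [OF assms] angle by simp
  ultimately show False
    using bad [of i] last(2) [of i] by simp
qed

subsection \<open>The Coxeter number and periodicity\<close>

text \<open>Bundled so as to be carried along source reflections from a bipartite quiver to any
  other. The middle clause will be the periodicity by the Coxeter number.\<close>

definition periodic :: "('n \<Rightarrow> int) \<Rightarrow> bool" where
  "periodic \<xi> \<longleftrightarrow> (\<forall>i. even (\<xi> (star i) - \<xi> i - layers)) \<and>
     (\<forall>i p. omega \<xi> (i, p - layers) = - omega \<xi> (star i, p)) \<and> (\<forall>i. \<xi> (star i) - layers \<le> \<xi> i)"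

lemma periodicD:
  assumes "periodic \<xi>"
  shows "even (\<xi> (star i) - \<xi> i - layers)" "omega \<xi> (i, p - layers) = - omega \<xi> (star i, p)"
    "\<xi> (star i) - layers \<le> \<xi> i"
  using assms unfolding periodic_def by blast+

lemma periodic_strict:
  assumes "periodic \<xi>" "height \<xi>"
  shows "\<xi> (star i) - layers < \<xi> i"
proof (rule ccontr)
  assume "\<not> ?thesis"
  then have eq: "\<xi> (star i) - layers = \<xi> i" using periodicD(3) [OF assms(1), of i] by simp
  have "fweight i = - fweight (star i)"
    using periodicD(2) [OF assms(1), of i "\<xi> (star i)"] by (simp add: eq)
  then have "pairing i (fweight i) = pairing i (- fweight (star i))" by simp
  then show False by (auto split: if_splits)
qed

lemma bipartite_periodic:
  assumes "bipartite M \<xi>"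
  shows "periodic \<xi>"
proof -
  note h = bipartite_height [OF assms]
  have lh: "last_height M \<xi> i = \<xi> (star i) - layers" for i by (rule last_height_star [OF assms])
  have par: "even (\<xi> (star i) - \<xi> i - layers)" for i
    using last_height_facts(2) [OF assms, of i] unfolding lh by presburger
  have slice: "omega \<xi> (i, p - layers) = - omega \<xi> (star i, p)" for i p
  proof (cases "even (p - \<xi> (star i))")
    case True
    have "mesh_additive (\<lambda>(i, p). omega \<xi> (i, p + - layers))"
      by (rule mesh_additive_shift [OF omega_mesh_additive [OF h]])
    from mesh_additive_star [OF this]
    have add: "mesh_additive (\<lambda>(i, p). omega \<xi> (star i, p - layers))" by simp
    have "omega \<xi> (star i, p) = (\<lambda>x. - (\<lambda>(i, p). omega \<xi> (star i, p - layers)) x) (star i, p)"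
    proof (rule mesh_additive_unique [OF omega_mesh_additive [OF h]
          mesh_additive_linear [OF linear_uminus add] h _ True])
      fix j show "omega \<xi> (j, \<xi> j) = - (\<lambda>(i, p). omega \<xi> (star i, p - layers)) (j, \<xi> j)"
        using last_height_omega [OF assms, of "star j"] lh [of "star j"] by simp
    qed
    then show ?thesis by simp
  next
    case False
    then have "odd (p - layers - \<xi> i)" using par [of i] by presburger
    with False show ?thesis by (simp add: omega_def)
  qed
  have "\<xi> (star i) - layers \<le> \<xi> i" for i using last_height_facts(3) [OF assms, of i] lh [of i] by simp
  with par slice show ?thesis unfolding periodic_def by blast
qed

lemma periodic_reflect:
  assumes "height \<xi>" "periodic \<xi>" "source \<xi> i"
  shows "periodic (reflect_height i \<xi>)"
proof -
  have "reflect_height i \<xi> (star k) - layers \<le> reflect_height i \<xi> k" for k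
  \<comment> \<open>Only here does the right side drop alone; strictness together with parity leaves
    the margin 2.\<close>
  proof (cases "k = i \<and> star k \<noteq> i")
    case True
    have "even (\<xi> (star k) - \<xi> k - layers)" by (rule periodicD(1) [OF assms(2)])
    then have "\<xi> (star k) - layers \<le> \<xi> k - 2"
      using periodic_strict [OF assms(2,1), of k] by presburger
    then show ?thesis using True by (auto simp: reflect_height_def)
  next
    case False
    have "\<xi> (star k) - layers \<le> \<xi> k" by (rule periodicD(3) [OF assms(2)])
    then show ?thesis using False by (auto simp: reflect_height_def)
  qed
  moreover have "even (reflect_height i \<xi> (star k) - reflect_height i \<xi> k - layers)" for k
    using periodicD(1) [OF assms(2), of k] by (auto simp: reflect_height_def)
  moreover have "omega (reflect_height i \<xi>) (k, p - layers) = - omega (reflect_height i \<xi>) (star k, p)"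
    for k p unfolding omega_reflect [OF assms(1,3)] by (simp add: periodicD(2) [OF assms(2), of k p])
  ultimately show ?thesis unfolding periodic_def by blast
qed

lemma bipartite_above:
  assumes "height \<xi>"
  obtains M \<eta> where "bipartite M \<eta>" "\<And>i. \<xi> i \<le> \<eta> i" "\<And>i. even (\<eta> i - \<xi> i)"
proof -
  define M where "M = Max (range \<xi>)"
  define \<eta> where "\<eta> i = (if even (\<xi> i - M) then M else M + 1)" for i
  have "\<xi> i \<le> M" for i by (simp add: M_def)
  then have "\<xi> i \<le> \<eta> i" for i by (simp add: \<eta>_def add_increasing2)
  moreover have "even (\<eta> i - \<xi> i)" for i by (auto simp: \<eta>_def)
  moreover have "height \<eta>"
    unfolding height_function_def
  proof (intro allI impI)
    fix k j assume "adjacent A k j"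
    then have "\<xi> j = \<xi> k + 1 \<or> \<xi> j = \<xi> k - 1" by (rule heightD [OF assms])
    then show "\<bar>\<eta> k - \<eta> j\<bar> = 1" by (auto simp: \<eta>_def)
  qed
  then have "bipartite M \<eta>" by (auto simp: bipartite_def \<eta>_def)
  ultimately show thesis using that by blast
qed

lemma height_periodic:
  assumes "height \<xi>"
  shows "periodic \<xi>"
proof -
  obtain M \<eta> where \<eta>: "bipartite M \<eta>" "\<And>i. \<xi> i \<le> \<eta> i" "\<And>i. even (\<eta> i - \<xi> i)"
    using bipartite_above [OF assms] by metis
  show ?thesis
    by (rule height_descend [OF bipartite_height [OF \<eta>(1)] assms \<eta>(2,3), where P = periodic])
      (use bipartite_periodic [OF \<eta>(1)] periodic_reflect in auto)
qed

text \<open>If every vertex of S had two neighbours in S, the sum of the normalized simple roots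
  over S would have nonpositive square: each row gives 2 minus at least 1 for each
  neighbour.\<close>

lemma leaf_exists:
  assumes "S \<noteq> {}"
  shows "\<exists>i\<in>S. card {j \<in> S. adjacent A i j} \<le> 1"
proof (rule ccontr)
  assume "\<not> ?thesis"
  then have two: "2 \<le> card {j \<in> S. adjacent A i j}" if "i \<in> S" for i using that by force
  \<comment> \<open>Scales each simple root to squared length 2; an edge then contributes minus the
    square root of the product of its Cartan integers, at most -1.\<close>
  define t where "t i = 1 / sqrt (d i)" for i
  have t: "0 < t i" "d i * t i * t i = 1" for i
    using d_pos [of i] by (simp_all add: t_def field_simps)
  define v :: "real ^ 'n" where "v = (\<chi> i. if i \<in> S then t i else 0)"
  have edge: "d i * of_int (A $ i $ j) * t i * t j \<le> - 1" if "adjacent A i j" for i j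
  proof -
    have neg: "A $ i $ j \<le> -1" "A $ j $ i \<le> -1"
      using that offdiag [of i j] offdiag [of j i] zero_sym [of j i]
      unfolding adjacent_def by (simp, force)
    define x where "x = - (d i * of_int (A $ i $ j) * t i * t j)"
    have "x * x = d i * of_int (A $ i $ j) * (d i * of_int (A $ i $ j)) * (t i * t i) * (t j * t j)"
      by (simp add: x_def algebra_simps)
    also have "\<dots> = d i * of_int (A $ i $ j) * (d j * of_int (A $ j $ i)) * (t i * t i) * (t j * t j)"
      by (simp only: d_sym [of i j])
    also have "\<dots> = (d i * t i * t i) * (d j * t j * t j) * (of_int (A $ i $ j) * of_int (A $ j $ i))"
      by (simp only: mult_ac)
    also have "\<dots> = of_int (A $ i $ j * A $ j $ i)" by (simp add: t)
    finally have xx: "x * x = of_int (A $ i $ j * A $ j $ i)" .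
    have "1 * 1 \<le> (- A $ i $ j) * (- A $ j $ i)" using neg by (intro mult_mono) auto
    then have "1 \<le> A $ i $ j * A $ j $ i" by simp
    then have "1 \<le> x * x" unfolding xx by (simp only: of_int_1_le_iff)
    moreover have "0 \<le> x" unfolding x_def using neg(1) t(1) [of i] t(1) [of j] d_pos [of i]
      by (simp add: mult_nonneg_nonpos mult_nonpos_nonneg less_imp_le)
    ultimately have "1 \<le> x" by (metis abs_of_nonneg abs_one one_power2 power2_eq_square abs_le_square_iff)
    then show ?thesis by (simp add: x_def)
  qed
  have row: "(\<Sum>j\<in>UNIV. d i * of_int (A $ i $ j) * v $ i * v $ j) \<le> 0" for i
  proof (cases "i \<in> S")
    case True
    have "(\<Sum>j\<in>UNIV. d i * of_int (A $ i $ j) * v $ i * v $ j) =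
        2 + (\<Sum>j\<in>UNIV - {i}. d i * of_int (A $ i $ j) * v $ i * v $ j)"
      using True t(2) [of i] by (subst sum.remove [of _ i]) (simp_all add: v_def diag)
    also have "(\<Sum>j\<in>UNIV - {i}. d i * of_int (A $ i $ j) * v $ i * v $ j) \<le>
        (\<Sum>j\<in>UNIV - {i}. if j \<in> S \<and> adjacent A i j then -1 else 0)"
    proof (rule sum_mono)
      fix j assume "j \<in> UNIV - {i}"
      then have "i \<noteq> j" by auto
      show "d i * of_int (A $ i $ j) * v $ i * v $ j \<le> (if j \<in> S \<and> adjacent A i j then -1 else 0)"
        using True edge [of i j] \<open>i \<noteq> j\<close> by (auto simp: v_def adjacent_def)
    qed
    also have "\<dots> = - real (card {j \<in> S. adjacent A i j})"
    proof -
      have "(UNIV - {i}) \<inter> {j. j \<in> S \<and> adjacent A i j} = {j \<in> S. adjacent A i j}"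
        by (auto simp: adjacent_def)
      then show ?thesis by (simp add: sum.If_cases)
    qed
    finally show ?thesis using two [OF True] by simp
  qed (simp add: v_def)
  have "form v v \<le> 0" unfolding form_def by (rule sum_nonpos) (rule row)
  moreover have "v \<noteq> 0"
  proof -
    obtain i where "i \<in> S" using assms by blast
    then have "v $ i \<noteq> 0" using t(1) [of i] by (simp add: v_def)
    then show ?thesis by auto
  qed
  ultimately show False using form_pos by fastforce
qed

text \<open>Removing leaves one at a time shows that any orientation comes from a height function.\<close>

lemma orientation_height:
  fixes r :: "'n \<Rightarrow> nat"
  shows "\<exists>\<xi>. \<forall>i\<in>S. \<forall>j\<in>S. adjacent A i j \<longrightarrow> r i < r j \<longrightarrow> \<xi> i = \<xi> j + (1 :: int)"
proof (induction "card S" arbitrary: S)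
  case (Suc n)
  then obtain i where i: "i \<in> S" "card {j \<in> S. adjacent A i j} \<le> 1"
    using leaf_exists [of S] by fastforce
  then have "card (S - {i}) = n" using Suc.hyps(2) by simp
  with Suc.hyps(1) obtain \<xi> where \<xi>: "\<forall>k\<in>S - {i}. \<forall>j\<in>S - {i}. adjacent A k j \<longrightarrow> r k < r j \<longrightarrow> \<xi> k = \<xi> j + (1 :: int)"
    by blast
  have nadj: "\<not> adjacent A i i" by (simp add: adjacent_def)
  obtain x where x: "\<forall>k\<in>S. adjacent A i k \<longrightarrow> (r i < r k \<longrightarrow> x = \<xi> k + 1) \<and> (r k < r i \<longrightarrow> \<xi> k = x + 1)"
  proof (cases "{j \<in> S. adjacent A i j} = {}")
    case True
    then show thesis using that by blast
  next
    case False
    then obtain j where "{j \<in> S. adjacent A i j} = {j}"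
      using i(2) by (metis One_nat_def card_1_singletonE card_0_eq finite le_Suc_eq le_zero_eq)
    then have "k = j" if "k \<in> S" "adjacent A i k" for k using that by blast
    then show thesis using that [of "if r i < r j then \<xi> j + 1 else \<xi> j - 1"] by auto
  qed
  have "\<forall>k\<in>S. \<forall>j\<in>S. adjacent A k j \<longrightarrow> r k < r j \<longrightarrow> (\<xi>(i := x)) k = (\<xi>(i := x)) j + 1"
    using \<xi> x nadj adjacent_sym by auto
  then show ?case by blast
qed simp

text \<open>\<open>coxeter_number\<close> quantifies over all Coxeter elements, so each must come
  from a quiver: orient every edge by the order of its ends in c.\<close>

lemma coxeter_element_quiver:
  assumes "distinct c" "set c = UNIV"
  obtains \<xi> where "height \<xi>" "coxeter_word \<xi> c"
proof -
  have "\<forall>i. \<exists>n<length c. c ! n = i" using assms(2) by (metis UNIV_I in_set_conv_nth)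
  then obtain r where r: "\<And>i. r i < length c" "\<And>i. c ! r i = i" by metis
  obtain \<xi> where \<xi>: "\<And>i j. adjacent A i j \<Longrightarrow> r i < r j \<Longrightarrow> \<xi> i = \<xi> j + (1 :: int)"
    using orientation_height [of UNIV r] by auto
  have "r i \<noteq> r j" if "adjacent A i j" for i j
    using that r(2) by (metis adjacent_def)
  then have h: "height \<xi>"
    unfolding height_function_def using \<xi> adjacent_sym
    by (metis abs_minus_commute abs_one add_diff_cancel_left' linorder_neqE_nat)
  have "j \<in> set u" if c: "c = u @ i # v" and "adjacent A i j" "\<xi> i < \<xi> j" for u i v j
  proof -
    have "r i = length u"
      using assms(1) r [of i] c by (metis length_append length_Cons nth_append_length nth_eq_iff_index_eq less_add_Suc1 add_Suc_right)
    moreover have "\<not> r i < r j" using \<xi> [of i j] that by auto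
    moreover have "r i \<noteq> r j" using \<open>\<And>i j. adjacent A i j \<Longrightarrow> r i \<noteq> r j\<close> that by blast
    ultimately have "r j < length u" by auto
    then show ?thesis using r(2) [of j] c by (metis nth_append nth_mem)
  qed
  then have "coxeter_word \<xi> c"
    using adapted_distinct_iff [OF h assms(1)] assms by (simp add: coxeter_word_def)
  with h show thesis by (rule that)
qed

lemma omega_funpow: "height \<xi> \<Longrightarrow> (cox \<xi> ^^ n) (omega \<xi> (i, p)) = omega \<xi> (i, p - 2 * int n)"
  by (induction n) (simp_all add: omega_cox algebra_simps)

text \<open>Periodicity applied twice shifts p by twice \<open>layers\<close>, so the power
  \<open>layers\<close> of any Coxeter element is trivial. A period m of a bipartite Coxeter element
  gives sin (m angle) = 0, and angle * layers = pi makes m a multiple of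
  \<open>layers\<close>.\<close>

lemma coxeter_number_eq: "int (coxeter_number A) = layers"
proof -
  have period: "c ^^ nat layers = id" if "c \<in> coxeter_elements A" for c
  proof -
    from that obtain w where w: "c = act w" "distinct w" "set w = UNIV"
      by (auto simp: coxeter_elements_def)
    obtain \<xi> where \<xi>: "height \<xi>" "coxeter_word \<xi> w" using coxeter_element_quiver [OF w(2,3)] .
    have c: "cox \<xi> = c" using coxeter_of_quiver_eq [OF \<xi>] w(1) by simp
    have shift: "omega \<xi> (i, p - layers) = - omega \<xi> (star i, p)" for i p
      by (rule periodicD(2) [OF height_periodic [OF \<xi>(1)]])
    have "(c ^^ nat layers) (fweight i) = fweight i" for i
    proof -
      have "(c ^^ nat layers) (fweight i) = omega \<xi> (i, \<xi> i - layers - layers)"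
        using omega_funpow [OF \<xi>(1), of "nat layers" i "\<xi> i"] c layers_bounds(1) by (simp add: algebra_simps)
      also have "\<dots> = fweight i" by (simp only: shift star_star minus_minus omega_slice)
      finally show ?thesis .
    qed
    then have "act (concat (replicate (nat layers) w)) = act []"
      by (intro act_eqI_fweight) (simp add: w(1) flip: act_funpow)
    then show ?thesis by (simp add: w(1) act_funpow fun_eq_iff)
  qed
  have least: "nat layers \<le> m" if "0 < m" "\<forall>c\<in>coxeter_elements A. c ^^ m = id" for m
  proof -
    obtain c where c: "set c = (UNIV :: 'n set)" "distinct c" using finite_distinct_list [OF finite] by metis
    obtain \<zeta> where "height \<zeta>" using coxeter_element_quiver [OF c(2,1)] by metis
    then obtain M \<xi> where \<xi>: "bipartite M \<xi>" using bipartite_above by metis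
    note h = bipartite_height [OF \<xi>]
    obtain g where g: "coxeter_word \<xi> g" "cox \<xi> = act g" using cox_act [OF h] by blast
    then have "cox \<xi> \<in> coxeter_elements A" by (auto simp: coxeter_elements_def coxeter_word_def)
    with that(2) have m: "(cox \<xi> ^^ m) v = v" for v by simp
    have om: "omega \<xi> (i, p + 2 * int m) = omega \<xi> (i, p)" for i p
      using omega_funpow [OF h, of m i "p + 2 * int m"] m by simp
    fix i :: 'n
    have "phi \<xi> (i, q + 2 * int m) = phi \<xi> (i, q)" for q
      using om [of i q] om [of i "q - 2"] by (simp add: phi_def algebra_simps)
    then have "sin (angle * of_int (int m)) = 0" by (intro phi_period_sin [OF \<xi>]) auto
    then obtain n :: int where n: "angle * real m = of_int n * pi"
      using sin_zero_iff_int2 by auto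
    also have "\<dots> = of_int n * (angle * of_int layers)" by (simp only: angle_layers [OF \<xi>])
    finally have "angle * real m = angle * of_int (n * layers)" by simp
    then have "real_of_int (int m) = of_int (n * layers)" using perron(2) by simp
    then have eq: "int m = n * layers" by (simp only: of_int_eq_iff)
    then have "0 < n" using that(1) layers_bounds(1) by (metis mult_nonpos_nonneg not_less of_nat_0_less_iff
          order_trans zero_le_numeral)
    then have "1 * layers \<le> n * layers" using layers_bounds(1) by (intro mult_right_mono) auto
    then show ?thesis using eq by simp
  qed
  have "coxeter_number A = nat layers"
    unfolding coxeter_number_def
    using period least layers_bounds(1) by (intro Least_equality) auto
  then show ?thesis using layers_bounds(1) by simp
qed

subsection \<open>The Auslander--Reiten quiver\<close>

abbreviation AR :: "('n \<Rightarrow> int) \<Rightarrow> ('n \<times> int) set" where "AR \<equiv> AR_vertices A"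

lemma AR_iff: "(i, p) \<in> AR \<xi> \<longleftrightarrow> even (p - \<xi> i) \<and> \<xi> (star i) - layers < p \<and> p \<le> \<xi> i"
  by (simp add: AR_vertices_def coxeter_number_eq)

lemma AR_coordinate_eq: "height \<xi> \<Longrightarrow> x \<in> AR \<xi> \<Longrightarrow> AR_coordinate A \<xi> x = phi \<xi> x"
  by (cases x) (simp add: AR_iff phi_AR_coordinate)

text \<open>The lower boundary of the strip \<open>AR \<xi>\<close>, itself a height function;
  descending to it passes exactly the vertices of the strip.\<close>

definition opposite_height :: "('n \<Rightarrow> int) \<Rightarrow> 'n \<Rightarrow> int" where
  "opposite_height \<xi> i = \<xi> (star i) - layers"

lemma opposite_height_facts:
  assumes "height \<xi>"
  shows "height (opposite_height \<xi>)" "opposite_height \<xi> i < \<xi> i" "even (\<xi> i - opposite_height \<xi> i)"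
proof -
  show "height (opposite_height \<xi>)"
    unfolding height_function_def opposite_height_def
  proof (intro allI impI)
    fix i j assume "adjacent A i j"
    then have "adjacent A (star i) (star j)" by simp
    then show "\<bar>\<xi> (star i) - layers - (\<xi> (star j) - layers)\<bar> = 1"
      using assms by (simp add: height_function_def)
  qed
  show "opposite_height \<xi> i < \<xi> i"
    unfolding opposite_height_def by (rule periodic_strict [OF height_periodic [OF assms] assms])
  show "even (\<xi> i - opposite_height \<xi> i)"
    using periodicD(1) [OF height_periodic [OF assms], of i] unfolding opposite_height_def by presburger
qed

lemma set_track_opposite: "final_height \<xi> w = opposite_height \<xi> \<Longrightarrow> set (track \<xi> w) = AR \<xi>"
  by (auto simp: set_track AR_iff opposite_height_def)

lemma two_length: "2 * int (length w) = (\<Sum>i\<in>UNIV. \<xi> i - final_height \<xi> w i)"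
proof -
  have "length w = (\<Sum>i\<in>UNIV. count_list w i)" using sum_count_set [of w UNIV] by simp
  then show ?thesis by (simp add: final_height_def sum_distrib_left)
qed

text \<open>Each letter lowers one height by 2. As the involution permutes the vertices, the total
  drop is the same for all quivers, and the bipartite case identifies the length.\<close>

lemma opposite_word_length:
  assumes "height \<xi>" "final_height \<xi> w = opposite_height \<xi>"
  shows "length w = card (positive_roots A)"
proof -
  have total: "2 * int (length u) = (\<Sum>i\<in>(UNIV :: 'n set). layers)"
    if "final_height \<zeta> u = opposite_height \<zeta>" for \<zeta> u
  proof -
    have "2 * int (length u) = (\<Sum>i\<in>UNIV. \<zeta> i - (\<zeta> (star i) - layers))"
      unfolding two_length [of u \<zeta>] that opposite_height_def ..
    also have "\<dots> = (\<Sum>i\<in>UNIV. \<zeta> i) - (\<Sum>i\<in>UNIV. \<zeta> (star i)) + (\<Sum>i\<in>(UNIV :: 'n set). layers)"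
      by (simp add: sum_subtractf sum.distrib del: sum_constant)
    finally show ?thesis by (simp only: sum_star)
  qed
  obtain M \<eta> where \<eta>: "bipartite M \<eta>" using bipartite_above [OF assms(1)] by metis
  obtain u where u: "final_height \<eta> u = last_height M \<eta>" "length u = card (positive_roots A)"
    using bipartite_longest_word [OF \<eta>] by metis
  have "last_height M \<eta> = opposite_height \<eta>"
    using last_height_star [OF \<eta>] by (auto simp: opposite_height_def)
  then have "2 * int (length u) = 2 * int (length w)" using total u(1) assms(2) by metis
  then show ?thesis using u(2) by simp
qed

lemma opposite_word_longest:
  assumes "height \<xi>" "adapted A \<xi> w" "final_height \<xi> w = opposite_height \<xi>"
  shows "act w = w0"
proof -
  obtain u where u: "w0 = act u" using longest_word_exists by metis
  have "act w (fweight i) = act u (fweight i)" for i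
  proof -
    have "act w (fweight i) = omega \<xi> (i, opposite_height \<xi> i)"
      using omega_word [OF assms(1,2), of "(i, opposite_height \<xi> i)"] assms(3) by simp
    also have "\<dots> = - omega \<xi> (star i, \<xi> (star i))"
      unfolding opposite_height_def by (rule periodicD(2) [OF height_periodic [OF assms(1)]])
    also have "\<dots> = act u (fweight i)" by (simp add: w0_fweight flip: u)
    finally show ?thesis .
  qed
  then show ?thesis using u act_eqI_fweight by metis
qed

lemma opposite_word_in_class:
  assumes "height \<xi>" "adapted A \<xi> w" "final_height \<xi> w = opposite_height \<xi>"
  shows "w \<in> commutation_class A \<xi>"
proof -
  obtain u where u: "w0 = act u" "makes_negative u" using longest_word_exists by metis
  then have "weyl_length A w0 = card (positive_roots A)" using makes_negative_length by simp
  then show ?thesis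
    using opposite_word_length [OF assms(1,3)] opposite_word_longest [OF assms] assms(2)
    by (simp add: commutation_class_def reduced_expressions_def)
qed

lemma class_word_exists:
  assumes "height \<xi>"
  obtains w where "w \<in> commutation_class A \<xi>" "adapted A \<xi> w" "final_height \<xi> w = opposite_height \<xi>"
proof -
  note o = opposite_height_facts [OF assms]
  obtain w where "adapted A \<xi> w" "final_height \<xi> w = opposite_height \<xi>"
    using descend_word [OF assms o(1) less_imp_le [OF o(2)] o(3)] by metis
  then show thesis using that opposite_word_in_class [OF assms] by blast
qed

lemma class_word_positive:
  assumes "w \<in> commutation_class A \<xi>" "k < length w"
  shows "nonneg (wroot w k)"
  using assms by (intro reduced_word_positive) (auto simp: commutation_class_def reduced_expressions_def)

lemma phi_bij:
  assumes "height \<xi>"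
  shows "bij_betw (phi \<xi>) (AR \<xi>) (positive_roots A)"
proof -
  obtain w where w: "w \<in> commutation_class A \<xi>" "adapted A \<xi> w" "final_height \<xi> w = opposite_height \<xi>"
    using class_word_exists [OF assms] .
  have pos: "nonneg (wroot w k)" if "k < length w" for k using class_word_positive [OF w(1) that] .
  have inj: "inj_on (wroot w) {..<length w}" and inv: "inversions w = wroot w ` {..<length w}"
    using inversions_positive_word [OF pos] by auto
  have "inversions w = positive_roots A"
  proof (rule card_subset_eq [OF finite_positive_roots])
    show "inversions w \<subseteq> positive_roots A" by (auto simp: inversions_def)
    show "card (inversions w) = card (positive_roots A)"
      using positive_word_length(2) [OF pos] opposite_word_length [OF assms w(3)] by simp
  qed
  then have b1: "bij_betw (wroot w) {..<length w} (positive_roots A)"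
    using inj inv by (simp add: bij_betw_def)
  have b2: "bij_betw (\<lambda>k. track \<xi> w ! k) {..<length w} (AR \<xi>)"
    using bij_betw_nth [OF distinct_track [of \<xi> w], of "{..<length w}" "AR \<xi>"]
      set_track_opposite [OF w(3)] by simp
  have "bij_betw (phi \<xi> \<circ> (\<lambda>k. track \<xi> w ! k)) {..<length w} (positive_roots A)"
    using b1 by (rule bij_betw_cong [THEN iffD1, rotated]) (simp add: word_root_track [OF assms w(2)])
  then show ?thesis using bij_betw_comp_iff [OF b2] by blast
qed

lemma phi_AR_nonneg: "height \<xi> \<Longrightarrow> x \<in> AR \<xi> \<Longrightarrow> nonneg (phi \<xi> x)"
  using phi_bij bij_betwE by (fastforce simp: positive_roots_eq)

lemma finite_AR: "height \<xi> \<Longrightarrow> finite (AR \<xi>)"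
  using bij_betw_finite [OF phi_bij] finite_positive_roots by blast

lemma slice_in_AR: "height \<xi> \<Longrightarrow> (i, \<xi> i) \<in> AR \<xi>"
  using opposite_height_facts(2) [of \<xi> i] by (simp add: AR_iff opposite_height_def)

text \<open>A word of the class cannot pass the opposite height: by periodicity the root there is
  minus a positive root, whereas a reduced word lists positive roots only. Equal lengths then force
  equal final heights.\<close>

lemma class_word_iff:
  assumes "height \<xi>"
  shows "w \<in> commutation_class A \<xi> \<longleftrightarrow> adapted A \<xi> w \<and> final_height \<xi> w = opposite_height \<xi>"
proof
  assume w: "w \<in> commutation_class A \<xi>"
  then have ad: "adapted A \<xi> w" by (simp add: commutation_class_def)
  have le: "opposite_height \<xi> i \<le> final_height \<xi> w i" for i
  proof (rule ccontr)
    assume "\<not> ?thesis"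
    then have "(i, opposite_height \<xi> i) \<in> set (track \<xi> w)"
      using opposite_height_facts(2,3) [OF assms, of i] by (auto simp: set_track)
    then obtain k where k: "k < length w" "track \<xi> w ! k = (i, opposite_height \<xi> i)"
      by (metis in_set_conv_nth length_track)
    then have "nonneg (phi \<xi> (i, opposite_height \<xi> i))"
      using class_word_positive [OF w] word_root_track [OF assms ad] by metis
    moreover have "phi \<xi> (i, opposite_height \<xi> i) = - phi \<xi> (star i, \<xi> (star i))"
    proof -
      have "omega \<xi> (i, opposite_height \<xi> i - 2) = - omega \<xi> (star i, \<xi> (star i) - 2)"
        using periodicD(2) [OF height_periodic [OF assms], of i "\<xi> (star i) - 2"]
        by (simp add: opposite_height_def algebra_simps)
      moreover have "omega \<xi> (i, opposite_height \<xi> i) = - omega \<xi> (star i, \<xi> (star i))"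
        using periodicD(2) [OF height_periodic [OF assms], of i "\<xi> (star i)"]
        by (simp only: opposite_height_def)
      ultimately show ?thesis by (simp add: phi_def)
    qed
    ultimately have "phi \<xi> (star i, \<xi> (star i)) = 0"
      using nonneg_antisym phi_AR_nonneg [OF assms slice_in_AR [OF assms]] by metis
    then show False using roots_nonzero phi_roots [OF assms] by fastforce
  qed
  obtain u where u: "u \<in> commutation_class A \<xi>" "final_height \<xi> u = opposite_height \<xi>"
    using class_word_exists [OF assms] by metis
  have "length u = length w" using u(1) w by (simp add: commutation_class_def reduced_expressions_def)
  then have "(\<Sum>i\<in>UNIV. \<xi> i - opposite_height \<xi> i) = (\<Sum>i\<in>UNIV. \<xi> i - final_height \<xi> w i)"
    using two_length [of u \<xi>] two_length [of w \<xi>] u(2) by simp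
  then have "(\<Sum>i\<in>UNIV. final_height \<xi> w i - opposite_height \<xi> i) = 0"
    by (simp add: sum_subtractf)
  then have "\<forall>i\<in>UNIV. final_height \<xi> w i - opposite_height \<xi> i = 0"
    by (subst (asm) sum_nonneg_eq_0_iff) (use le in auto)
  then show "adapted A \<xi> w \<and> final_height \<xi> w = opposite_height \<xi>" using ad by auto
qed (use opposite_word_in_class assms in blast)


subsection \<open>Adapted words as linear extensions\<close>

text \<open>Arrows of the repetition quiver, pointing to later letters. The second kind orders a
  column also when its vertex has no neighbour.\<close>

definition step :: "'n \<times> int \<Rightarrow> 'n \<times> int \<Rightarrow> bool" where
  "step x y \<longleftrightarrow> snd y = snd x - 1 \<and> adjacent A (fst x) (fst y) \<or> snd y = snd x - 2 \<and> fst x = fst y"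

abbreviation reach :: "'n \<times> int \<Rightarrow> 'n \<times> int \<Rightarrow> bool" where "reach \<equiv> step\<^sup>*\<^sup>*"

definition below :: "('n \<Rightarrow> int) \<Rightarrow> ('n \<times> int) set" where
  "below \<xi> = {(i, p). even (p - \<xi> i) \<and> p \<le> \<xi> i}"

lemma below_step: "height \<xi> \<Longrightarrow> x \<in> below \<xi> \<Longrightarrow> step x y \<Longrightarrow> y \<in> below \<xi>"
proof -
  assume a: "height \<xi>" "x \<in> below \<xi>" "step x y"
  obtain i p j q where xy: "x = (i, p)" "y = (j, q)" by fastforce
  show "y \<in> below \<xi>"
    using a heightD [OF a(1), of i j] unfolding xy by (auto simp: below_def step_def)
qed

lemma below_reach: "reach x y \<Longrightarrow> height \<xi> \<Longrightarrow> x \<in> below \<xi> \<Longrightarrow> y \<in> below \<xi>"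
  by (induction rule: rtranclp_induct) (auto intro: below_step)

lemma AR_below: "AR \<xi> \<subseteq> below \<xi>"
  by (auto simp: AR_iff below_def)

text \<open>The lower boundary changes by 1 along an edge, so going back along an arrow cannot leave
  the strip through it.\<close>

lemma AR_step:
  assumes "height \<xi>" "y \<in> AR \<xi>" "x \<in> below \<xi>" "step x y"
  shows "x \<in> AR \<xi>"
proof -
  obtain i p j q where xy: "x = (i, p)" "y = (j, q)" by fastforce
  have "adjacent A i j \<Longrightarrow> \<xi> (star j) = \<xi> (star i) + 1 \<or> \<xi> (star j) = \<xi> (star i) - 1"
    by (rule heightD [OF assms(1)]) simp
  then show ?thesis using assms(2-4) unfolding xy by (auto simp: below_def step_def AR_iff)
qed

lemma AR_reach:
  assumes "reach x y" "height \<xi>" "y \<in> AR \<xi>" "x \<in> below \<xi>"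
  shows "x \<in> AR \<xi>"
  using assms
  by (induction rule: converse_rtranclp_induct) (auto intro: AR_step below_step)

lemma AR_convex: "height \<xi> \<Longrightarrow> x \<in> AR \<xi> \<Longrightarrow> y \<in> AR \<xi> \<Longrightarrow> reach x z \<Longrightarrow> reach z y \<Longrightarrow> z \<in> AR \<xi>"
  using AR_reach below_reach AR_below by (metis subsetD)

lemma reach_snd: "reach x y \<Longrightarrow> snd y \<le> snd x"
  by (induction rule: rtranclp_induct) (auto simp: step_def)

lemma reach_antisym: "reach x y \<Longrightarrow> reach y x \<Longrightarrow> x = y"
proof (induction rule: converse_rtranclp_induct)
  case (step x z)
  have "snd z < snd x" using step.hyps(1) by (auto simp: step_def)
  then have "snd y < snd x" using reach_snd [OF step.hyps(2)] by simp
  then show ?case using reach_snd [OF step.prems] by simp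
qed simp

lemma below_reflect: "z \<in> below (reflect_height i \<xi>) \<longleftrightarrow> z \<in> below \<xi> \<and> z \<noteq> (i, \<xi> i)"
proof (cases z)
  case (Pair k q)
  have "even (q - \<xi> i) \<Longrightarrow> q \<le> \<xi> i - 2 \<longleftrightarrow> q \<le> \<xi> i \<and> q \<noteq> \<xi> i" by presburger
  then show ?thesis using Pair by (cases "k = i") (auto simp: below_def reflect_height_def)
qed

lemma track_order:
  assumes "height \<xi>" "adapted A \<xi> w" "b < length w" "step z (track \<xi> w ! b)" "z \<in> below \<xi>"
  shows "\<exists>a<b. track \<xi> w ! a = z"
  using assms
proof (induction w arbitrary: \<xi> b)
  case (Cons i w)
  obtain k q where z: "z = (k, q)" by fastforce
  have src: "source \<xi> i" using Cons.prems(2) by simp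
  show ?case
  proof (cases b)
    case 0
    then show ?thesis using Cons.prems(4,5) src adjacent_sym
      by (auto simp: z step_def below_def is_source_def)
  next
    case (Suc b')
    show ?thesis
    proof (cases "z = (i, \<xi> i)")
      case True
      then show ?thesis using Suc by (intro exI [of _ 0]) simp
    next
      case False
      then have "z \<in> below (reflect_height i \<xi>)"
        using Cons.prems(5) by (simp add: below_reflect)
      then obtain a where "a < b'" "track (reflect_height i \<xi>) w ! a = z"
        using Cons.IH [OF height_reflect [OF Cons.prems(1) src], of b'] Cons.prems Suc by auto
      then show ?thesis using Suc by (intro exI [of _ "Suc a"]) simp
    qed
  qed
qed simp

text \<open>The first entry has no predecessor in \<open>below \<xi>\<close>, so it is the top of
  its column and its vertex is a source; reflecting there leaves a list of the same kind.\<close>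

lemma tracking_adapted:
  assumes "height \<xi>" "distinct L" "set L \<subseteq> below \<xi>"
    "\<And>b z. b < length L \<Longrightarrow> z \<in> below \<xi> \<Longrightarrow> step z (L ! b) \<Longrightarrow> \<exists>a<b. L ! a = z"
  shows "adapted A \<xi> (map fst L) \<and> track \<xi> (map fst L) = L"
  using assms
proof (induction L arbitrary: \<xi>)
  case (Cons x L)
  obtain i p where x: "x = (i, p)" by fastforce
  have p: "even (p - \<xi> i)" "p \<le> \<xi> i" using Cons.prems(3) by (auto simp: x below_def)
  have first: "\<not> step z x" if "z \<in> below \<xi>" for z
    using Cons.prems(4) [of 0 z] that by auto
  have "p = \<xi> i"
  proof (rule ccontr)
    assume "p \<noteq> \<xi> i"
    then have "(i, p + 2) \<in> below \<xi>" using p unfolding below_def by simp presburger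
    then show False using first by (force simp: step_def x)
  qed
  have src: "source \<xi> i"
    unfolding is_source_def
  proof (intro allI impI)
    fix j assume adj: "adjacent A i j"
    have "(j, p + 1) \<notin> below \<xi>" using first [of "(j, p + 1)"] adj adjacent_sym by (auto simp: step_def x)
    then show "\<xi> j < \<xi> i" using heightD [OF Cons.prems(1) adj] \<open>p = \<xi> i\<close> by (auto simp: below_def)
  qed
  have "adapted A (reflect_height i \<xi>) (map fst L) \<and> track (reflect_height i \<xi>) (map fst L) = L"
  proof (rule Cons.IH [OF height_reflect [OF Cons.prems(1) src]])
    show "distinct L" using Cons.prems(2) by simp
    show "set L \<subseteq> below (reflect_height i \<xi>)"
    proof
      fix z assume "z \<in> set L"
      then have "z \<in> below \<xi>" "z \<noteq> (i, \<xi> i)" using Cons.prems(2,3) x \<open>p = \<xi> i\<close> by auto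
      then show "z \<in> below (reflect_height i \<xi>)"
        by (simp add: below_reflect)
    qed
    fix b z assume b: "b < length L" "z \<in> below (reflect_height i \<xi>)" "step z (L ! b)"
    then have "z \<in> below \<xi>" "z \<noteq> x"
      by (simp_all add: below_reflect x \<open>p = \<xi> i\<close>)
    then obtain a where "a < Suc b" "(x # L) ! a = z"
      using Cons.prems(4) [of "Suc b" z] b by auto
    then show "\<exists>a<b. L ! a = z" using \<open>z \<noteq> x\<close> by (cases a) auto
  qed
  then show ?case using src x \<open>p = \<xi> i\<close> by simp
qed simp

lemma class_linear_extension:
  assumes "height \<xi>" "w \<in> commutation_class A \<xi>"
  shows "linear_extension reach (AR \<xi>) (track \<xi> w)"
proof -
  have w: "adapted A \<xi> w" "final_height \<xi> w = opposite_height \<xi>"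
    using class_word_iff [OF assms(1)] assms(2) by auto
  define L where "L = track \<xi> w"
  have L: "distinct L" "set L = AR \<xi>" "length L = length w"
    using distinct_track set_track_opposite [OF w(2)] by (auto simp: L_def)
  have before: "a \<le> b" if "reach x y" "x = L ! a" "a < length L" "y = L ! b" "b < length L" for a b x y
    using that
  proof (induction arbitrary: b rule: rtranclp_induct)
    case base
    then show ?case using L(1) nth_eq_iff_index_eq by fastforce
  next
    case (step y z)
    have "L ! a \<in> below \<xi>" using step.prems L(2) AR_below by (metis nth_mem subsetD)
    then have "y \<in> below \<xi>" using below_reach step.hyps(1) assms(1) step.prems(1) by blast
    then obtain c where c: "c < b" "L ! c = y"
      using track_order [OF assms(1) w(1), of b y] step.hyps(2) step.prems(3,4) L(3)
      by (auto simp: L_def)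
    then have "a \<le> c" using step.IH [of c] step.prems by auto
    then show ?case using c by simp
  qed
  have "sorted_wrt (\<lambda>x y. \<not> reach y x) L"
    unfolding sorted_wrt_iff_nth_less
  proof (intro allI impI notI)
    fix a b assume ab: "a < b" "b < length L" "reach (L ! b) (L ! a)"
    then have "b \<le> a" by (intro before [OF ab(3) refl ab(2) refl]) simp
    then show False using ab(1) by simp
  qed
  then show ?thesis using L by (simp add: linear_extension_def L_def)
qed

lemma linear_extension_class:
  assumes "height \<xi>" "linear_extension reach (AR \<xi>) L"
  shows "map fst L \<in> commutation_class A \<xi>" "track \<xi> (map fst L) = L"
proof -
  have L: "distinct L" "set L = AR \<xi>" "sorted_wrt (\<lambda>x y. \<not> reach y x) L"
    using assms(2) by (auto simp: linear_extension_def)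
  have t: "adapted A \<xi> (map fst L) \<and> track \<xi> (map fst L) = L"
  proof (rule tracking_adapted [OF assms(1) L(1)])
    show "set L \<subseteq> below \<xi>" using L(2) AR_below by simp
    fix b z assume b: "b < length L" "z \<in> below \<xi>" "step z (L ! b)"
    then have "z \<in> set L" using AR_step [OF assms(1) _ b(2,3)] L(2) by (metis nth_mem)
    then obtain a where a: "a < length L" "L ! a = z" by (metis in_set_conv_nth)
    have "a \<noteq> b" using a b(3) by (auto simp: step_def)
    moreover have "\<not> b < a"
      using L(3) a b unfolding sorted_wrt_iff_nth_less by blast
    ultimately show "\<exists>a<b. L ! a = z" using a(2) by (intro exI [of _ a]) simp
  qed
  then show tr: "track \<xi> (map fst L) = L" by blast
  have "final_height \<xi> (map fst L) i = opposite_height \<xi> i" for i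
  proof -
    define f where "f = final_height \<xi> (map fst L) i"
    have set: "even (p - \<xi> i) \<and> p \<le> \<xi> i \<and> f < p \<longleftrightarrow> even (p - \<xi> i) \<and> p \<le> \<xi> i \<and> opposite_height \<xi> i < p" for p
    proof -
      have "(i, p) \<in> set (track \<xi> (map fst L)) \<longleftrightarrow> (i, p) \<in> AR \<xi>" using tr L(2) by simp
      then show ?thesis by (auto simp: set_track AR_iff opposite_height_def f_def)
    qed
    have "f \<le> \<xi> i" "even (f - \<xi> i)" by (simp_all add: f_def final_height_def)
    moreover have "opposite_height \<xi> i \<le> \<xi> i" "even (opposite_height \<xi> i - \<xi> i)"
      using opposite_height_facts(2,3) [OF assms(1), of i] by (auto simp: less_imp_le)
    ultimately have "f = opposite_height \<xi> i"
      using set [of f] set [of "opposite_height \<xi> i"] by force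
    then show ?thesis by (simp add: f_def)
  qed
  then show "map fst L \<in> commutation_class A \<xi>" using class_word_iff [OF assms(1)] t by auto
qed

lemma linear_extension_exists: "height \<xi> \<Longrightarrow> \<exists>L. linear_extension reach (AR \<xi>) L"
  using class_word_exists class_linear_extension by metis

lemma all_class_words:
  assumes "height \<xi>"
  shows "(\<forall>w\<in>commutation_class A \<xi>. P w) \<longleftrightarrow> (\<forall>L. linear_extension reach (AR \<xi>) L \<longrightarrow> P (map fst L))"
  using class_linear_extension [OF assms] linear_extension_class(1) [OF assms] by (metis map_fst_track)

text \<open>Injectivity of \<open>phi\<close> on the strip turns comparison of roots into comparison
  of list positions.\<close>

lemma word_less_split:
  assumes "height \<xi>" "w \<in> commutation_class A \<xi>" "track \<xi> w = u @ x # v" "y \<in> AR \<xi>"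
  shows "word_less A w (phi \<xi> y) (phi \<xi> x) \<longleftrightarrow> y \<in> set u" "word_less A w (phi \<xi> x) (phi \<xi> y) \<longleftrightarrow> y \<in> set v"
proof -
  have w: "adapted A \<xi> w" "final_height \<xi> w = opposite_height \<xi>"
    using class_word_iff [OF assms(1)] assms(2) by auto
  define L where "L = track \<xi> w"
  have "distinct L" "length L = length w" by (simp_all add: L_def distinct_track)
  moreover have "set L = AR \<xi>" unfolding L_def by (rule set_track_opposite [OF w(2)])
  moreover have "L = u @ x # v" unfolding L_def by (rule assms(3))
  ultimately have L: "distinct L" "set L = AR \<xi>" "length L = length w" "L = u @ x # v" by blast+
  have x: "x \<in> AR \<xi>" using L(2,4) by auto
  have root: "wroot w k = phi \<xi> (L ! k)" if "k < length w" for k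
    using word_root_track [OF assms(1) w(1) that] by (simp add: L_def)
  have iff: "word_less A w (phi \<xi> y) (phi \<xi> z) \<longleftrightarrow> (\<exists>a b. a < b \<and> b < length L \<and> y = L ! a \<and> z = L ! b)"
    if "y \<in> AR \<xi>" "z \<in> AR \<xi>" for y z
  proof -
    have eq: "phi \<xi> y = wroot w k \<longleftrightarrow> y = L ! k" if "k < length w" "y \<in> AR \<xi>" for k y
    proof -
      have "L ! k \<in> AR \<xi>" using that(1) L(2,3) nth_mem by metis
      then show ?thesis
        unfolding root [OF that(1)]
        by (intro inj_on_eq_iff [OF bij_betw_imp_inj_on [OF phi_bij [OF assms(1)]] that(2)])
    qed
    show ?thesis
    proof
      assume "word_less A w (phi \<xi> y) (phi \<xi> z)"
      then obtain a b where ab: "a < b" "b < length w" "phi \<xi> y = wroot w a" "phi \<xi> z = wroot w b"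
        unfolding word_less_def by blast
      then have "y = L ! a" "z = L ! b" using eq [of a y] eq [of b z] that by auto
      then show "\<exists>a b. a < b \<and> b < length L \<and> y = L ! a \<and> z = L ! b" using ab L(3) by auto
    next
      assume "\<exists>a b. a < b \<and> b < length L \<and> y = L ! a \<and> z = L ! b"
      then obtain a b where ab: "a < b" "b < length w" "y = L ! a" "z = L ! b" using L(3) by auto
      then have "phi \<xi> y = wroot w a" "phi \<xi> z = wroot w b" using eq [of a y] eq [of b z] that by auto
      then show "word_less A w (phi \<xi> y) (phi \<xi> z)" using ab unfolding word_less_def by blast
    qed
  qed
  have idx: "b = length u" if "b < length L" "x = L ! b" for b
  proof -
    have "L ! length u = x" "length u < length L" using L(4) by auto
    then show ?thesis using that L(1) nth_eq_iff_index_eq by metis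
  qed
  show "word_less A w (phi \<xi> y) (phi \<xi> x) \<longleftrightarrow> y \<in> set u"
  proof
    assume "word_less A w (phi \<xi> y) (phi \<xi> x)"
    then obtain a b where "a < b" "b < length L" "y = L ! a" "x = L ! b"
      using iff [OF assms(4) x] by blast
    with idx have "a < length u" "y = L ! a" by auto
    then show "y \<in> set u" using L(4) by (simp add: nth_append)
  next
    assume "y \<in> set u"
    then obtain a where "a < length u" "u ! a = y" by (metis in_set_conv_nth)
    then show "word_less A w (phi \<xi> y) (phi \<xi> x)"
      unfolding iff [OF assms(4) x] using L(4)
      by (intro exI [of _ a] exI [of _ "length u"]) (auto simp: nth_append)
  qed
  show "word_less A w (phi \<xi> x) (phi \<xi> y) \<longleftrightarrow> y \<in> set v"
  proof
    assume "word_less A w (phi \<xi> x) (phi \<xi> y)"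
    then obtain a b where ab: "a < b" "b < length L" "x = L ! a" "y = L ! b"
      using iff [OF x assms(4)] by blast
    then have "length u < b" using idx [of a] by simp
    then have "L ! b = v ! (b - length u - 1)" unfolding L(4) by (simp add: nth_append)
    moreover have "b - length u - 1 < length v"
      using ab(2) \<open>length u < b\<close> unfolding L(4) by simp
    ultimately show "y \<in> set v" unfolding ab(4) by simp
  next
    assume "y \<in> set v"
    then obtain b where "b < length v" "v ! b = y" by (metis in_set_conv_nth)
    then show "word_less A w (phi \<xi> x) (phi \<xi> y)"
      unfolding iff [OF x assms(4)] using L(4)
      by (intro exI [of _ "length u"] exI [of _ "length u + Suc b"]) (auto simp: nth_append)
  qed
qed


subsection \<open>The degree on the repetition quiver\<close>

text \<open>
  Equality of weights is expressed through all mesh-additive functions, which makes the order and the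
  degree independent of the quiver.
\<close>

definition cless :: "('n \<times> int \<Rightarrow> nat) \<Rightarrow> ('n \<times> int \<Rightarrow> nat) \<Rightarrow> bool" where
  "cless m m' \<longleftrightarrow> finite {x. m x \<noteq> m' x} \<and> (\<exists>x. m x \<noteq> m' x) \<and>
     (\<forall>g :: 'n \<times> int \<Rightarrow> real. mesh_additive g \<longrightarrow> (\<Sum>x | m x \<noteq> m' x. (real (m x) - real (m' x)) * g x) = 0) \<and>
     (\<forall>x. m x \<noteq> m' x \<longrightarrow> (\<forall>y. m y \<noteq> m' y \<longrightarrow> reach y x \<longrightarrow> y = x) \<longrightarrow> m x < m' x) \<and>
     (\<forall>x. m x \<noteq> m' x \<longrightarrow> (\<forall>y. m y \<noteq> m' y \<longrightarrow> reach x y \<longrightarrow> y = x) \<longrightarrow> m x < m' x)"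

definition cdeg :: "('n \<times> int \<Rightarrow> nat) \<Rightarrow> nat" where
  "cdeg m = (GREATEST k. \<exists>c. c k = m \<and> (\<forall>l<k. cless (c l) (c (Suc l))))"

definition pull :: "('n \<Rightarrow> int) \<Rightarrow> (real ^ 'n \<Rightarrow> nat) \<Rightarrow> 'n \<times> int \<Rightarrow> nat" where
  "pull \<xi> e = (\<lambda>x. if x \<in> AR \<xi> then e (phi \<xi> x) else 0)"

lemma fixed_by_word:
  assumes "distinct w" "act w v = v" "i \<in> set w"
  shows "pairing i v = 0"
  using assms
proof (induction w)
  case (Cons k w)
  have "act w v = srefl k v" using Cons.prems(2) by (metis act_Cons srefl_srefl)
  moreover have "act w v $ k = v $ k" using Cons.prems(1) by (intro act_nth_unchanged) simp
  ultimately have k: "pairing k v = 0" by (simp add: srefl_nth)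
  then have "act w v = v" using \<open>act w v = srefl k v\<close> by (simp add: srefl_eq)
  then show ?case using Cons k by auto
qed simp

text \<open>A solution is a linear function of \<open>omega\<close>, determined by its values on the
  slice. As 1 minus the Coxeter element is injective, \<open>omega\<close> is recovered linearly
  from \<open>phi\<close>.\<close>

lemma additive_through_phi:
  fixes g :: "'n \<times> int \<Rightarrow> real"
  assumes "height \<xi>" "mesh_additive g"
  obtains F where "linear F" "\<And>i p. even (p - \<xi> i) \<Longrightarrow> g (i, p) = F (phi \<xi> (i, p))"
proof -
  obtain c where c: "coxeter_word \<xi> c" "cox \<xi> = act c" using cox_act [OF assms(1)] by blast
  define T where "T v = v - act c v" for v
  have T: "linear T" by (rule linearI) (simp_all add: T_def algebra_simps)
  have "inj T"
  proof (rule injI)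
    fix u v assume "T u = T v"
    then have "act c (u - v) = u - v" by (simp add: T_def algebra_simps)
    then have "pairing i (u - v) = 0" for i
      using fixed_by_word [of c "u - v" i] c(1) by (simp add: coxeter_word_def)
    then have "u - v = 0" by (rule pairing_eq_0)
    then show "u = v" by simp
  qed
  then obtain T' where T': "linear T'" "T' \<circ> T = id" using linear_injective_left_inverse [OF T] by blast
  define F0 where "F0 v = (\<Sum>i\<in>UNIV. g (i, \<xi> i) * pairing i v)" for v
  have F0: "linear F0" by (rule linearI) (simp_all add: F0_def algebra_simps sum.distrib sum_distrib_left)
  have "g (i, p) = (F0 \<circ> T') (phi \<xi> (i, p))" if "even (p - \<xi> i)" for i p
  proof -
    have "g (i, p) = F0 (omega \<xi> (i, p))"
    proof (rule mesh_additive_unique [OF assms(2) mesh_additive_linear [OF F0 omega_mesh_additive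
            [OF assms(1)]] assms(1) _ that])
      show "g (j, \<xi> j) = F0 (omega \<xi> (j, \<xi> j))" for j
        by (simp add: F0_def if_distrib [of "\<lambda>x. _ * x"] cong: if_cong)
    qed
    moreover have "phi \<xi> (i, p) = T (omega \<xi> (i, p))"
      using omega_cox [OF assms(1), of i p] c(2) by (simp add: phi_def T_def)
    ultimately show ?thesis using T'(2) by (simp add: fun_eq_iff)
  qed
  moreover have "linear (F0 \<circ> T')" using linear_compose [OF T'(1) F0] .
  ultimately show thesis using that by blast
qed

lemma weight_pull:
  assumes "height \<xi>"
  shows "weight A e = (\<Sum>x\<in>AR \<xi>. real (pull \<xi> e x) *\<^sub>R phi \<xi> x)"
proof -
  have "weight A e = (\<Sum>x\<in>AR \<xi>. real (e (phi \<xi> x)) *\<^sub>R phi \<xi> x)"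
    unfolding weight_def by (rule sum.reindex_bij_betw [OF phi_bij [OF assms], symmetric])
  then show ?thesis by (simp add: pull_def)
qed

text \<open>One direction factors g through \<open>phi\<close>; the other tests with the coordinates
  of \<open>phi\<close>, which are themselves mesh-additive.\<close>

lemma weight_eq_iff:
  assumes "height \<xi>"
  shows "weight A e = weight A e' \<longleftrightarrow> (\<forall>g :: 'n \<times> int \<Rightarrow> real. mesh_additive g \<longrightarrow>
    (\<Sum>x | pull \<xi> e x \<noteq> pull \<xi> e' x. (real (pull \<xi> e x) - real (pull \<xi> e' x)) * g x) = 0)"
proof -
  define c where "c x = real (pull \<xi> e x) - real (pull \<xi> e' x)" for x
  have sub: "{x. pull \<xi> e x \<noteq> pull \<xi> e' x} \<subseteq> AR \<xi>" by (auto simp: pull_def)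
  have sums: "(\<Sum>x | pull \<xi> e x \<noteq> pull \<xi> e' x. c x * g x) = (\<Sum>x\<in>AR \<xi>. c x * g x)" for g :: "'n \<times> int \<Rightarrow> real"
    by (rule sum.mono_neutral_left [OF finite_AR [OF assms] sub]) (auto simp: c_def)
  have "weight A e - weight A e' = (\<Sum>x\<in>AR \<xi>. c x *\<^sub>R phi \<xi> x)"
    by (simp add: weight_pull [OF assms] c_def algebra_simps sum_subtractf)
  then have "weight A e = weight A e' \<longleftrightarrow> (\<Sum>x\<in>AR \<xi>. c x *\<^sub>R phi \<xi> x) = 0" by (metis eq_iff_diff_eq_0)
  also have "\<dots> \<longleftrightarrow> (\<forall>g :: 'n \<times> int \<Rightarrow> real. mesh_additive g \<longrightarrow> (\<Sum>x\<in>AR \<xi>. c x * g x) = 0)"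
  proof (intro iffI allI impI)
    fix g :: "'n \<times> int \<Rightarrow> real" assume z: "(\<Sum>x\<in>AR \<xi>. c x *\<^sub>R phi \<xi> x) = 0" and g: "mesh_additive g"
    obtain F where F: "linear F" "\<And>i p. even (p - \<xi> i) \<Longrightarrow> g (i, p) = F (phi \<xi> (i, p))"
      using additive_through_phi [OF assms g] by metis
    have "(\<Sum>x\<in>AR \<xi>. c x * g x) = (\<Sum>x\<in>AR \<xi>. F (c x *\<^sub>R phi \<xi> x))"
      by (rule sum.cong) (auto simp: F(2) AR_iff linear_scale [OF F(1)])
    also have "\<dots> = F 0" by (simp add: z flip: linear_sum [OF F(1)])
    finally show "(\<Sum>x\<in>AR \<xi>. c x * g x) = 0" by (simp add: linear_0 [OF F(1)])
  next
    assume all: "\<forall>g :: 'n \<times> int \<Rightarrow> real. mesh_additive g \<longrightarrow> (\<Sum>x\<in>AR \<xi>. c x * g x) = 0"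
    have "(\<Sum>x\<in>AR \<xi>. c x *\<^sub>R phi \<xi> x) $ l = 0" for l
    proof -
      have "linear (\<lambda>v :: real ^ 'n. v $ l)" by (rule linearI) simp_all
      from mesh_additive_linear [OF this phi_mesh_additive [OF assms]]
      have "(\<Sum>x\<in>AR \<xi>. c x * phi \<xi> x $ l) = 0" using all by blast
      then show ?thesis by simp
    qed
    then show "(\<Sum>x\<in>AR \<xi>. c x *\<^sub>R phi \<xi> x) = 0" by (simp add: vec_eq_iff)
  qed
  finally show ?thesis by (simp add: sums flip: c_def)
qed

lemma word_bless_pull:
  assumes "height \<xi>" "linear_extension reach (AR \<xi>) L"
  shows "word_bless A (map fst L) e e' \<longleftrightarrow> weight A e = weight A e' \<and>
    (\<exists>u x v. L = u @ x # v \<and> pull \<xi> e x < pull \<xi> e' x \<and> (\<forall>y\<in>set u. pull \<xi> e y = pull \<xi> e' y)) \<and>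
    (\<exists>u x v. L = u @ x # v \<and> pull \<xi> e x < pull \<xi> e' x \<and> (\<forall>y\<in>set v. pull \<xi> e y = pull \<xi> e' y))"
proof -
  define w where "w = map fst L"
  have w: "w \<in> commutation_class A \<xi>" "track \<xi> w = L"
    using linear_extension_class [OF assms] by (auto simp: w_def)
  have set: "set L = AR \<xi>" using assms(2) by (simp add: linear_extension_def)
  have P: "positive_roots A = phi \<xi> ` AR \<xi>" using phi_bij [OF assms(1)] by (simp add: bij_betw_def)
  have split: "(\<exists>x\<in>AR \<xi>. Q x) \<longleftrightarrow> (\<exists>u x v. L = u @ x # v \<and> Q x)" for Q
    unfolding set [symmetric] by (metis in_set_conv_decomp)
  have "(\<exists>\<alpha>\<in>positive_roots A. e \<alpha> < e' \<alpha> \<and> (\<forall>\<beta>\<in>positive_roots A. word_less A w \<beta> \<alpha> \<longrightarrow> e \<beta> = e' \<beta>)) \<longleftrightarrow>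
      (\<exists>u x v. L = u @ x # v \<and> pull \<xi> e x < pull \<xi> e' x \<and> (\<forall>y\<in>set u. pull \<xi> e y = pull \<xi> e' y))"
  proof -
    have 1: "(\<forall>y\<in>AR \<xi>. word_less A w (phi \<xi> y) (phi \<xi> x) \<longrightarrow> e (phi \<xi> y) = e' (phi \<xi> y)) \<longleftrightarrow>
        (\<forall>y\<in>set u. pull \<xi> e y = pull \<xi> e' y)" if L: "L = u @ x # v" for u x v
    proof -
      have "y \<in> AR \<xi> \<Longrightarrow> word_less A w (phi \<xi> y) (phi \<xi> x) \<longleftrightarrow> y \<in> set u" for y
        using word_less_split(1) [OF assms(1) w(1)] w(2) L by simp
      moreover have "set u \<subseteq> AR \<xi>" using L set by auto
      ultimately show ?thesis by (auto simp: pull_def)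
    qed
    have 2: "e (phi \<xi> x) < e' (phi \<xi> x) \<longleftrightarrow> pull \<xi> e x < pull \<xi> e' x" if "L = u @ x # v" for u x v
    proof -
      have "x \<in> AR \<xi>" using that set by auto
      then show ?thesis by (simp add: pull_def)
    qed
    have "(L = u @ x # v \<and> e (phi \<xi> x) < e' (phi \<xi> x) \<and>
        (\<forall>y\<in>AR \<xi>. word_less A w (phi \<xi> y) (phi \<xi> x) \<longrightarrow> e (phi \<xi> y) = e' (phi \<xi> y))) \<longleftrightarrow>
        (L = u @ x # v \<and> pull \<xi> e x < pull \<xi> e' x \<and> (\<forall>y\<in>set u. pull \<xi> e y = pull \<xi> e' y))" for u x v
      using 1 [of u x v] 2 [of u x v] by blast
    then show ?thesis unfolding P bex_simps ball_simps split by (simp only:)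
  qed
  moreover have "(\<exists>\<alpha>\<in>positive_roots A. e \<alpha> < e' \<alpha> \<and> (\<forall>\<beta>\<in>positive_roots A. word_less A w \<alpha> \<beta> \<longrightarrow> e \<beta> = e' \<beta>)) \<longleftrightarrow>
      (\<exists>u x v. L = u @ x # v \<and> pull \<xi> e x < pull \<xi> e' x \<and> (\<forall>y\<in>set v. pull \<xi> e y = pull \<xi> e' y))"
  proof -
    have 1: "(\<forall>y\<in>AR \<xi>. word_less A w (phi \<xi> x) (phi \<xi> y) \<longrightarrow> e (phi \<xi> y) = e' (phi \<xi> y)) \<longleftrightarrow>
        (\<forall>y\<in>set v. pull \<xi> e y = pull \<xi> e' y)" if L: "L = u @ x # v" for u x v
    proof -
      have "y \<in> AR \<xi> \<Longrightarrow> word_less A w (phi \<xi> x) (phi \<xi> y) \<longleftrightarrow> y \<in> set v" for y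
        using word_less_split(2) [OF assms(1) w(1)] w(2) L by simp
      moreover have "set v \<subseteq> AR \<xi>" using L set by auto
      ultimately show ?thesis by (auto simp: pull_def)
    qed
    have 2: "e (phi \<xi> x) < e' (phi \<xi> x) \<longleftrightarrow> pull \<xi> e x < pull \<xi> e' x" if "L = u @ x # v" for u x v
    proof -
      have "x \<in> AR \<xi>" using that set by auto
      then show ?thesis by (simp add: pull_def)
    qed
    have "(L = u @ x # v \<and> e (phi \<xi> x) < e' (phi \<xi> x) \<and>
        (\<forall>y\<in>AR \<xi>. word_less A w (phi \<xi> x) (phi \<xi> y) \<longrightarrow> e (phi \<xi> y) = e' (phi \<xi> y))) \<longleftrightarrow>
        (L = u @ x # v \<and> pull \<xi> e x < pull \<xi> e' x \<and> (\<forall>y\<in>set v. pull \<xi> e y = pull \<xi> e' y))" for u x v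
      using 1 [of u x v] 2 [of u x v] by blast
    then show ?thesis unfolding P bex_simps ball_simps split by (simp only:)
  qed
  ultimately show ?thesis unfolding word_bless_def w_def [symmetric] by blast
qed

text \<open>The condition at the left end of the words is \<open>first_difference_iff\<close>; the
  one at the right end is the same lemma for the reversed order, whose extensions are the reversed
  lists.\<close>

lemma quiver_bless_iff:
  assumes "height \<xi>"
  shows "quiver_bless A \<xi> e e' \<longleftrightarrow> cless (pull \<xi> e) (pull \<xi> e')"
proof -
  define m m' where "m = pull \<xi> e" and "m' = pull \<xi> e'"
  have supp: "m x \<noteq> m' x \<Longrightarrow> x \<in> AR \<xi>" for x by (auto simp: m_def m'_def pull_def split: if_splits)
  then have "{x. m x \<noteq> m' x} \<subseteq> AR \<xi>" by blast
  then have fin: "finite {x. m x \<noteq> m' x}" by (rule finite_subset [OF _ finite_AR [OF assms]])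
  obtain L0 where L0: "linear_extension reach (AR \<xi>) L0" using linear_extension_exists [OF assms] by blast
  have revrev: "linear_extension (\<lambda>x y. reach y x) (AR \<xi>) L \<Longrightarrow> linear_extension reach (AR \<xi>) (rev L)" for L
    using linear_extension_rev [of "\<lambda>x y. reach y x" "AR \<xi>" L] by simp
  have first: "(\<forall>L. linear_extension reach (AR \<xi>) L \<longrightarrow>
      (\<exists>u x v. L = u @ x # v \<and> m x < m' x \<and> (\<forall>y\<in>set u. m y = m' y))) \<longleftrightarrow>
      (\<exists>x. m x \<noteq> m' x) \<and> (\<forall>x. m x \<noteq> m' x \<longrightarrow> (\<forall>y. m y \<noteq> m' y \<longrightarrow> reach y x \<longrightarrow> y = x) \<longrightarrow> m x < m' x)"
  proof -
    have "reflp reach" "transp reach" by (auto simp: reflp_def transp_def)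
    from first_difference_iff [OF this linear_extension_exists [OF assms], of m m']
    show ?thesis using supp by blast
  qed
  have second: "(\<forall>L. linear_extension reach (AR \<xi>) L \<longrightarrow>
      (\<exists>u x v. L = u @ x # v \<and> m x < m' x \<and> (\<forall>y\<in>set v. m y = m' y))) \<longleftrightarrow>
      (\<exists>x. m x \<noteq> m' x) \<and> (\<forall>x. m x \<noteq> m' x \<longrightarrow> (\<forall>y. m y \<noteq> m' y \<longrightarrow> reach x y \<longrightarrow> y = x) \<longrightarrow> m x < m' x)"
  proof -
    have "(\<forall>L. linear_extension (\<lambda>x y. reach y x) (AR \<xi>) L \<longrightarrow>
        (\<exists>u x v. L = u @ x # v \<and> m x < m' x \<and> (\<forall>y\<in>set u. m y = m' y))) \<longleftrightarrow>
        (\<exists>x. m x \<noteq> m' x) \<and> (\<forall>x. m x \<noteq> m' x \<longrightarrow> (\<forall>y. m y \<noteq> m' y \<longrightarrow> reach x y \<longrightarrow> y = x) \<longrightarrow> m x < m' x)"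
    proof -
      have "reflp (\<lambda>x y. reach y x)" "transp (\<lambda>x y. reach y x)" by (auto simp: reflp_def transp_def)
      from first_difference_iff [OF this, of "AR \<xi>" m m'] linear_extension_rev [OF L0]
      show ?thesis using supp by blast
    qed
    moreover have swap: "(\<exists>u x v. rev L = u @ x # v \<and> m x < m' x \<and> (\<forall>y\<in>set u. m y = m' y)) \<longleftrightarrow>
        (\<exists>u x v. L = u @ x # v \<and> m x < m' x \<and> (\<forall>y\<in>set v. m y = m' y))" for L
    proof -
      have "rev L = u @ x # v \<longleftrightarrow> L = rev v @ x # rev u" for u x v
        by (simp add: rev_swap)
      then have "(\<exists>u x v. rev L = u @ x # v \<and> m x < m' x \<and> (\<forall>y\<in>set u. m y = m' y)) \<longleftrightarrow>
          (\<exists>u x v. L = rev v @ x # rev u \<and> m x < m' x \<and> (\<forall>y\<in>set (rev u). m y = m' y))" by simp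
      also have "\<dots> \<longleftrightarrow> (\<exists>v x u. L = v @ x # u \<and> m x < m' x \<and> (\<forall>y\<in>set u. m y = m' y))"
        by (metis rev_rev_ident)
      finally show ?thesis .
    qed
    moreover have "(\<forall>L. linear_extension (\<lambda>x y. reach y x) (AR \<xi>) L \<longrightarrow> Q L) \<longleftrightarrow>
        (\<forall>L. linear_extension reach (AR \<xi>) L \<longrightarrow> Q (rev L))" for Q
    proof (intro iffI allI impI)
      fix L assume "\<forall>L. linear_extension (\<lambda>x y. reach y x) (AR \<xi>) L \<longrightarrow> Q L" "linear_extension reach (AR \<xi>) L"
      then show "Q (rev L)" using linear_extension_rev by blast
    next
      fix L assume *: "\<forall>L. linear_extension reach (AR \<xi>) L \<longrightarrow> Q (rev L)"
        "linear_extension (\<lambda>x y. reach y x) (AR \<xi>) L"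
      then have "Q (rev (rev L))" using revrev [OF *(2)] by blast
      then show "Q L" by simp
    qed
    ultimately show ?thesis by (simp only:)
  qed
  have "quiver_bless A \<xi> e e' \<longleftrightarrow> (\<forall>L. linear_extension reach (AR \<xi>) L \<longrightarrow> weight A e = weight A e' \<and>
      (\<exists>u x v. L = u @ x # v \<and> m x < m' x \<and> (\<forall>y\<in>set u. m y = m' y)) \<and>
      (\<exists>u x v. L = u @ x # v \<and> m x < m' x \<and> (\<forall>y\<in>set v. m y = m' y)))"
    unfolding quiver_bless_def all_class_words [OF assms] m_def m'_def
    by (simp only: word_bless_pull [OF assms] cong: imp_cong)
  also have "\<dots> \<longleftrightarrow> weight A e = weight A e' \<and>
      (\<forall>L. linear_extension reach (AR \<xi>) L \<longrightarrow>
        (\<exists>u x v. L = u @ x # v \<and> m x < m' x \<and> (\<forall>y\<in>set u. m y = m' y))) \<and>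
      (\<forall>L. linear_extension reach (AR \<xi>) L \<longrightarrow>
        (\<exists>u x v. L = u @ x # v \<and> m x < m' x \<and> (\<forall>y\<in>set v. m y = m' y)))"
    using L0 by blast
  also have "\<dots> \<longleftrightarrow> cless m m'"
    unfolding first second weight_eq_iff [OF assms, of e e', folded m_def m'_def] cless_def
    using fin by blast
  finally show ?thesis by (simp only: m_def m'_def)
qed

lemma reach_snd_eq: "reach x y \<Longrightarrow> snd x = snd y \<Longrightarrow> x = y"
proof (induction rule: converse_rtranclp_induct)
  case (step x z)
  have "snd z < snd x" using step.hyps(1) by (auto simp: step_def)
  then show ?case using reach_snd [OF step.hyps(2)] step.prems by simp
qed simp

text \<open>Among the finitely many differences that reach z, one with largest second coordinate is
  minimal, hence an increase.\<close>

lemma cless_lower: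
  assumes "cless m m'" "m z \<noteq> m' z"
  obtains y where "m y < m' y" "reach y z"
proof -
  define D where "D = {y. m y \<noteq> m' y \<and> reach y z}"
  have "finite D" using assms(1) by (auto simp: D_def cless_def)
  moreover have "z \<in> D" using assms(2) by (simp add: D_def)
  ultimately have "Max (snd ` D) \<in> snd ` D" and ge: "\<And>y'. y' \<in> D \<Longrightarrow> snd y' \<le> Max (snd ` D)"
    by (auto intro: Max_in)
  then obtain y where "y \<in> D" "snd y = Max (snd ` D)" by auto
  with ge have y: "y \<in> D" "\<And>y'. y' \<in> D \<Longrightarrow> snd y' \<le> snd y" by auto
  have "y' = y" if "m y' \<noteq> m' y'" "reach y' y" for y'
  proof -
    have "reach y' z" using that(2) y(1) by (auto simp: D_def)
    then have "snd y' \<le> snd y" using y(2) that(1) by (simp add: D_def)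
    then show ?thesis using reach_snd [OF that(2)] reach_snd_eq [OF that(2)] by simp
  qed
  then have "m y < m' y" using assms(1) y(1) unfolding cless_def D_def by blast
  then show thesis using that y(1) by (simp add: D_def)
qed

lemma cless_upper:
  assumes "cless m m'" "m z \<noteq> m' z"
  obtains y where "m y < m' y" "reach z y"
proof -
  define D where "D = {y. m y \<noteq> m' y \<and> reach z y}"
  have "finite D" using assms(1) by (auto simp: D_def cless_def)
  moreover have "z \<in> D" using assms(2) by (simp add: D_def)
  ultimately have "Min (snd ` D) \<in> snd ` D" and le: "\<And>y'. y' \<in> D \<Longrightarrow> Min (snd ` D) \<le> snd y'"
    by (auto intro: Min_in)
  then obtain y where "y \<in> D" "snd y = Min (snd ` D)" by auto
  with le have y: "y \<in> D" "\<And>y'. y' \<in> D \<Longrightarrow> snd y \<le> snd y'" by auto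
  have "y' = y" if "m y' \<noteq> m' y'" "reach y y'" for y'
  proof -
    have "reach z y'" using that(2) y(1) by (auto simp: D_def)
    then have "snd y \<le> snd y'" using y(2) that(1) by (simp add: D_def)
    then show ?thesis using reach_snd [OF that(2)] reach_snd_eq [OF that(2)] by simp
  qed
  then have "m y < m' y" using assms(1) y(1) unfolding cless_def D_def by blast
  then show thesis using that y(1) by (simp add: D_def)
qed

definition supported :: "('n \<Rightarrow> int) \<Rightarrow> ('n \<times> int \<Rightarrow> nat) \<Rightarrow> bool" where
  "supported \<xi> m \<longleftrightarrow> (\<forall>x. m x \<noteq> 0 \<longrightarrow> x \<in> AR \<xi>)"

lemma supportedD: "supported \<xi> m \<Longrightarrow> m x \<noteq> 0 \<Longrightarrow> x \<in> AR \<xi>"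
  unfolding supported_def by blast

text \<open>A difference lies between two increases. There m' is positive, so they are in the strip,
  and the strip is convex. Chains for \<open>cdeg\<close> that end in the strip thus stay in
  it.\<close>

lemma cless_supported:
  assumes "height \<xi>" "cless m m'" "supported \<xi> m'"
  shows "supported \<xi> m"
  unfolding supported_def
proof (intro allI impI)
  fix z assume z: "m z \<noteq> 0"
  show "z \<in> AR \<xi>"
  proof (cases "m z = m' z")
    case True
    then show ?thesis using supportedD [OF assms(3), of z] z by simp
  next
    case False
    obtain a where a: "m a < m' a" "reach a z" using cless_lower [OF assms(2) False] .
    obtain b where b: "m b < m' b" "reach z b" using cless_upper [OF assms(2) False] .
    have "a \<in> AR \<xi>" "b \<in> AR \<xi>" using a(1) b(1) supportedD [OF assms(3), of a] supportedD [OF assms(3), of b] by simp_all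
    then show ?thesis using AR_convex [OF assms(1)] a(2) b(2) by blast
  qed
qed

definition push :: "('n \<Rightarrow> int) \<Rightarrow> ('n \<times> int \<Rightarrow> nat) \<Rightarrow> real ^ 'n \<Rightarrow> nat" where
  "push \<xi> m \<beta> = (if \<beta> \<in> positive_roots A then m (inv_into (AR \<xi>) (phi \<xi>) \<beta>) else 0)"

lemma push_exponents: "push \<xi> m \<in> exponents A"
  by (simp add: push_def exponents_def)

lemma pull_supported: "supported \<xi> (pull \<xi> e)"
  by (simp add: supported_def pull_def)

lemma pull_push:
  assumes "height \<xi>" "supported \<xi> m"
  shows "pull \<xi> (push \<xi> m) = m"
proof
  fix x
  show "pull \<xi> (push \<xi> m) x = m x"
  proof (cases "x \<in> AR \<xi>")
    case True
    then have "phi \<xi> x \<in> positive_roots A" "inv_into (AR \<xi>) (phi \<xi>) (phi \<xi> x) = x"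
      using phi_bij [OF assms(1)] by (auto simp: bij_betw_def)
    then show ?thesis using True by (simp add: pull_def push_def)
  next
    case False
    then show ?thesis using supportedD [OF assms(2), of x] by (auto simp: pull_def)
  qed
qed

lemma push_pull:
  assumes "height \<xi>" "e \<in> exponents A"
  shows "push \<xi> (pull \<xi> e) = e"
proof
  fix \<beta>
  show "push \<xi> (pull \<xi> e) \<beta> = e \<beta>"
  proof (cases "\<beta> \<in> positive_roots A")
    case True
    then have "\<beta> \<in> phi \<xi> ` AR \<xi>" using phi_bij [OF assms(1)] by (simp add: bij_betw_def)
    then have "inv_into (AR \<xi>) (phi \<xi>) \<beta> \<in> AR \<xi>" "phi \<xi> (inv_into (AR \<xi>) (phi \<xi>) \<beta>) = \<beta>"
      by (auto intro: inv_into_into f_inv_into_f)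
    then show ?thesis using True by (simp add: push_def pull_def)
  next
    case False
    then show ?thesis using assms(2) by (simp add: push_def exponents_def)
  qed
qed

text \<open>The predicates under the two \<open>GREATEST\<close> agree for every k:
  \<open>pull\<close> and \<open>push\<close> translate chains, since supports stay in the
  strip.\<close>

lemma exponent_deg_eq:
  assumes "height \<xi>" "e \<in> exponents A"
  shows "exponent_deg A \<xi> e = cdeg (pull \<xi> e)"
proof -
  have "(\<exists>c. (\<forall>l\<le>k. c l \<in> exponents A) \<and> c k = e \<and> (\<forall>l<k. quiver_bless A \<xi> (c l) (c (Suc l)))) \<longleftrightarrow>
      (\<exists>c. c k = pull \<xi> e \<and> (\<forall>l<k. cless (c l) (c (Suc l))))" (is "?L \<longleftrightarrow> ?R") for k :: nat
  proof
    assume ?L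
    then obtain c where c: "c k = e" "\<forall>l<k. quiver_bless A \<xi> (c l) (c (Suc l))" by blast
    then have "\<forall>l<k. cless (pull \<xi> (c l)) (pull \<xi> (c (Suc l)))"
      using quiver_bless_iff [OF assms(1)] by blast
    with c(1) show ?R by (intro exI [of _ "\<lambda>l. pull \<xi> (c l)"]) simp
  next
    assume ?R
    then obtain c where c: "c k = pull \<xi> e" "\<forall>l<k. cless (c l) (c (Suc l))" by blast
    have supp: "supported \<xi> (c l)" if "l \<le> k" for l
      using that
    proof (induction rule: inc_induct)
      case base
      then show ?case using c(1) pull_supported by simp
    next
      case (step l)
      then show ?case using cless_supported [OF assms(1)] c(2) by blast
    qed
    have "quiver_bless A \<xi> (push \<xi> (c l)) (push \<xi> (c (Suc l)))" if "l < k" for l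
      unfolding quiver_bless_iff [OF assms(1)]
      using pull_push [OF assms(1) supp [of l]] pull_push [OF assms(1) supp [of "Suc l"]] c(2) that by simp
    moreover have "push \<xi> (c k) = e" using c(1) push_pull [OF assms] by simp
    ultimately show ?L by (intro exI [of _ "\<lambda>l. push \<xi> (c l)"]) (simp add: push_exponents)
  qed
  then show ?thesis by (simp only: exponent_deg_def cdeg_def)
qed

definition cpair :: "'n \<times> int \<Rightarrow> 'n \<times> int \<Rightarrow> 'n \<times> int \<Rightarrow> nat" where
  "cpair x y = (\<lambda>z. if z = x \<or> z = y then 1 else 0)"

lemma cpair_commute: "cpair x y = cpair y x"
  by (auto simp: cpair_def)

lemma pull_pair:
  assumes "height \<xi>" "x \<in> AR \<xi>" "y \<in> AR \<xi>"
  shows "pull \<xi> (pair_exponent (phi \<xi> x) (phi \<xi> y)) = cpair x y"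
proof
  fix z
  have "z \<in> AR \<xi> \<Longrightarrow> phi \<xi> z = phi \<xi> x' \<longleftrightarrow> z = x'" if "x' \<in> AR \<xi>" for x'
    using phi_bij [OF assms(1)] that by (meson bij_betw_imp_inj_on inj_on_eq_iff)
  then show "pull \<xi> (pair_exponent (phi \<xi> x) (phi \<xi> y)) z = cpair x y z"
    using assms(2,3) by (auto simp: pull_def pair_exponent_def cpair_def)
qed

lemma pair_exponent_deg:
  assumes "height \<xi>" "x \<in> AR \<xi>" "y \<in> AR \<xi>"
  shows "exponent_deg A \<xi> (pair_exponent (phi \<xi> x) (phi \<xi> y)) = cdeg (cpair x y)"
proof -
  have "phi \<xi> x \<in> positive_roots A" "phi \<xi> y \<in> positive_roots A"
    using bij_betwE [OF phi_bij [OF assms(1)]] assms(2,3) by blast+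
  then have "pair_exponent (phi \<xi> x) (phi \<xi> y) \<in> exponents A"
    by (auto simp: exponents_def pair_exponent_def)
  then show ?thesis using exponent_deg_eq [OF assms(1)] pull_pair [OF assms] by simp
qed

lemma cdeg_zero:
  assumes "\<And>n. \<not> cless n m"
  shows "cdeg m = 0"
  unfolding cdeg_def
proof (rule Greatest_equality)
  show "\<exists>c. c 0 = m \<and> (\<forall>l<0. cless (c l) (c (Suc l)))" by (intro exI [of _ "\<lambda>_. m"]) simp
next
  fix k assume "\<exists>c. c k = m \<and> (\<forall>l<k. cless (c l) (c (Suc l)))"
  then obtain c where c: "c k = m" "\<forall>l<k. cless (c l) (c (Suc l))" by blast
  then show "k \<le> 0" using assms by (cases k) auto
qed


subsection \<open>Translation and reversal\<close>

definition symmetry :: "('n \<times> int \<Rightarrow> 'n \<times> int) \<Rightarrow> bool" where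
  "symmetry \<sigma> \<longleftrightarrow> bij \<sigma> \<and>
     (\<forall>g :: 'n \<times> int \<Rightarrow> real. mesh_additive g \<longrightarrow> mesh_additive (\<lambda>x. g (inv \<sigma> x))) \<and>
     ((\<forall>x y. reach (\<sigma> x) (\<sigma> y) \<longleftrightarrow> reach x y) \<or> (\<forall>x y. reach (\<sigma> x) (\<sigma> y) \<longleftrightarrow> reach y x))"

lemma cless_symmetry:
  assumes "symmetry \<sigma>" "cless m m'"
  shows "cless (m \<circ> \<sigma>) (m' \<circ> \<sigma>)"
proof -
  define D where "D = {x. m x \<noteq> m' x}"
  define D' where "D' = {x. (m \<circ> \<sigma>) x \<noteq> (m' \<circ> \<sigma>) x}"
  have bij: "bij \<sigma>" using assms(1) by (simp add: symmetry_def)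
  have D': "D' = \<sigma> -` D" by (auto simp: D_def D'_def)
  have "\<sigma> ` D' = D" unfolding D' using bij by (simp add: surj_image_vimage_eq bij_is_surj)
  then have bb: "bij_betw \<sigma> D' D"
    using bij by (meson bij_betw_def bij_is_inj inj_on_subset subset_UNIV)
  have fin: "finite D" and ne: "D \<noteq> {}"
    using assms(2) unfolding cless_def D_def by blast+
  have sums: "(\<Sum>x\<in>D. (real (m x) - real (m' x)) * g x) = 0" if "mesh_additive g" for g :: "'n \<times> int \<Rightarrow> real"
    using assms(2) that unfolding cless_def D_def by blast
  have lo: "m x < m' x" if "x \<in> D" "\<forall>y\<in>D. reach y x \<longrightarrow> y = x" for x
    using assms(2) that unfolding cless_def D_def by blast
  have up: "m x < m' x" if "x \<in> D" "\<forall>y\<in>D. reach x y \<longrightarrow> y = x" for x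
    using assms(2) that unfolding cless_def D_def by blast
  have "finite D'" using bij_betw_finite [OF bb] fin by blast
  moreover have "\<exists>x. (m \<circ> \<sigma>) x \<noteq> (m' \<circ> \<sigma>) x"
  proof -
    have "D' \<noteq> {}" using ne \<open>\<sigma> ` D' = D\<close> by blast
    then show ?thesis unfolding D'_def by blast
  qed
  moreover have "(\<Sum>x\<in>D'. (real ((m \<circ> \<sigma>) x) - real ((m' \<circ> \<sigma>) x)) * g x) = 0"
    if g: "mesh_additive g" for g :: "'n \<times> int \<Rightarrow> real"
  proof -
    have "(\<Sum>x\<in>D'. (real (m (\<sigma> x)) - real (m' (\<sigma> x))) * g (inv \<sigma> (\<sigma> x))) =
        (\<Sum>y\<in>D. (real (m y) - real (m' y)) * g (inv \<sigma> y))"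
      by (rule sum.reindex_bij_betw [OF bb])
    also have "\<dots> = 0" by (rule sums) (use assms(1) g in \<open>unfold symmetry_def, blast\<close>)
    finally show ?thesis using bij by (simp add: bij_is_inj)
  qed
  moreover have "(m \<circ> \<sigma>) x < (m' \<circ> \<sigma>) x" if x: "x \<in> D'" "(\<forall>y\<in>D'. reach y x \<longrightarrow> y = x) \<or> (\<forall>y\<in>D'. reach x y \<longrightarrow> y = x)" for x
  proof -
    have sx: "\<sigma> x \<in> D" using x(1) by (simp add: D')
    have all: "(\<forall>y\<in>D. Q y) \<longleftrightarrow> (\<forall>y\<in>D'. Q (\<sigma> y))" for Q using \<open>\<sigma> ` D' = D\<close> by blast
    have inj: "\<sigma> y = \<sigma> x \<longleftrightarrow> y = x" for y using bij by (simp add: bij_is_inj inj_eq)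
    consider "\<forall>y\<in>D. reach y (\<sigma> x) \<longrightarrow> y = \<sigma> x" | "\<forall>y\<in>D. reach (\<sigma> x) y \<longrightarrow> y = \<sigma> x"
      unfolding all inj using assms(1) x(2) unfolding symmetry_def by blast
    then show ?thesis using lo [OF sx] up [OF sx] by cases auto
  qed
  ultimately show ?thesis unfolding cless_def D'_def by blast
qed

lemma cdeg_symmetry:
  assumes "symmetry \<sigma>" "symmetry (inv \<sigma>)"
  shows "cdeg (m \<circ> \<sigma>) = cdeg m"
proof -
  have bij: "bij \<sigma>" using assms(1) by (simp add: symmetry_def)
  have inv1: "(f \<circ> \<sigma>) \<circ> inv \<sigma> = f" "(f \<circ> inv \<sigma>) \<circ> \<sigma> = f" for f :: "'n \<times> int \<Rightarrow> nat"
    using bij by (auto simp: fun_eq_iff bij_is_inj bij_is_surj surj_f_inv_f)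
  have "(\<exists>c. c k = m \<circ> \<sigma> \<and> (\<forall>l<k. cless (c l) (c (Suc l)))) \<longleftrightarrow>
      (\<exists>c. c k = m \<and> (\<forall>l<k. cless (c l) (c (Suc l))))" (is "?L \<longleftrightarrow> ?R") for k :: nat
  proof
    assume ?L
    then obtain c where c: "c k = m \<circ> \<sigma>" "\<forall>l<k. cless (c l) (c (Suc l))" by blast
    then show ?R
      using cless_symmetry [OF assms(2)] inv1 by (intro exI [of _ "\<lambda>l. c l \<circ> inv \<sigma>"]) auto
  next
    assume ?R
    then obtain c where c: "c k = m" "\<forall>l<k. cless (c l) (c (Suc l))" by blast
    then show ?L using cless_symmetry [OF assms(1)] by (intro exI [of _ "\<lambda>l. c l \<circ> \<sigma>"]) auto
  qed
  then show ?thesis by (simp only: cdeg_def)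
qed

definition translate :: "int \<Rightarrow> 'n \<times> int \<Rightarrow> 'n \<times> int" where
  "translate c = (\<lambda>(i, p). (i, p + c))"

definition reflect :: "'n \<times> int \<Rightarrow> 'n \<times> int" where
  "reflect = (\<lambda>(i, p). (i, - p))"

lemma reach_map:
  assumes "\<And>x y. step x y \<Longrightarrow> step (f x) (f y)" "reach x y"
  shows "reach (f x) (f y)"
  using assms(2) by (induction rule: rtranclp_induct) (auto intro: rtranclp.rtrancl_into_rtrancl assms(1))

lemma reach_map_reverse:
  assumes "\<And>x y. step x y \<Longrightarrow> step (f y) (f x)" "reach x y"
  shows "reach (f y) (f x)"
  using assms(2) by (induction rule: rtranclp_induct) (auto intro: converse_rtranclp_into_rtranclp assms(1))

lemma inv_translate: "inv (translate c) = translate (- c)"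
  by (rule inv_equality) (auto simp: translate_def)

lemma inv_reflect: "inv reflect = reflect"
  by (rule inv_equality) (auto simp: reflect_def)

lemma symmetry_translate: "symmetry (translate c)"
proof -
  have fwd: "reach x y \<Longrightarrow> reach (translate c x) (translate c y)" for c x y
    by (rule reach_map [where f = "translate c"]) (auto simp: translate_def step_def case_prod_unfold)
  have "reach (translate c x) (translate c y) \<longleftrightarrow> reach x y" for x y
    using fwd [of x y c] fwd [of "translate c x" "translate c y" "- c"]
    by (auto simp: translate_def case_prod_unfold)
  moreover have "bij (translate c)"
    by (rule o_bij [of "translate (- c)"]) (auto simp: translate_def)
  moreover have "mesh_additive g \<Longrightarrow> mesh_additive (\<lambda>x. g (translate (- c) x))" for g :: "'n \<times> int \<Rightarrow> real"
    using mesh_additive_shift [of g "- c"] by (simp add: translate_def case_prod_unfold)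
  ultimately show ?thesis unfolding symmetry_def inv_translate by blast
qed

lemma symmetry_reflect: "symmetry reflect"
proof -
  have fwd: "reach x y \<Longrightarrow> reach (reflect y) (reflect x)" for x y
  proof (rule reach_map_reverse [where f = reflect])
    fix x y :: "'n \<times> int" assume "step x y"
    then show "step (reflect y) (reflect x)"
      using adjacent_sym [of "fst x" "fst y"] by (auto simp: reflect_def step_def case_prod_unfold)
  qed
  have "reach (reflect x) (reflect y) \<longleftrightarrow> reach y x" for x y
    using fwd [of y x] fwd [of "reflect x" "reflect y"]
    by (auto simp: reflect_def case_prod_unfold)
  moreover have "bij reflect"
    by (rule o_bij [of reflect]) (auto simp: reflect_def)
  moreover have "mesh_additive g \<Longrightarrow> mesh_additive (\<lambda>x. g (reflect x))" for g :: "'n \<times> int \<Rightarrow> real"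
    using mesh_additive_reverse [of g] by (simp add: reflect_def case_prod_unfold)
  ultimately show ?thesis unfolding symmetry_def inv_reflect by blast
qed

lemma cdeg_translate: "cdeg (cpair (i, p + c) (j, s + c)) = cdeg (cpair (i, p) (j, s))"
proof -
  have "cpair (i, p) (j, s) = cpair (i, p + c) (j, s + c) \<circ> translate c"
    by (auto simp: cpair_def translate_def)
  then show ?thesis
    using cdeg_symmetry [of "translate c"] symmetry_translate by (simp add: inv_translate)
qed

lemma cdeg_reflect: "cdeg (cpair (i, - p) (j, - s)) = cdeg (cpair (i, p) (j, s))"
proof -
  have "cpair (i, p) (j, s) = cpair (i, - p) (j, - s) \<circ> reflect"
    by (auto simp: cpair_def reflect_def)
  then show ?thesis
    using cdeg_symmetry [of reflect] symmetry_reflect by (simp add: inv_reflect)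
qed

definition distance_deg :: "'n \<Rightarrow> 'n \<Rightarrow> nat \<Rightarrow> nat" where
  "distance_deg i j k = cdeg (cpair (i, int k) (j, 0))"

text \<open>Translation brings the lower position to 0; if it is the one in column i, a reflection
  first exchanges upper and lower.\<close>

lemma cdeg_distance:
  assumes "\<bar>p - s\<bar> = int k"
  shows "cdeg (cpair (i, p) (j, s)) = distance_deg i j k"
proof (cases "s \<le> p")
  case True
  then have "int k + s = p" using assms by simp
  then show ?thesis unfolding distance_deg_def using cdeg_translate [of i "int k" s j 0] by simp
next
  case False
  then have "int k + - s = - p" using assms by simp
  then show ?thesis
    unfolding distance_deg_def using cdeg_translate [of i "int k" "- s" j 0] cdeg_reflect [of i p j s] by simp
qed

subsection \<open>Pairs of degree zero\<close>

lemma reach_height: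
  "reach x y \<Longrightarrow> height \<eta> \<Longrightarrow> \<bar>\<eta> (fst x) - \<eta> (fst y)\<bar> \<le> snd x - snd y"
proof (induction rule: rtranclp_induct)
  case (step y z)
  have "adjacent A (fst y) (fst z) \<Longrightarrow> \<eta> (fst z) = \<eta> (fst y) + 1 \<or> \<eta> (fst z) = \<eta> (fst y) - 1"
    by (rule heightD [OF step.prems])
  then show ?case using step by (auto simp: step_def)
qed simp

lemma psum_phi_pos: "height \<xi> \<Longrightarrow> x \<in> AR \<xi> \<Longrightarrow> 0 < psum (phi \<xi> x)"
proof -
  assume "height \<xi>" "x \<in> AR \<xi>"
  then have "phi \<xi> x \<in> positive_roots A" using bij_betwE [OF phi_bij] by blast
  then show ?thesis using psum_pos roots_nonzero by (auto simp: positive_roots_eq)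
qed

text \<open>\<open>psum\<close> of \<open>phi\<close> is a mesh-additive test function that is
  positive on the strip, so equality of weights excludes increases alone.\<close>

lemma cless_not_only_less:
  assumes "height \<xi>" "cless n m" "\<And>z. n z \<noteq> m z \<Longrightarrow> n z < m z \<and> z \<in> AR \<xi>"
  shows False
proof -
  define D where "D = {z. n z \<noteq> m z}"
  have fin: "finite D" and ne: "D \<noteq> {}" using assms(2) unfolding cless_def D_def by blast+
  have "(\<Sum>z\<in>D. (real (n z) - real (m z)) * psum (phi \<xi> z)) = 0"
    using assms(2) mesh_additive_linear [OF linear_psum phi_mesh_additive [OF assms(1)]]
    unfolding cless_def D_def by blast
  moreover have "(\<Sum>z\<in>D. (real (n z) - real (m z)) * psum (phi \<xi> z)) < (\<Sum>z\<in>D. 0)"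
  proof (rule sum_strict_mono [OF fin ne])
    fix z assume "z \<in> D"
    then have "n z < m z" "z \<in> AR \<xi>" using assms(3) by (auto simp: D_def)
    then show "(real (n z) - real (m z)) * psum (phi \<xi> z) < 0"
      using psum_phi_pos [OF assms(1)] by (intro mult_neg_pos) auto
  qed
  ultimately show False by simp
qed

lemma cpair_less: "k < cpair x y z \<Longrightarrow> k = 0 \<and> (z = x \<or> z = y)"
  by (auto simp: cpair_def split: if_splits)

text \<open>A difference lies between two increases taken from x and y. Incomparability makes them
  equal, so every difference is an increase.\<close>

lemma not_cless_incomparable:
  assumes "height \<xi>" "x \<in> AR \<xi>" "y \<in> AR \<xi>" "\<not> reach x y" "\<not> reach y x"
  shows "\<not> cless n (cpair x y)"
proof
  assume c: "cless n (cpair x y)"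
  show False
  proof (rule cless_not_only_less [OF assms(1) c])
    fix z assume z: "n z \<noteq> cpair x y z"
    obtain a where a: "n a < cpair x y a" "reach a z" using cless_lower [OF c z] .
    obtain b where b: "n b < cpair x y b" "reach z b" using cless_upper [OF c z] .
    have "reach a b" using a(2) b(2) by (rule rtranclp_trans)
    then have "a = b" using cpair_less [OF a(1)] cpair_less [OF b(1)] assms(4,5) by blast
    then have "z = a" using reach_antisym a(2) b(2) by blast
    then show "n z < cpair x y z \<and> z \<in> AR \<xi>" using a(1) cpair_less [OF a(1)] assms(2,3) by blast
  qed
qed

section \<open>Pairs at distance at least the Coxeter number\<close>

lemma reduced_suffix:
  assumes "weyl_length A (act (u @ w)) = length (u @ w)"
  shows "weyl_length A (act w) = length w"
proof -
  obtain w' where w': "act w' = act w" "length w' = weyl_length A (act w)"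
    using reduced_word_exists by metis
  then have "act (u @ w') = act (u @ w)" by (simp add: fun_eq_iff)
  then have "weyl_length A (act (u @ w)) \<le> length (u @ w')" using weyl_length_le by metis
  then show ?thesis using assms w' weyl_length_le [of w] by simp
qed

lemma final_height_le: "final_height \<xi> u i \<le> \<xi> i"
  by (simp add: final_height_def)

text \<open>Read first everything that (i, p) does not reach, and stop just before (i, p). What
  follows that letter is a suffix of a reduced word, so its roots are positive.\<close>

lemma advance_to:
  assumes "height \<xi>" "(i, p) \<in> AR \<xi>"
  obtains \<zeta> where "height \<zeta>" "\<And>j. \<zeta> j \<le> \<xi> j" "\<zeta> i = p" "source \<zeta> i"
    "\<And>z. z \<in> AR \<xi> \<Longrightarrow> reach (i, p) z \<Longrightarrow> z \<noteq> (i, p) \<Longrightarrow> nonneg (phi (reflect_height i \<zeta>) z)"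
proof -
  define x where "x = (i, p)"
  obtain L0 where L0: "linear_extension reach (AR \<xi>) L0" using linear_extension_exists [OF assms(1)] by blast
  define P Q where "P = filter (\<lambda>z. \<not> reach x z) L0" and "Q = filter (\<lambda>z. reach x z) L0"
  have ext: "linear_extension reach (AR \<xi>) (P @ Q)"
    using L0 by (auto simp: linear_extension_def P_def Q_def sorted_wrt_append sorted_wrt_filter
        dest: rtranclp_trans)
  have Q: "set Q = {z \<in> AR \<xi>. reach x z}" using L0 by (auto simp: Q_def linear_extension_def)
  then have "x \<in> set Q" using assms(2) by (simp add: x_def)
  then obtain q Q' where Qq: "Q = q # Q'" by (cases Q) auto
  \<comment> \<open>x reaches every element of \<open>Q\<close>, so it must come first
    there.\<close>
  have "q = x"
  proof (rule ccontr)
    assume "q \<noteq> x"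
    then have "x \<in> set Q'" using \<open>x \<in> set Q\<close> Qq by simp
    then have "\<not> reach x q" using ext Qq by (auto simp: linear_extension_def sorted_wrt_append)
    moreover have "q \<in> set Q" using Qq by simp
    ultimately show False using Q by blast
  qed
  define w where "w = map fst (P @ Q)"
  define u v where "u = map fst P" and "v = map fst Q'"
  have w: "w = u @ i # v" by (simp add: w_def u_def v_def Qq \<open>q = x\<close> x_def)
  have "w \<in> commutation_class A \<xi>" and tr: "track \<xi> w = P @ Q"
    using linear_extension_class [OF assms(1) ext] by (simp_all add: w_def)
  then have ad: "adapted A \<xi> w" and red: "weyl_length A (act w) = length w"
    by (auto simp: commutation_class_def reduced_expressions_def)
  define \<zeta> where "\<zeta> = final_height \<xi> u"
  have ad': "adapted A \<xi> u" "source \<zeta> i" "adapted A (reflect_height i \<zeta>) v"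
    using ad unfolding w \<zeta>_def by simp_all
  have h: "height \<zeta>" unfolding \<zeta>_def by (rule height_final [OF assms(1) ad'(1)])
  have "track \<xi> u @ (i, \<zeta> i) # track (reflect_height i \<zeta>) v = P @ (i, p) # Q'"
    using tr unfolding w by (simp add: track_append Qq \<open>q = x\<close> x_def \<zeta>_def)
  moreover have "length (track \<xi> u) = length P" by (simp add: u_def)
  ultimately have "\<zeta> i = p" and trv: "track (reflect_height i \<zeta>) v = Q'"
    by (simp_all add: append_eq_append_conv)
  have "nonneg (phi (reflect_height i \<zeta>) z)" if z: "z \<in> AR \<xi>" "reach (i, p) z" "z \<noteq> (i, p)" for z
  proof -
    have "z \<in> set Q" using Q z(1,2) unfolding x_def by blast
    then have "z \<in> set Q'" using z(3) Qq \<open>q = x\<close> by (simp add: x_def)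
    then obtain k where k: "k < length v" "Q' ! k = z" by (metis in_set_conv_nth length_map v_def)
    have "weyl_length A (act v) = length v"
      using reduced_suffix [of "u @ [i]" v] red unfolding w by simp
    then have "nonneg (wroot v k)" using k(1) by (rule reduced_word_positive)
    then show ?thesis
      using word_root_track [OF height_reflect [OF h ad'(2)] ad'(3) k(1)] trv k(2) by simp
  qed
  moreover have "\<And>j. \<zeta> j \<le> \<xi> j" by (simp add: \<zeta>_def final_height_le)
  ultimately show thesis using that h ad'(2) \<open>\<zeta> i = p\<close> by blast
qed

text \<open>After i has been passed, the new Coxeter element maps
  \<open>fweight i - simple_root i\<close> to \<open>fweight i\<close>. Invariance of the form then
  makes \<open>phi\<close> on the slice of the other vertices orthogonal to
  \<open>fweight i\<close>. Mesh relations carry this zero upwards; column i does not interfere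
  because r is at most \<zeta> i.\<close>

lemma phi_coordinate_above:
  assumes "height \<zeta>" "source \<zeta> i" "(l, r) \<noteq> (i, \<zeta> i)" "\<zeta> l \<le> r" "r \<le> \<zeta> i"
  shows "phi (reflect_height i \<zeta>) (l, r) $ i = 0"
  using assms(3-5)
proof (induction "nat (r - Min (range \<zeta>))" arbitrary: l r rule: less_induct)
  case less
  define \<eta> where "\<eta> = reflect_height i \<zeta>"
  have h: "height \<eta>" unfolding \<eta>_def by (rule height_reflect [OF assms(1,2)])
  have li: "l \<noteq> i" using less.prems by auto
  then have \<eta>l: "\<eta> l = \<zeta> l" by (simp add: \<eta>_def reflect_height_def)
  have "phi \<eta> (l, r) $ i = 0"
  proof (cases "even (r - \<eta> l)")
    case False
    then show ?thesis by (simp add: phi_def omega_def)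
  next
    case True
    show ?thesis
    proof (cases "r = \<zeta> l")
      case True
      obtain c where c: "cox \<eta> = act c" using cox_act [OF h] by blast
      have sink: "omega \<eta> (i, \<eta> i + 2) = fweight i - simple_root i"
      proof (rule omega_sink [OF h])
        fix j assume j: "adjacent A i j"
        then have "j \<noteq> i" by (auto simp: adjacent_def)
        then show "\<eta> j = \<eta> i + 1"
          using source_lower [OF assms(1,2) j] by (simp add: \<eta>_def reflect_height_def)
      qed
      have "act c (fweight i - simple_root i) = fweight i"
        using omega_cox [OF h, of i "\<eta> i + 2"] by (simp only: sink c) simp
      then have "form (act c (fweight l)) (fweight i) = form (fweight l) (fweight i - simple_root i)"
        using form_act [of c "fweight l" "fweight i - simple_root i"] by simp
      also have "\<dots> = form (fweight l) (fweight i)"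
        using form_commute [of "fweight l" "simple_root i"] li
        by (simp add: form_diff_right form_simple_root)
      finally have "d i * (fweight l - act c (fweight l)) $ i = 0"
        unfolding form_fweight [symmetric] form_diff_left by simp
      moreover have "phi \<eta> (l, \<eta> l) = fweight l - act c (fweight l)"
        using omega_cox [OF h, of l "\<eta> l"] by (simp add: phi_def c)
      ultimately show ?thesis using d_pos [of i] True \<eta>l by simp
    next
      case False
      then have r: "\<zeta> l + 2 \<le> r" using True less.prems(2) unfolding \<eta>l by presburger
      have "Min (range \<zeta>) \<le> \<zeta> l" by simp
      then have small: "Min (range \<zeta>) < r" using r by linarith
      have "phi \<eta> (l, r - 2) $ i = 0"
        unfolding \<eta>_def using r li less.prems(3) small by (intro less.hyps) auto
      moreover have "of_int (A $ j $ l) * phi \<eta> (j, r - 1) $ i = 0" if "j \<noteq> l" for j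
      proof (cases "adjacent A l j")
        case True
        then have "\<zeta> j \<le> r - 1" using heightD [OF assms(1) True] r by auto
        then have "phi \<eta> (j, r - 1) $ i = 0"
          unfolding \<eta>_def using less.prems(3) small \<open>\<zeta> j \<le> r - 1\<close> by (intro less.hyps) auto
        then show ?thesis by simp
      qed (use that not_adjacent_cartan in auto)
      then have "(\<Sum>j\<in>UNIV - {l}. of_int (A $ j $ l) * phi \<eta> (j, r - 1) $ i) = 0"
        by (intro sum.neutral) auto
      ultimately show ?thesis
        using arg_cong [OF mesh_additiveD [OF phi_mesh_additive [OF h], of l "r - 1"], of "\<lambda>v. v $ i"]
        by simp
    qed
  qed
  then show ?case by (simp add: \<eta>_def)
qed

lemma not_cless_far:
  assumes "height \<xi>" "(i, p) \<in> AR \<xi>" "(j, s) \<in> AR \<xi>" "layers \<le> p - s"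
  shows "\<not> cless n (cpair (i, p) (j, s))"
proof
  define x y where "x = (i, p)" and "y = (j, s)"
  assume "cless n (cpair (i, p) (j, s))"
  then have c: "cless n (cpair x y)" by (simp add: x_def y_def)
  have lt: "snd y < snd x" using assms(4) layers_bounds(1) by (simp add: x_def y_def)
  have nyx: "\<not> reach y x" using reach_snd [of y x] lt by auto
  have xAR: "x \<in> AR \<xi>" "y \<in> AR \<xi>" using assms(2,3) by (auto simp: x_def y_def)
  have xy: "reach x y" using not_cless_incomparable [OF assms(1) xAR _ nyx] c by blast
  have above: "reach x z" if z: "n z \<noteq> cpair x y z" for z
  proof -
    obtain a where a: "n a < cpair x y a" "reach a z" using cless_lower [OF c z] .
    then show ?thesis using cpair_less [OF a(1)] xy rtranclp_trans by metis
  qed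
  have xD: "n x \<noteq> cpair x y x"
  proof
    assume nx: "n x = cpair x y x"
    show False
    proof (rule cless_not_only_less [OF assms(1) c])
      fix z assume z: "n z \<noteq> cpair x y z"
      obtain a where a: "n a < cpair x y a" "reach a z" using cless_lower [OF c z] .
      obtain b where b: "n b < cpair x y b" "reach z b" using cless_upper [OF c z] .
      have "a = y" "b = y" using cpair_less [OF a(1)] cpair_less [OF b(1)] nx a(1) b(1) by auto
      then have "z = y" using reach_antisym a(2) b(2) by blast
      then show "n z < cpair x y z \<and> z \<in> AR \<xi>" using a(1) \<open>a = y\<close> xAR by simp
    qed
  qed
  have nx: "n x = 0"
  proof -
    obtain a where a: "n a < cpair x y a" "reach a x" using cless_lower [OF c xD] .
    then have "a = x" using cpair_less [OF a(1)] nyx by blast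
    then show ?thesis using cpair_less [OF a(1)] by simp
  qed
  have supp: "supported \<xi> (cpair x y)" using xAR by (auto simp: supported_def cpair_def)
  obtain \<zeta> where \<zeta>: "height \<zeta>" "\<And>j. \<zeta> j \<le> \<xi> j" "\<zeta> i = p" "source \<zeta> i"
    and pos: "\<And>z. z \<in> AR \<xi> \<Longrightarrow> reach x z \<Longrightarrow> z \<noteq> x \<Longrightarrow> nonneg (phi (reflect_height i \<zeta>) z)"
    using advance_to [OF assms(1,2)] unfolding x_def by metis
  define \<eta> where "\<eta> = reflect_height i \<zeta>"
  have h: "height \<eta>" unfolding \<eta>_def by (rule height_reflect [OF \<zeta>(1,4)])
  define coord where "coord z = phi \<eta> z $ i" for z
  have "coord x = -1"
    using phi_reflect [OF \<zeta>(1,4), of "(i, p)"] phi_source [OF \<zeta>(1,4)] \<zeta>(3)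
    by (simp add: coord_def x_def \<eta>_def)
  \<comment> \<open>Periodicity moves (j, s) up by \<open>layers\<close> into column
    \<open>star j\<close>. Being in the strip, it then lies above \<zeta>, and \<open>layers\<close>
    \<le> p - s keeps it at height at most p, the range of
    \<open>phi_coordinate_above\<close>.\<close>
  have "coord y = 0"
  proof -
    have "phi \<eta> (j, s) = - phi \<eta> (star j, s + layers)"
    proof -
      have "omega \<eta> (j, s - 2) = - omega \<eta> (star j, s - 2 + layers)"
        using periodicD(2) [OF height_periodic [OF h], of j "s - 2 + layers"] by simp
      moreover have "omega \<eta> (j, s) = - omega \<eta> (star j, s + layers)"
        using periodicD(2) [OF height_periodic [OF h], of j "s + layers"] by simp
      ultimately show ?thesis by (simp add: phi_def algebra_simps)
    qed
    moreover have "\<zeta> (star j) < s + layers"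
      using assms(3) \<zeta>(2) [of "star j"] by (simp add: AR_iff)
    then have "phi \<eta> (star j, s + layers) $ i = 0"
      unfolding \<eta>_def using \<zeta>(3) assms(4)
      by (intro phi_coordinate_above [OF \<zeta>(1,4)]) auto
    ultimately show ?thesis by (simp add: coord_def y_def)
  qed
  have add: "mesh_additive coord"
  proof -
    have "linear (\<lambda>v :: real ^ 'n. v $ i)" by (rule linearI) simp_all
    from mesh_additive_linear [OF this phi_mesh_additive [OF h]] show ?thesis
      unfolding coord_def .
  qed
  define D where "D = {z. n z \<noteq> cpair x y z}"
  have fin: "finite D" using c unfolding cless_def D_def by blast
  have "(\<Sum>z\<in>D. (real (n z) - real (cpair x y z)) * coord z) = 0"
    using c add unfolding cless_def D_def by blast
  \<comment> \<open>Compares coordinates at i of the two weights on the differences: nonnegative for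
    n, which vanishes at x, but -1 for the pair.\<close>
  then have "(\<Sum>z\<in>D. real (n z) * coord z) = (\<Sum>z\<in>D. real (cpair x y z) * coord z)"
    by (simp add: left_diff_distrib sum_subtractf)
  moreover have "0 \<le> (\<Sum>z\<in>D. real (n z) * coord z)"
  proof (rule sum_nonneg)
    fix z assume z: "z \<in> D"
    show "0 \<le> real (n z) * coord z"
    proof (cases "n z = 0")
      case False
      have "z \<in> AR \<xi>" using supportedD [OF cless_supported [OF assms(1) c supp] False] .
      moreover have "z \<noteq> x" using False nx by auto
      moreover have "reach x z" using above z by (simp add: D_def)
      ultimately have "0 \<le> coord z" using pos [of z] by (simp add: coord_def \<eta>_def nonneg_def)
      then show ?thesis by simp
    qed simp
  qed
  moreover have "(\<Sum>z\<in>D. real (cpair x y z) * coord z) = -1"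
  proof -
    have "(\<Sum>z\<in>D. real (cpair x y z) * coord z) = (\<Sum>z\<in>D. if z = x then -1 else 0)"
      by (rule sum.cong) (use \<open>coord x = -1\<close> \<open>coord y = 0\<close> in \<open>auto simp: cpair_def\<close>)
    then show ?thesis using fin xD by (simp add: D_def)
  qed
  ultimately show False by simp
qed


subsection \<open>The value attached to a distance\<close>

text \<open>Coincident positions are excluded because \<open>quiver_less_eq\<close> is reflexive, so
  a pair consists of distinct roots.\<close>

definition realized :: "('n \<Rightarrow> int) \<Rightarrow> 'n \<Rightarrow> 'n \<Rightarrow> nat \<Rightarrow> bool" where
  "realized \<xi> i j k \<longleftrightarrow> (\<exists>p s. (i, p) \<in> AR \<xi> \<and> (j, s) \<in> AR \<xi> \<and> \<bar>p - s\<bar> = int k \<and> (i, p) \<noteq> (j, s))"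

lemma pairs_at_distance_deg:
  assumes "height \<xi>" "(\<alpha>, \<beta>) \<in> pairs_at_distance A \<xi> i j k"
  shows "realized \<xi> i j k \<and> exponent_deg A \<xi> (pair_exponent \<alpha> \<beta>) = distance_deg i j k"
proof -
  from assms(2) obtain p s where q: "\<not> quiver_less_eq A \<xi> \<beta> \<alpha>"
    and ps: "(i, p) \<in> AR \<xi>" "(j, s) \<in> AR \<xi>" "\<bar>p - s\<bar> = int k"
    and ab: "{\<alpha>, \<beta>} = {AR_coordinate A \<xi> (i, p), AR_coordinate A \<xi> (j, s)}"
    by (auto simp: pairs_at_distance_def quiver_pairs_def)
  have ab: "{\<alpha>, \<beta>} = {phi \<xi> (i, p), phi \<xi> (j, s)}"
    using ab AR_coordinate_eq [OF assms(1) ps(1)] AR_coordinate_eq [OF assms(1) ps(2)] by simp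
  have "\<alpha> \<noteq> \<beta>" using q by (auto simp: quiver_less_eq_def)
  then have "(i, p) \<noteq> (j, s)" using ab by (metis doubleton_eq_iff insert_absorb2)
  moreover have "pair_exponent \<alpha> \<beta> = pair_exponent (phi \<xi> (i, p)) (phi \<xi> (j, s))"
    using ab by (auto simp: pair_exponent_def doubleton_eq_iff)
  ultimately show ?thesis
    using ps pair_exponent_deg [OF assms(1) ps(1,2)] cdeg_distance [OF ps(3)]
    by (auto simp: realized_def)
qed

text \<open>A single word orders two distinct roots in only one way, so at least one ordering of
  them is a pair.\<close>

lemma realized_pairs:
  assumes "height \<xi>" "realized \<xi> i j k"
  shows "pairs_at_distance A \<xi> i j k \<noteq> {}"
proof -
  obtain p s where ps: "(i, p) \<in> AR \<xi>" "(j, s) \<in> AR \<xi>" "\<bar>p - s\<bar> = int k" "(i, p) \<noteq> (j, s)"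
    using assms(2) by (auto simp: realized_def)
  define \<alpha> \<beta> where "\<alpha> = phi \<xi> (i, p)" and "\<beta> = phi \<xi> (j, s)"
  have pos: "\<alpha> \<in> positive_roots A" "\<beta> \<in> positive_roots A"
    using bij_betwE [OF phi_bij [OF assms(1)]] ps(1,2) by (auto simp: \<alpha>_def \<beta>_def)
  have "\<alpha> \<noteq> \<beta>"
    using phi_bij [OF assms(1)] ps unfolding \<alpha>_def \<beta>_def by (metis bij_betw_imp_inj_on inj_on_eq_iff)
  obtain w where w: "w \<in> commutation_class A \<xi>" using class_word_exists [OF assms(1)] by metis
  have lin: "linear_extension reach (AR \<xi>) (track \<xi> w)" by (rule class_linear_extension [OF assms(1) w])
  then obtain u v where uv: "track \<xi> w = u @ (i, p) # v"
    using ps(1) by (metis linear_extension_def split_list)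
  have "\<not> (word_less A w \<alpha> \<beta> \<and> word_less A w \<beta> \<alpha>)"
    using word_less_split [OF assms(1) w uv ps(2)] lin uv
    by (auto simp: linear_extension_def \<alpha>_def \<beta>_def)
  then have "\<not> quiver_less_eq A \<xi> \<alpha> \<beta> \<or> \<not> quiver_less_eq A \<xi> \<beta> \<alpha>"
    using w \<open>\<alpha> \<noteq> \<beta>\<close> by (auto simp: quiver_less_eq_def quiver_less_def)
  moreover have "AR_coordinate A \<xi> (i, p) = \<alpha>" "AR_coordinate A \<xi> (j, s) = \<beta>"
    using AR_coordinate_eq [OF assms(1)] ps(1,2) by (auto simp: \<alpha>_def \<beta>_def)
  ultimately have "(\<alpha>, \<beta>) \<in> pairs_at_distance A \<xi> i j k \<or> (\<beta>, \<alpha>) \<in> pairs_at_distance A \<xi> i j k"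
    using pos ps(1-3) unfolding pairs_at_distance_def quiver_pairs_def by blast
  then show ?thesis by blast
qed

lemma is_o_value_iff:
  assumes "height \<xi>"
  shows "is_o_value A \<xi> i j k n \<longleftrightarrow> n = (if realized \<xi> i j k then distance_deg i j k else 0)"
proof (cases "realized \<xi> i j k")
  case True
  then have "pairs_at_distance A \<xi> i j k \<noteq> {}" by (rule realized_pairs [OF assms])
  then obtain \<alpha> \<beta> where ab: "(\<alpha>, \<beta>) \<in> pairs_at_distance A \<xi> i j k" by auto
  have "is_o_value A \<xi> i j k n \<longleftrightarrow> n = distance_deg i j k"
    unfolding is_o_value_def using pairs_at_distance_deg [OF assms] ab by fastforce
  then show ?thesis using True by simp
next
  case False
  then have "pairs_at_distance A \<xi> i j k = {}" using pairs_at_distance_deg [OF assms] by auto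
  then show ?thesis using False by (simp add: is_o_value_def)
qed

lemma o_value_eq:
  "height \<xi> \<Longrightarrow> o_value A \<xi> i j k = (if realized \<xi> i j k then distance_deg i j k else 0)"
  unfolding o_value_def by (rule the_equality) (simp_all add: is_o_value_iff)

lemma height_dual: "height \<xi> \<Longrightarrow> height (dual_height A \<xi>)"
  by (auto simp: height_function_def dual_height_def)

lemma realized_commute: "realized \<xi> i j k \<longleftrightarrow> realized \<xi> j i k"
  unfolding realized_def by (metis abs_minus_commute)

text \<open>The upper position is the top of column i; the inequalities place \<xi> i - k inside
  column j.\<close>

lemma realizedI:
  assumes "height \<xi>" "\<bar>\<xi> i - \<xi> j\<bar> \<le> int k" "even (\<xi> i - \<xi> j - int k)"
    "int k < \<xi> i - \<xi> (star j) + layers" "i \<noteq> j \<or> k \<noteq> 0"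
  shows "realized \<xi> i j k"
proof -
  have "even (\<xi> i - int k - \<xi> j)" using assms(3) by presburger
  then have "(j, \<xi> i - int k) \<in> AR \<xi>" using assms(2,4) by (simp add: AR_iff)
  moreover have "(i, \<xi> i) \<in> AR \<xi>" by (rule slice_in_AR [OF assms(1)])
  ultimately show ?thesis using assms(5) unfolding realized_def
    by (intro exI [of _ "\<xi> i"] exI [of _ "\<xi> i - int k"]) auto
qed

lemma height_parity:
  assumes "height \<xi>" "height \<eta>"
  shows "even (\<xi> i - \<xi> j - (\<eta> i - \<eta> j))"
proof -
  have "even (\<xi> i - \<xi> j - (\<eta> i - \<eta> j))" if "(adjacent A)\<^sup>*\<^sup>* i j"
    using that
  proof (induction rule: rtranclp_induct)
    case (step j l)
    then show ?case using heightD [OF assms(1) step.hyps(2)] heightD [OF assms(2) step.hyps(2)] by auto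
  qed simp
  then show ?thesis using connected by blast
qed

text \<open>A nonzero degree forces a comparable pair and k < \<open>layers\<close>. Comparability
  bounds the difference of any height function at i and j by k, so only the lower boundary can
  obstruct. If \<xi> (star i) \<le> \<xi> j, there is room in Q with j on top; otherwise there is
  room in the dual quiver with i on top.\<close>

lemma realized_transfer:
  assumes h: "height \<xi>" "height \<xi>'" and r: "realized \<xi>' i j k" and nz: "distance_deg i j k \<noteq> 0"
  shows "realized \<xi> i j k \<or> realized (dual_height A \<xi>) i j k"
proof -
  obtain p s where ps: "(i, p) \<in> AR \<xi>'" "(j, s) \<in> AR \<xi>'" "\<bar>p - s\<bar> = int k" "(i, p) \<noteq> (j, s)"
    using r by (auto simp: realized_def)
  have "cdeg (cpair (i, p) (j, s)) \<noteq> 0" using cdeg_distance [OF ps(3)] nz by simp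
  obtain n where n: "cless n (cpair (i, p) (j, s))"
  proof (rule ccontr)
    assume "\<not> thesis"
    then have "cdeg (cpair (i, p) (j, s)) = 0" using that by (intro cdeg_zero) blast
    then show False using \<open>cdeg (cpair (i, p) (j, s)) \<noteq> 0\<close> by simp
  qed
  then have comparable: "reach (i, p) (j, s) \<or> reach (j, s) (i, p)"
    using not_cless_incomparable [OF h(2) ps(1,2)] by blast
  have "\<not> layers \<le> p - s" using not_cless_far [OF h(2) ps(1,2)] n by blast
  moreover have "\<not> layers \<le> s - p"
    using not_cless_far [OF h(2) ps(2,1)] n cpair_commute by metis
  ultimately have k: "int k < layers" using ps(3) by linarith
  have close: "\<bar>\<eta> i - \<eta> j\<bar> \<le> int k" if "height \<eta>" for \<eta>
    using comparable reach_height [of "(i, p)" "(j, s)" \<eta>] reach_height [of "(j, s)" "(i, p)" \<eta>] that ps(3)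
    by auto
  have par: "even (\<eta> i - \<eta> j - int k)" if "height \<eta>" for \<eta>
  proof -
    have "even (p - \<xi>' i)" "even (s - \<xi>' j)" using ps(1,2) by (auto simp: AR_iff)
    then have "even (\<xi>' i - \<xi>' j - int k)" using ps(3) by presburger
    then show ?thesis using height_parity [OF that h(2), of i j] by presburger
  qed
  have ne: "i \<noteq> j \<or> k \<noteq> 0" using ps(3,4) by auto
  have close': "\<bar>\<eta> j - \<eta> i\<bar> \<le> int k" and par': "even (\<eta> j - \<eta> i - int k)" if "height \<eta>" for \<eta>
    using close [OF that] par [OF that] by (linarith, presburger)
  show ?thesis
  proof (cases "\<xi> (star i) \<le> \<xi> j")
    case True
    then have "realized \<xi> j i k"
      using realizedI [OF h(1) close' [OF h(1)] par' [OF h(1)]] k ne by auto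
    then show ?thesis using realized_commute by blast
  next
    case False
    note hd = height_dual [OF h(1)]
    have "int k < dual_height A \<xi> i - dual_height A \<xi> (star j) + layers"
      using False k by (simp add: dual_height_def)
    then have "realized (dual_height A \<xi>) i j k"
      using realizedI [OF hd close [OF hd] par [OF hd]] ne by blast
    then show ?thesis by blast
  qed
qed

lemma O_value_eq:
  assumes "height \<xi>" "height \<xi>'"
  shows "O_value A \<xi> i j k = O_value A \<xi>' i j k"
proof (cases "distance_deg i j k = 0")
  case False
  have dd: "dual_height A (dual_height A \<zeta>) = \<zeta>" for \<zeta> by (simp add: dual_height_def)
  have "realized \<xi> i j k \<or> realized (dual_height A \<xi>) i j k \<longleftrightarrow>
      realized \<xi>' i j k \<or> realized (dual_height A \<xi>') i j k"
    using realized_transfer [OF _ _ _ False] assms height_dual dd by metis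
  then show ?thesis
    using o_value_eq [OF assms(1), of i j k] o_value_eq [OF height_dual [OF assms(1)], of i j k]
      o_value_eq [OF assms(2), of i j k] o_value_eq [OF height_dual [OF assms(2)], of i j k]
    by (auto simp: O_value_def)
qed (simp add: O_value_def o_value_eq assms height_dual)

end

lemma finite_cartan_exists:
  assumes "finite_type_cartan_matrix A"
  obtains d where "finite_cartan A d"
proof -
  obtain d :: "'a \<Rightarrow> real" where "\<forall>i. 0 < d i"
    "\<forall>i j. d i * of_int (A $ i $ j) = d j * of_int (A $ j $ i)"
    "\<forall>v :: real ^ 'a. v \<noteq> 0 \<longrightarrow>
       0 < (\<Sum>i\<in>UNIV. \<Sum>j\<in>UNIV. d i * of_int (A $ i $ j) * v $ i * v $ j)"
    using assms unfolding finite_type_cartan_matrix_def symmetrizable_pos_def_def by blast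
  then have "finite_cartan A d"
    using assms
    by unfold_locales
      (auto simp: finite_type_cartan_matrix_def generalized_cartan_matrix_def indecomposable_def)
  then show thesis by (rule that)
qed

theorem proposition6p1:
  fixes A :: "int ^ 'n::finite ^ 'n"
  assumes "finite_type_cartan_matrix A"
  shows
    "(\<forall>\<xi> i j k. height_function A \<xi> \<longrightarrow>
        (\<forall>(\<alpha>, \<beta>)\<in>pairs_at_distance A \<xi> i j k. \<forall>(\<alpha>', \<beta>')\<in>pairs_at_distance A \<xi> i j k.
           exponent_deg A \<xi> (pair_exponent \<alpha> \<beta>) = exponent_deg A \<xi> (pair_exponent \<alpha>' \<beta>')) \<and>
        (\<exists>!d. is_o_value A \<xi> i j k d)) \<and>
     (\<forall>\<xi> \<xi>' i j k. height_function A \<xi> \<longrightarrow> height_function A \<xi>' \<longrightarrow>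
        O_value A \<xi> i j k = O_value A \<xi>' i j k)"
proof -
  obtain d where "finite_cartan A d" using finite_cartan_exists [OF assms] .
  then interpret finite_cartan A d .
  show ?thesis
  proof (intro conjI allI impI)
    fix \<xi> :: "'n \<Rightarrow> int" and i j k assume h: "height_function A \<xi>"
    show "\<forall>(\<alpha>, \<beta>)\<in>pairs_at_distance A \<xi> i j k. \<forall>(\<alpha>', \<beta>')\<in>pairs_at_distance A \<xi> i j k.
        exponent_deg A \<xi> (pair_exponent \<alpha> \<beta>) = exponent_deg A \<xi> (pair_exponent \<alpha>' \<beta>')"
      using pairs_at_distance_deg [OF h] by fastforce
    show "\<exists>!d. is_o_value A \<xi> i j k d" unfolding is_o_value_iff [OF h] by simp
  next
    fix \<xi> \<xi>' :: "'n \<Rightarrow> int" and i j k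
    assume "height_function A \<xi>" "height_function A \<xi>'"
    then show "O_value A \<xi> i j k = O_value A \<xi>' i j k" by (rule O_value_eq)
  qed
qed

end
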